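(* Let $X$ be a smooth $4$-dimensional manifold with a smooth Riemannian metric $\mathbf{g}$, and let $x\in X$. Then $\mathbf{g}$ can be block-diagonalised near $x$ if and only if, on some neighbourhood of $x$, $\mathbf{g}$ admits an orthonormal coframe $\{\boldsymbol{\epsilon}^a : a=1,\dots,4\}$ that satisfies the relations $$\boldsymbol{\epsilon}^1\wedge\boldsymbol{\epsilon}^2\wedge d\boldsymbol{\epsilon}^1=0,\qquad \boldsymbol{\epsilon}^1\wedge\boldsymbol{\epsilon}^2\wedge d\boldsymbol{\epsilon}^2=0,\qquad \boldsymbol{\epsilon}^3\wedge\boldsymbol{\epsilon}^4\wedge d\boldsymbol{\epsilon}^3=0,\qquad \boldsymbol{\epsilon}^3\wedge\boldsymbol{\epsilon}^4\wedge d\boldsymbol{\epsilon}^4=0 .$$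
   Context: "$\mathbf{g}$ can be block-diagonalised near $x$" means that there are local coordinates $(x^1,x^2,x^3,x^4)$ on some neighbourhood of $x$ in which $g_{\alpha\beta}=0$ for $(\alpha,\beta)\in\{(1,3),(1,4),(2,3),(2,4)\}$. An orthonormal coframe is a collection of $1$-forms $\boldsymbol{\epsilon}^a$ with $\mathbf{g}=\sum_a \boldsymbol{\epsilon}^a\otimes\boldsymbol{\epsilon}^a$. *)

theory Defs
  imports "HOL-Analysis.Analysis" "HOL-Combinatorics.Permutations"
begin

section \<open>Smooth maps\<close>

text \<open>
  For open \<open>S\<close> in a finite-dimensional space, \<open>Ck_on k S f\<close> says that all iterated directional
  derivatives of \<open>f\<close> of order at most \<open>k\<close> exist and are continuous on \<open>S\<close>. It is only used for
  open \<open>S\<close>.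
\<close>

primrec Ck_on :: "nat \<Rightarrow> 'a::real_normed_vector set \<Rightarrow> ('a \<Rightarrow> 'b::real_normed_vector) \<Rightarrow> bool" where
  "Ck_on 0 S f \<longleftrightarrow> continuous_on S f"
| "Ck_on (Suc k) S f \<longleftrightarrow>
     (\<forall>x\<in>S. f differentiable (at x)) \<and> (\<forall>v. Ck_on k S (\<lambda>x. frechet_derivative f (at x) v))"

definition smooth_on :: "'a::real_normed_vector set \<Rightarrow> ('a \<Rightarrow> 'b::real_normed_vector) \<Rightarrow> bool" where
  "smooth_on S f \<longleftrightarrow> (\<forall>k. Ck_on k S f)"

section \<open>Smooth manifolds\<close>

text \<open>
  A chart is a pair \<open>(U, \<phi>)\<close>; the values of \<open>\<phi>\<close> outside \<open>U\<close> are irrelevant. The dimension of the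
  manifold is \<open>CARD('n)\<close>.
\<close>

type_synonym ('a, 'n) chart = "'a set \<times> ('a \<Rightarrow> real ^ 'n)"

definition is_chart :: "'a topology \<Rightarrow> ('a, 'n::finite) chart \<Rightarrow> bool" where
  "is_chart X c \<longleftrightarrow> openin X (fst c) \<and> open (snd c ` fst c) \<and>
     homeomorphic_map (subtopology X (fst c)) (top_of_set (snd c ` fst c)) (snd c)"

definition transition :: "('a, 'n::finite) chart \<Rightarrow> ('a, 'n) chart \<Rightarrow> real ^ 'n \<Rightarrow> real ^ 'n" where
  "transition c d y = snd d (inv_into (fst c) (snd c) y)"

definition compatible :: "('a, 'n::finite) chart \<Rightarrow> ('a, 'n) chart \<Rightarrow> bool" where
  "compatible c d \<longleftrightarrow> smooth_on (snd c ` (fst c \<inter> fst d)) (transition c d) \<and>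
                     smooth_on (snd d ` (fst c \<inter> fst d)) (transition d c)"

definition smooth_manifold :: "'a topology \<Rightarrow> ('a, 'n::finite) chart set \<Rightarrow> bool" where
  "smooth_manifold X A \<longleftrightarrow> Hausdorff_space X \<and> second_countable X \<and>
     (\<forall>c\<in>A. is_chart X c) \<and> (\<Union>c\<in>A. fst c) = topspace X \<and> (\<forall>c\<in>A. \<forall>d\<in>A. compatible c d)"

text \<open>
  The local coordinate systems of the manifold are the charts of the maximal atlas generated by
  \<open>A\<close>.
\<close>

definition local_coords :: "'a topology \<Rightarrow> ('a, 'n::finite) chart set \<Rightarrow> ('a, 'n) chart set" where
  "local_coords X A = {c. is_chart X c \<and> (\<forall>d\<in>A. compatible c d)}"

section \<open>Covariant tensor fields\<close>

text \<open>
  A covariant tensor field of rank \<open>k\<close> is given by its expressions in all local coordinate systems,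
  related by pullback along the transition maps. Its value at the point with coordinates \<open>y\<close>
  in the chart \<open>c\<close> is a \<open>k\<close>-linear function of the tangent vectors \<open>v 0, \<dots>, v (k - 1)\<close>, each given
  by its components with respect to \<open>c\<close>; the remaining entries of \<open>v\<close> are ignored. Values at
  \<open>y\<close> outside the image of the domain under \<open>c\<close> carry no information, so tensor fields on \<open>W\<close> are
  compared by \<open>tensor_eq_on\<close>.
\<close>

type_synonym ('a, 'n) tensor = "('a, 'n) chart \<Rightarrow> real ^ 'n \<Rightarrow> (nat \<Rightarrow> real ^ 'n) \<Rightarrow> real"

definition k_linear :: "nat \<Rightarrow> ((nat \<Rightarrow> real ^ 'n::finite) \<Rightarrow> real) \<Rightarrow> bool" where
  "k_linear k f \<longleftrightarrow> (\<forall>v w. (\<forall>i<k. v i = w i) \<longrightarrow> f v = f w) \<and>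
                    (\<forall>v. \<forall>i<k. linear (\<lambda>u. f (v(i := u))))"

definition tensor_field_on ::
  "'a topology \<Rightarrow> ('a, 'n::finite) chart set \<Rightarrow> nat \<Rightarrow> 'a set \<Rightarrow> ('a, 'n) tensor \<Rightarrow> bool" where
  "tensor_field_on X A k W T \<longleftrightarrow>
     (\<forall>c\<in>local_coords X A.
        (\<forall>y\<in>snd c ` (fst c \<inter> W). k_linear k (T c y)) \<and>
        (\<forall>v. smooth_on (snd c ` (fst c \<inter> W)) (\<lambda>y. T c y v))) \<and>
     (\<forall>c\<in>local_coords X A. \<forall>d\<in>local_coords X A. \<forall>y\<in>snd c ` (fst c \<inter> fst d \<inter> W). \<forall>v.
        T c y v = T d (transition c d y) (\<lambda>i. frechet_derivative (transition c d) (at y) (v i)))"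

definition tensor_eq_on ::
  "'a topology \<Rightarrow> ('a, 'n::finite) chart set \<Rightarrow> 'a set \<Rightarrow> ('a, 'n) tensor \<Rightarrow> ('a, 'n) tensor \<Rightarrow> bool"
where
  "tensor_eq_on X A W S T \<longleftrightarrow>
     (\<forall>c\<in>local_coords X A. \<forall>y\<in>snd c ` (fst c \<inter> W). \<forall>v. S c y v = T c y v)"

definition zero_tensor :: "('a, 'n::finite) tensor" where
  "zero_tensor = (\<lambda>c y v. 0)"

definition tensor_prod ::
  "nat \<Rightarrow> ('a, 'n::finite) tensor \<Rightarrow> ('a, 'n) tensor \<Rightarrow> ('a, 'n) tensor" where
  "tensor_prod k S T = (\<lambda>c y v. S c y v * T c y (\<lambda>i. v (k + i)))"

section \<open>Differential forms\<close>

text \<open>Every covariant tensor field of rank 1 is alternating.\<close>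

abbreviation one_form_on ::
  "'a topology \<Rightarrow> ('a, 'n::finite) chart set \<Rightarrow> 'a set \<Rightarrow> ('a, 'n) tensor \<Rightarrow> bool" where
  "one_form_on X A \<equiv> tensor_field_on X A 1"

text \<open>
  Wedge product of a \<open>k\<close>-form and an \<open>l\<close>-form, normalised such that
  \<open>(dx \<and> dy) (v 0, v 1) = dx (v 0) * dy (v 1) - dx (v 1) * dy (v 0)\<close>.
\<close>

definition wedge ::
  "nat \<Rightarrow> nat \<Rightarrow> ('a, 'n::finite) tensor \<Rightarrow> ('a, 'n) tensor \<Rightarrow> ('a, 'n) tensor" where
  "wedge k l \<omega> \<eta> = (\<lambda>c y v.
     (\<Sum>\<sigma> | \<sigma> permutes {..<k + l}.
        of_int (sign \<sigma>) * tensor_prod k \<omega> \<eta> c y (\<lambda>i. v (\<sigma> i))) / (fact k * fact l))"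

text \<open>
  Exterior derivative of a \<open>k\<close>-form:
  \<open>d\<omega> (v 0, \<dots>, v k)\<close> is the sum over \<open>i \<le> k\<close> of \<open>(- 1) ^ i\<close> times the derivative in direction \<open>v i\<close>
  of \<open>\<omega>\<close> applied to the constant vectors \<open>v 0, \<dots>, v k\<close> without \<open>v i\<close>.
\<close>

definition ext_deriv :: "nat \<Rightarrow> ('a, 'n::finite) tensor \<Rightarrow> ('a, 'n) tensor" where
  "ext_deriv k \<omega> = (\<lambda>c y v. \<Sum>i\<le>k. (- 1) ^ i *
     frechet_derivative (\<lambda>z. \<omega> c z (\<lambda>j. if j < i then v j else v (Suc j))) (at y) (v i))"

section \<open>Riemannian metrics\<close>

definition riemannian_metric ::
  "'a topology \<Rightarrow> ('a, 'n::finite) chart set \<Rightarrow> ('a, 'n) tensor \<Rightarrow> bool" where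
  "riemannian_metric X A g \<longleftrightarrow> tensor_field_on X A 2 (topspace X) g \<and>
     (\<forall>c\<in>local_coords X A. \<forall>y\<in>snd c ` fst c.
        (\<forall>u w. g c y (\<lambda>i. if i = 0 then u else w) = g c y (\<lambda>i. if i = 0 then w else u)) \<and>
        (\<forall>u. u \<noteq> 0 \<longrightarrow> g c y (\<lambda>i. u) > 0))"

text \<open>The component \<open>g\<^sub>\<alpha>\<^sub>\<beta>\<close> of a rank 2 tensor in the coordinates \<open>c\<close>.\<close>

definition component ::
  "('a, 'n::finite) tensor \<Rightarrow> ('a, 'n) chart \<Rightarrow> real ^ 'n \<Rightarrow> 'n \<Rightarrow> 'n \<Rightarrow> real" where
  "component g c y \<alpha> \<beta> = g c y (\<lambda>i. if i = 0 then axis \<alpha> 1 else axis \<beta> 1)"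

definition orthonormal_coframe_on ::
  "'a topology \<Rightarrow> ('a, 'n::finite) chart set \<Rightarrow> ('a, 'n) tensor \<Rightarrow> 'a set
     \<Rightarrow> ('n \<Rightarrow> ('a, 'n) tensor) \<Rightarrow> bool" where
  "orthonormal_coframe_on X A g W \<epsilon> \<longleftrightarrow> (\<forall>a. one_form_on X A W (\<epsilon> a)) \<and>
     tensor_eq_on X A W g (\<lambda>c y v. \<Sum>a\<in>UNIV. tensor_prod 1 (\<epsilon> a) (\<epsilon> a) c y v)"

text \<open>The four elements of the index type \<open>4\<close> are \<open>1, 2, 3, 4\<close>, where \<open>4 = 0\<close>.\<close>

definition block_diagonalisable_near ::
  "'a topology \<Rightarrow> ('a, 4) chart set \<Rightarrow> ('a, 4) tensor \<Rightarrow> 'a \<Rightarrow> bool" where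
  "block_diagonalisable_near X A g x \<longleftrightarrow>
     (\<exists>c\<in>local_coords X A. x \<in> fst c \<and>
        (\<forall>y\<in>snd c ` fst c. \<forall>(\<alpha>, \<beta>)\<in>{(1, 3), (1, 4), (2, 3), (2, 4)}. component g c y \<alpha> \<beta> = 0))"

end

theory Submission
  imports Defs
begin

text \<open>
  Gram-Schmidt within each block turns block-diagonal coordinates into a coframe whose first two members
  are combinations of \<open>dx\<^sup>1, dx\<^sup>2\<close> and whose last two members are combinations of \<open>dx\<^sup>3, dx\<^sup>4\<close>; the four
  wedge relations follow.

  Conversely, the relations say that \<open>d\<epsilon>\<^sup>1\<close> and \<open>d\<epsilon>\<^sup>2\<close> vanish on the common kernel of \<open>\<epsilon>\<^sup>1, \<epsilon>\<^sup>2\<close>, and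
  likewise for \<open>\<epsilon>\<^sup>3, \<epsilon>\<^sup>4\<close>, so both kernels are integrable. By Frobenius there are \<open>x\<^sup>1, x\<^sup>2\<close> whose
  differentials span the same space as \<open>\<epsilon>\<^sup>1, \<epsilon>\<^sup>2\<close>, and \<open>x\<^sup>3, x\<^sup>4\<close> for \<open>\<epsilon>\<^sup>3, \<epsilon>\<^sup>4\<close>; together they are
  coordinates in which the mixed components of the metric vanish.

  For the Frobenius theorem, vector fields in the kernel whose image under a fixed linear projection is
  constant commute, and their flows straighten the kernel. Flows depend smoothly on the initial value because they
  are fixed points of a contraction of the space of continuous curves: the derivative of a fixed point
  solves a linear fixed point equation whose coefficients are as smooth as the fixed point itself.
\<close>

section \<open>Calculus of \<open>C\<^sup>k\<close> maps\<close>

text \<open>\<open>Ck_on\<close> controls derivatives in fixed directions only. In finite dimensions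
  a varying direction is expanded in a basis. The space of curves that carries the flow is
  infinite-dimensional, so composition with a field is differentiated there only along parametrised
  families of curves.

  All contractions have constant 1/2. Time is rescaled by a factor \<open>\<delta>\<close> instead
  of being shortened, so that all curves are parametrised by [0,1] and lie in one Banach space. The
  affine equation \<open>x = c + L x\<close> with \<open>norm L \<le> 1/2\<close> yields derivatives
  of flows, inverses of Jacobians and the fields spanning a kernel; one regularity lemma serves all
  three.

  Mixed components vanish since the first two coordinate vectors are killed by the last two
  differentials, hence by \<open>\<epsilon>\<^sup>3, \<epsilon>\<^sup>4\<close>, and conversely:
  each product in the sum for the metric has a zero factor.

  Tensors are families of chart expressions, so the relations for the constructed coframe are
  checked in every chart. There the coordinate differentials become pullbacks, and that these are
  closed is the symmetry of second derivatives.\<close>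

lemma Ck_on_cong:
  assumes "open S" and "\<And>x. x \<in> S \<Longrightarrow> f x = g x" and "Ck_on k S f"
  shows "Ck_on k S g"
  using assms(2,3)
proof (induction k arbitrary: f g)
  case 0
  then show ?case using continuous_on_cong[of S S f g] by simp
next
  case (Suc k)
  have d: "(g has_derivative frechet_derivative f (at x)) (at x)" if "x \<in> S" for x
  proof -
    have "(f has_derivative frechet_derivative f (at x)) (at x)"
      using Suc.prems(2) that by (simp add: frechet_derivative_works[symmetric])
    then show ?thesis
      by (rule has_derivative_transform_within_open[OF _ \<open>open S\<close> that]) (rule Suc.prems(1))
  qed
  have eq: "frechet_derivative f (at x) = frechet_derivative g (at x)" if "x \<in> S" for x
    by (rule frechet_derivative_at[OF d[OF that]])
  have "Ck_on k S (\<lambda>x. frechet_derivative g (at x) v)" for v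
  proof (rule Suc.IH)
    show "Ck_on k S (\<lambda>x. frechet_derivative f (at x) v)" using Suc.prems(2) by simp
  qed (simp add: eq)
  moreover have "g differentiable at x" if "x \<in> S" for x
    by (rule differentiableI[OF d[OF that]])
  ultimately show ?case by simp
qed

text \<open>The recursion for \<open>Ck_on\<close> speaks of the selected
  \<open>frechet_derivative\<close>. On an open set derivatives are unique, so a derivative found by
  calculation may take its place.\<close>

lemma Ck_on_SucI:
  assumes "open S" and d: "\<And>x. x \<in> S \<Longrightarrow> (f has_derivative f' x) (at x)"
    and "\<And>v. Ck_on k S (\<lambda>x. f' x v)"
  shows "Ck_on (Suc k) S f"
proof -
  have eq: "f' x = frechet_derivative f (at x)" if "x \<in> S" for x
    by (rule frechet_derivative_at[OF d[OF that]])
  have "Ck_on k S (\<lambda>x. frechet_derivative f (at x) v)" for v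
    by (rule Ck_on_cong[OF \<open>open S\<close> _ assms(3)[of v]]) (simp add: eq)
  moreover have "f differentiable at x" if "x \<in> S" for x
    by (rule differentiableI[OF d[OF that]])
  ultimately show ?thesis by simp
qed

lemma Ck_on_Suc_has_derivative:
  "Ck_on (Suc k) S f \<Longrightarrow> x \<in> S \<Longrightarrow> (f has_derivative frechet_derivative f (at x)) (at x)"
  by (simp add: frechet_derivative_works[symmetric])

lemma Ck_on_SucD: "Ck_on (Suc k) S f \<Longrightarrow> Ck_on k S f"
proof (induction k arbitrary: f)
  case 0
  then show ?case
    by (auto intro!: differentiable_imp_continuous_on simp: differentiable_on_def differentiable_at_withinI)
next
  case (Suc k)
  then show ?case by simp
qed

lemma Ck_on_le: "Ck_on k S f \<Longrightarrow> j \<le> k \<Longrightarrow> Ck_on j S f"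
  by (induction k) (auto simp: le_Suc_eq dest: Ck_on_SucD simp del: Ck_on.simps(2))

lemma Ck_on_continuous_on: "Ck_on k S f \<Longrightarrow> continuous_on S f"
  using Ck_on_le[of k S f 0] by simp

lemma Ck_on_subset: "Ck_on k S f \<Longrightarrow> T \<subseteq> S \<Longrightarrow> Ck_on k T f"
  by (induction k arbitrary: f) (auto intro: continuous_on_subset)

lemma Ck_on_local:
  assumes "\<And>x. x \<in> S \<Longrightarrow> \<exists>T. open T \<and> x \<in> T \<and> Ck_on k T f"
  shows "Ck_on k S f"
  using assms
proof (induction k arbitrary: f)
  case 0
  then show ?case
    by (metis Ck_on.simps(1) continuous_at_imp_continuous_on continuous_on_eq_continuous_at)
next
  case (Suc k)
  have "Ck_on k S (\<lambda>x. frechet_derivative f (at x) v)" for v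
    by (rule Suc.IH) (use Suc.prems in fastforce)
  then show ?case using Suc.prems by fastforce
qed

lemma Ck_on_const: "Ck_on k S (\<lambda>x. c)"
  by (induction k arbitrary: c) (auto intro: continuous_intros)

lemma Ck_on_bounded_linear:
  assumes "bounded_linear f" "open S" shows "Ck_on k S f"
proof (cases k)
  case 0
  then show ?thesis using assms by (simp add: linear_continuous_on)
next
  case (Suc j)
  then show ?thesis
    by (auto intro!: Ck_on_SucI[OF assms(2) bounded_linear_imp_has_derivative[OF assms(1)]] Ck_on_const
        simp del: Ck_on.simps)
qed

lemma Ck_on_add:
  assumes "open S" "Ck_on k S f" "Ck_on k S g" shows "Ck_on k S (\<lambda>x. f x + g x)"
  using assms(2,3)
proof (induction k arbitrary: f g)
  case 0
  then show ?case by (auto intro: continuous_intros)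
next
  case (Suc k)
  have "Ck_on k S (\<lambda>x. frechet_derivative f (at x) v + frechet_derivative g (at x) v)" for v
    using Suc.prems by (intro Suc.IH) auto
  then show ?case
    by (intro Ck_on_SucI[OF assms(1) has_derivative_add[OF Ck_on_Suc_has_derivative Ck_on_Suc_has_derivative]])
      (use Suc.prems in auto)
qed

lemma Ck_on_sum:
  assumes "open S" "\<And>i. i \<in> I \<Longrightarrow> Ck_on k S (f i)" shows "Ck_on k S (\<lambda>x. \<Sum>i\<in>I. f i x)"
  using assms(2) by (induction I rule: infinite_finite_induct) (auto intro: Ck_on_const Ck_on_add[OF assms(1)])

text \<open>The product rule gives two terms of the same bilinear shape, so the induction closes
  once both factors are general. Products, scalings, application of operators and multiplication of
  curves are all instances.\<close>

lemma Ck_on_bilinear: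
  assumes B: "bounded_bilinear B" and "open S" "Ck_on k S f" "Ck_on k S g"
  shows "Ck_on k S (\<lambda>x. B (f x) (g x))"
  using assms(3,4)
proof (induction k arbitrary: f g)
  case 0
  then show ?case by (auto intro: bounded_bilinear.continuous_on[OF B])
next
  case (Suc k)
  have "Ck_on k S (\<lambda>x. B (f x) (frechet_derivative g (at x) v) + B (frechet_derivative f (at x) v) (g x))" for v
    using Suc.prems Suc.prems[THEN Ck_on_SucD] by (intro Ck_on_add[OF assms(2)] Suc.IH) auto
  then show ?case
    by (intro Ck_on_SucI[OF assms(2) bounded_bilinear.FDERIV[OF B Ck_on_Suc_has_derivative Ck_on_Suc_has_derivative]])
      (use Suc.prems in auto)
qed

lemma Ck_on_linear_compose:
  assumes L: "bounded_linear L" and "open S" "Ck_on k S f"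
  shows "Ck_on k S (\<lambda>x. L (f x))"
proof -
  interpret L: bounded_linear L by fact
  \<comment> \<open>A linear map becomes bilinear through a scalar factor that is kept at 1; this
    saves a second induction.\<close>
  have "bounded_bilinear (\<lambda>(a::real) b. a *\<^sub>R L b)"
    by (rule bounded_bilinear.comp[OF bounded_bilinear_scaleR bounded_linear_ident L])
  from Ck_on_bilinear[OF this assms(2) Ck_on_const[of _ _ 1] assms(3)] show ?thesis by simp
qed

lemma Ck_on_diff:
  assumes "open S" "Ck_on k S f" "Ck_on k S g" shows "Ck_on k S (\<lambda>x. f x - g x)"
  using Ck_on_add[OF assms(1,2) Ck_on_linear_compose[OF bounded_linear_minus[OF bounded_linear_ident] assms(1,3)]] by simp

lemma Ck_on_Pair:
  assumes "open S" "Ck_on k S f" "Ck_on k S g" shows "Ck_on k S (\<lambda>x. (f x, g x))"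
  using Ck_on_add[OF assms(1) Ck_on_linear_compose[OF bounded_linear_Pair[OF bounded_linear_ident bounded_linear_zero] assms(1,2)]
     Ck_on_linear_compose[OF bounded_linear_Pair[OF bounded_linear_zero bounded_linear_ident] assms(1,3)]] by simp

lemma linear_euclidean_expand:
  fixes L :: "'a::euclidean_space \<Rightarrow> 'b::real_vector"
  assumes "linear L" shows "L v = (\<Sum>i\<in>Basis. (v \<bullet> i) *\<^sub>R L i)"
proof -
  have "L v = L (\<Sum>i\<in>Basis. (v \<bullet> i) *\<^sub>R i)" by (simp add: euclidean_representation)
  also have "\<dots> = (\<Sum>i\<in>Basis. (v \<bullet> i) *\<^sub>R L i)"
    by (simp add: linear_sum[OF assms] linear_scale[OF assms])
  finally show ?thesis .
qed

text \<open>The chain rule evaluates the derivative of \<open>f\<close> in a direction that moves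
  with \<open>x\<close>. Expanding this direction in the basis of the Euclidean middle space leaves
  derivatives in fixed directions, composed with \<open>g\<close>, to which the induction hypothesis
  applies.\<close>

lemma Ck_on_compose:
  fixes f :: "'b::euclidean_space \<Rightarrow> 'c::real_normed_vector"
  assumes "open S" "open T" and gT: "\<And>x. x \<in> S \<Longrightarrow> g x \<in> T"
    and "Ck_on k S g" "Ck_on k T f"
  shows "Ck_on k S (\<lambda>x. f (g x))"
  using assms(4,5)
proof (induction k arbitrary: f)
  case 0
  then show ?case using gT by (auto intro: continuous_on_compose2)
next
  case (Suc k)
  note g = Suc.prems(1)[THEN Ck_on_SucD] and
    dg = Ck_on_Suc_has_derivative[OF Suc.prems(1)] and df = Ck_on_Suc_has_derivative[OF Suc.prems(2)]
  define D where "D x v = (\<Sum>i\<in>Basis. (frechet_derivative g (at x) v \<bullet> i) *\<^sub>R frechet_derivative f (at (g x)) i)" for x v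
  have "((\<lambda>x. f (g x)) has_derivative D x) (at x)" if "x \<in> S" for x
  proof -
    have "((\<lambda>x. f (g x)) has_derivative (\<lambda>v. frechet_derivative f (at (g x)) (frechet_derivative g (at x) v))) (at x)"
      using diff_chain_at[OF dg[OF that] df[OF gT[OF that]]] by (simp add: o_def)
    also have "(\<lambda>v. frechet_derivative f (at (g x)) (frechet_derivative g (at x) v)) = D x"
      unfolding D_def
      by (intro ext linear_euclidean_expand has_derivative_linear[OF df] gT that)
    finally show ?thesis .
  qed
  moreover have "Ck_on k S (\<lambda>x. D x v)" for v
    unfolding D_def
  proof (intro Ck_on_sum[OF assms(1)] Ck_on_bilinear[OF bounded_bilinear_scaleR assms(1)])
    fix i :: 'b
    show "Ck_on k S (\<lambda>x. frechet_derivative g (at x) v \<bullet> i)"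
      using Suc.prems(1) by (intro Ck_on_linear_compose[OF bounded_linear_inner_left assms(1)]) auto
    show "Ck_on k S (\<lambda>x. frechet_derivative f (at (g x)) i)"
      using Suc.prems(2) by (intro Suc.IH g) auto
  qed
  ultimately show ?case by (rule Ck_on_SucI[OF assms(1)])
qed

text \<open>Real powers are closed under differentiation up to constants, hence the general
  exponent. Square roots and reciprocals in the orthonormalisation are special cases.\<close>

lemma Ck_on_powr: "Ck_on k {0<..} (\<lambda>x::real. x powr a)"
proof (induction k arbitrary: a)
  case 0
  then show ?case by (auto intro!: continuous_intros)
next
  case (Suc k)
  show ?case
  proof (rule Ck_on_SucI)
    show "((\<lambda>x. x powr a) has_derivative (\<lambda>v. v * (a * x powr (a - 1)))) (at x)" if "x \<in> {0<..}" for x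
      using that DERIV_powr[OF DERIV_ident, of x "\<lambda>x. a" 0] 
      by (auto simp: has_field_derivative_def powr_diff ac_simps intro!: derivative_eq_intros)
    show "Ck_on k {0<..} (\<lambda>x. v * (a * x powr (a - 1)))" for v
      using Ck_on_linear_compose[OF bounded_linear_mult_right[of "v * a"] _ Suc.IH[of "a - 1"]] by (simp add: mult.assoc)
  qed auto
qed

section \<open>The same calculus for smooth maps\<close>

lemma smooth_on_Ck: "smooth_on S f \<Longrightarrow> Ck_on k S f" by (simp add: smooth_on_def)

lemma smooth_on_has_derivative:
  "smooth_on S f \<Longrightarrow> x \<in> S \<Longrightarrow> (f has_derivative frechet_derivative f (at x)) (at x)"
  using Ck_on_Suc_has_derivative smooth_on_Ck by blast

lemma smooth_on_continuous_on: "smooth_on S f \<Longrightarrow> continuous_on S f"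
  using Ck_on_continuous_on smooth_on_Ck by blast

lemma smooth_on_frechet_derivative: "smooth_on S f \<Longrightarrow> smooth_on S (\<lambda>x. frechet_derivative f (at x) v)"
  unfolding smooth_on_def
proof
  fix k assume "\<forall>k. Ck_on k S f"
  then have "Ck_on (Suc k) S f" by blast
  then show "Ck_on k S (\<lambda>x. frechet_derivative f (at x) v)" by simp
qed

lemma smooth_on_subset: "smooth_on S f \<Longrightarrow> T \<subseteq> S \<Longrightarrow> smooth_on T f"
  unfolding smooth_on_def using Ck_on_subset[of _ S f T] by blast

lemma smooth_on_cong:
  "open S \<Longrightarrow> (\<And>x. x \<in> S \<Longrightarrow> f x = g x) \<Longrightarrow> smooth_on S f \<Longrightarrow> smooth_on S g"
  unfolding smooth_on_def using Ck_on_cong[of S f g] by blast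

lemma smooth_on_local: "(\<And>x. x \<in> S \<Longrightarrow> \<exists>T. open T \<and> x \<in> T \<and> smooth_on T f) \<Longrightarrow> smooth_on S f"
  unfolding smooth_on_def by (intro allI Ck_on_local) blast

lemma smooth_on_const: "smooth_on S (\<lambda>x. c)"
  by (simp add: smooth_on_def Ck_on_const)

lemma smooth_on_bounded_linear: "bounded_linear f \<Longrightarrow> open S \<Longrightarrow> smooth_on S f"
  by (simp add: smooth_on_def Ck_on_bounded_linear)

lemma smooth_on_add: "open S \<Longrightarrow> smooth_on S f \<Longrightarrow> smooth_on S g \<Longrightarrow> smooth_on S (\<lambda>x. f x + g x)"
  by (simp add: smooth_on_def Ck_on_add)

lemma smooth_on_diff: "open S \<Longrightarrow> smooth_on S f \<Longrightarrow> smooth_on S g \<Longrightarrow> smooth_on S (\<lambda>x. f x - g x)"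
  by (simp add: smooth_on_def Ck_on_diff)

lemma smooth_on_sum: "open S \<Longrightarrow> (\<And>i. i \<in> I \<Longrightarrow> smooth_on S (f i)) \<Longrightarrow> smooth_on S (\<lambda>x. \<Sum>i\<in>I. f i x)"
  by (simp add: smooth_on_def Ck_on_sum)

lemma smooth_on_bilinear:
  "bounded_bilinear B \<Longrightarrow> open S \<Longrightarrow> smooth_on S f \<Longrightarrow> smooth_on S g \<Longrightarrow> smooth_on S (\<lambda>x. B (f x) (g x))"
  by (simp add: smooth_on_def Ck_on_bilinear)

lemmas smooth_on_scaleR = smooth_on_bilinear[OF bounded_bilinear_scaleR]

lemma smooth_on_mult:
  "open S \<Longrightarrow> smooth_on S f \<Longrightarrow> smooth_on S g \<Longrightarrow> smooth_on S (\<lambda>x. f x * g x)"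
  for f :: "_ \<Rightarrow> real" by (rule smooth_on_bilinear[OF bounded_bilinear_mult])

lemma smooth_on_Pair: "open S \<Longrightarrow> smooth_on S f \<Longrightarrow> smooth_on S g \<Longrightarrow> smooth_on S (\<lambda>x. (f x, g x))"
  by (simp add: smooth_on_def Ck_on_Pair)

lemma smooth_on_linear_compose:
  "bounded_linear L \<Longrightarrow> open S \<Longrightarrow> smooth_on S f \<Longrightarrow> smooth_on S (\<lambda>x. L (f x))"
  by (simp add: smooth_on_def Ck_on_linear_compose)

lemma smooth_on_compose:
  fixes f :: "'b::euclidean_space \<Rightarrow> 'c::real_normed_vector"
  shows "open S \<Longrightarrow> open T \<Longrightarrow> (\<And>x. x \<in> S \<Longrightarrow> g x \<in> T) \<Longrightarrow> smooth_on S g \<Longrightarrow> smooth_on T f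
    \<Longrightarrow> smooth_on S (\<lambda>x. f (g x))"
  unfolding smooth_on_def using Ck_on_compose[of S T g] by blast

lemma smooth_on_powr:
  fixes f :: "'a::real_normed_vector \<Rightarrow> real"
  shows "open S \<Longrightarrow> smooth_on S f \<Longrightarrow> (\<And>x. x \<in> S \<Longrightarrow> f x > 0) \<Longrightarrow> smooth_on S (\<lambda>x. f x powr a)"
  using smooth_on_compose[of S "{0<..}" f "\<lambda>x. x powr a"] Ck_on_powr by (auto simp: smooth_on_def)

section \<open>Smooth dependence of fixed points on parameters\<close>

lemma norm_blinfun_half:
  assumes "norm L \<le> 1/2"
  shows "norm (blinfun_apply L x) \<le> 1/2 * norm x"
  by (rule order_trans[OF norm_blinfun mult_right_mono[OF assms]]) simp

text \<open>Banach's fixed point theorem in place of a Neumann series: the equation inverts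
  \<open>id - L\<close>. Existence supplies candidates for derivatives, and uniqueness identifies
  them with solutions found by other means.\<close>

lemma blinfun_affine_fixpoint:
  fixes L :: "'e::banach \<Rightarrow>\<^sub>L 'e"
  assumes "norm L \<le> 1/2"
  shows "\<exists>!x. x = c + L x"
proof -
  have "dist (c + L x) (c + L y) \<le> 1/2 * dist x y" for x y
  proof -
    show ?thesis using norm_blinfun_half[OF assms, of "x - y"] by (simp add: dist_norm blinfun.diff_right)
  qed
  then have "\<exists>!x. c + L x = x"
    by (intro banach_fix_type[of "1/2"]) auto
  then show ?thesis by (simp add: eq_commute)
qed

text \<open>Implicit differentiation. The formally differentiated equation determines
  \<open>W\<close>; since \<open>DH\<close> contracts in the second variable, the error of the
  linear approximation occurs on both sides of an inequality and can be absorbed. Continuity of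
  \<open>e\<close> is assumed and keeps \<open>(y, e y)\<close> in the range where \<open>H\<close>
  is approximated by \<open>DH\<close>.\<close>

lemma fixpoint_has_derivative:
  fixes e :: "'p::real_normed_vector \<Rightarrow> 'e::real_normed_vector"
  assumes "open P" "p \<in> P" and fp: "\<And>q. q \<in> P \<Longrightarrow> e q = H (q, e q)"
    and DH: "(H has_derivative DH) (at (p, e p))"
    and cont: "isCont e p"
    and contr: "\<And>w. norm (DH (0, w)) \<le> 1/2 * norm w"
    and W: "\<And>v. W v = DH (v, W v)"
  shows "(e has_derivative W) (at p)"
proof -
  interpret DH: bounded_linear DH using DH by (rule has_derivative_bounded_linear)
  \<comment> \<open>Linearity of \<open>W\<close> is not assumed: each linearity defect satisfies
    this homogeneous equation, so it vanishes.\<close>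
  have zero: "w = 0" if "w = DH (0, w)" for w
    using contr[of w] that by simp
  have "W (u + v) - (W u + W v) = 0" for u v
  proof (rule zero)
    have "W (u + v) - (W u + W v) = DH (u + v, W (u + v)) - (DH (u, W u) + DH (v, W v))"
      using W by metis
    also have "\<dots> = DH (0, W (u + v) - (W u + W v))"
      by (simp flip: DH.add DH.diff)
    finally show "W (u + v) - (W u + W v) = DH (0, W (u + v) - (W u + W v))" .
  qed
  then have W_add: "W (u + v) = W u + W v" for u v by simp
  have "W (r *\<^sub>R v) - r *\<^sub>R W v = 0" for r v
  proof (rule zero)
    have "W (r *\<^sub>R v) - r *\<^sub>R W v = DH (r *\<^sub>R v, W (r *\<^sub>R v)) - r *\<^sub>R DH (v, W v)"
      using W by metis
    also have "\<dots> = DH (0, W (r *\<^sub>R v) - r *\<^sub>R W v)"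
      by (simp flip: DH.scaleR DH.diff)
    finally show "W (r *\<^sub>R v) - r *\<^sub>R W v = DH (0, W (r *\<^sub>R v) - r *\<^sub>R W v)" .
  qed
  then have W_scale: "W (r *\<^sub>R v) = r *\<^sub>R W v" for r v by simp
  obtain K where K: "K > 0" "\<And>z. norm (DH z) \<le> norm z * K"
    using DH.pos_bounded by blast
  have W_bound: "norm (W v) \<le> norm v * (2 * K)" for v
  proof -
    have "DH (v, 0) + DH (0, W v) = DH (v, W v)" by (simp flip: DH.add)
    then have "W v = DH (v, 0) + DH (0, W v)" using W[of v] by simp
    then have "norm (W v) \<le> norm (DH (v, 0)) + norm (DH (0, W v))" by (metis norm_triangle_ineq)
    then show ?thesis using K(2)[of "(v, 0)"] contr[of "W v"] by simp
  qed
  have "bounded_linear W"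
    by (rule bounded_linear_intro[of _ "2 * K"]) (rule W_add W_scale W_bound)+
  moreover have "\<exists>d>0. \<forall>y. norm (y - p) < d \<longrightarrow> norm (e y - e p - W (y - p)) \<le> c * norm (y - p)"
    if "c > 0" for c
  proof -
    \<comment> \<open>The bound 1/4 lets \<open>2 * \<epsilon> * norm R\<close> be absorbed by half
      of \<open>norm R\<close>. The other bound turns the resulting constant
      \<open>4 * \<epsilon> * (1 + 2 * K)\<close> into at most \<open>c\<close>, where
      \<open>2 * K\<close> bounds \<open>W\<close>.\<close>
    define \<epsilon> where "\<epsilon> = min (1/4) (c / (4 * (1 + 2 * K)))"
    have \<epsilon>: "\<epsilon> > 0" "\<epsilon> \<le> 1/4" "4 * \<epsilon> * (1 + 2 * K) \<le> c"
    proof -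
      show "\<epsilon> > 0" using \<open>c > 0\<close> K(1) by (simp add: \<epsilon>_def)
      show "\<epsilon> \<le> 1/4" unfolding \<epsilon>_def by (rule min.cobounded1)
      have "\<epsilon> \<le> c / (4 * (1 + 2 * K))" by (simp add: \<epsilon>_def)
      then show "4 * \<epsilon> * (1 + 2 * K) \<le> c"
        using K(1) by (subst (asm) pos_le_divide_eq) (auto simp: mult_ac)
    qed
    obtain d1 where d1: "d1 > 0" "\<And>y. norm (y - (p, e p)) < d1 \<Longrightarrow>
        norm (H y - H (p, e p) - DH (y - (p, e p))) \<le> \<epsilon> * norm (y - (p, e p))"
      using DH \<epsilon>(1) unfolding has_derivative_at_alt by blast
    obtain d2 where d2: "d2 > 0" "\<And>y. norm (y - p) < d2 \<Longrightarrow> norm (e y - e p) < d1 / 2"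
      using cont d1(1) unfolding continuous_at_eps_delta dist_norm by (metis half_gt_zero)
    obtain d3 where d3: "d3 > 0" "ball p d3 \<subseteq> P"
      using \<open>open P\<close> \<open>p \<in> P\<close> open_contains_ball by blast
    show ?thesis
    proof (intro exI[of _ "min (d1 / 2) (min d2 d3)"] conjI allI impI)
      show "min (d1 / 2) (min d2 d3) > 0" using d1 d2 d3 by simp
      fix y assume y: "norm (y - p) < min (d1 / 2) (min d2 d3)"
      define h \<Delta> R where "h = y - p" "\<Delta> = e y - e p" "R = e y - e p - W (y - p)"
      have "y \<in> P" using y d3(2) by (auto simp: dist_norm norm_minus_commute)
      have np: "norm (h, \<Delta>) \<le> norm h + norm \<Delta>" by (rule norm_Pair_le)
      have "norm (h, \<Delta>) < d1"
        using np y d2(2)[of y] by (simp add: h_\<Delta>_R_def)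
      then have "norm (H (y, e y) - H (p, e p) - DH (h, \<Delta>)) \<le> \<epsilon> * norm (h, \<Delta>)"
        using d1(2)[of "(y, e y)"] by (simp add: h_\<Delta>_R_def)
      also have "\<dots> \<le> \<epsilon> * (norm h + norm \<Delta>)"
        using np \<epsilon>(1) by (intro mult_left_mono) auto
      finally have 1: "norm (\<Delta> - DH (h, \<Delta>)) \<le> \<epsilon> * (norm h + norm \<Delta>)"
        using fp[OF \<open>y \<in> P\<close>] fp[OF \<open>p \<in> P\<close>] by (simp add: h_\<Delta>_R_def)
      have "DH (h, \<Delta>) - DH (h, W h) = DH (0, R)" by (simp add: h_\<Delta>_R_def flip: DH.diff)
      \<comment> \<open>The remainder solves the linearised equation up to the approximation error
        of \<open>H\<close>; the contraction then bounds it by twice that error.\<close>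
      then have "R = (\<Delta> - DH (h, \<Delta>)) + DH (0, R)"
        using W[of h] by (simp add: h_\<Delta>_R_def algebra_simps)
      then have "norm R \<le> norm (\<Delta> - DH (h, \<Delta>)) + norm (DH (0, R))" by (metis norm_triangle_ineq)
      then have 2: "norm R \<le> 2 * \<epsilon> * (norm h + norm \<Delta>)" using 1 contr[of R] by simp
      have "norm \<Delta> \<le> norm (W h) + norm R"
        using norm_triangle_ineq[of "W h" R] by (simp add: h_\<Delta>_R_def)
      then have "norm \<Delta> \<le> norm h * (2 * K) + norm R" using W_bound[of h] by simp
      then have "2 * \<epsilon> * (norm h + norm \<Delta>) \<le> 2 * \<epsilon> * (norm h + (norm h * (2 * K) + norm R))"
        using \<epsilon>(1) by (intro mult_left_mono) auto
      also have "\<dots> = 2 * \<epsilon> * (1 + 2 * K) * norm h + 2 * \<epsilon> * norm R"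
        by (simp add: algebra_simps)
      also have "2 * \<epsilon> * norm R \<le> 1/2 * norm R"
        using \<epsilon>(2) by (intro mult_right_mono) auto
      finally have "norm R \<le> 4 * \<epsilon> * (1 + 2 * K) * norm h" using 2 by simp
      also have "\<dots> \<le> c * norm h"
        using \<epsilon>(3) by (rule mult_right_mono) simp
      finally show "norm (e y - e p - W (y - p)) \<le> c * norm (y - p)" by (simp add: h_\<Delta>_R_def)
    qed
  qed
  ultimately show ?thesis unfolding has_derivative_at_alt by blast
qed

text \<open>Differentiating the equation gives one of the same form, with the same operator
  \<open>L\<close> and the inhomogeneity \<open>Db v + (DL v) w\<close>. The latter is as regular as
  \<open>w\<close>, so each step of the induction gains one derivative.\<close>

lemma blinfun_fixpoint_Ck_on:
  fixes L :: "'p::real_normed_vector \<Rightarrow> 'e::banach \<Rightarrow>\<^sub>L 'e"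
  assumes "open P" and L: "\<And>p. p \<in> P \<Longrightarrow> norm (L p) \<le> 1/2"
    and "Ck_on k P L" "Ck_on k P b" and w: "\<And>p. p \<in> P \<Longrightarrow> w p = b p + L p (w p)"
  shows "Ck_on k P w"
  using assms(3-5)
proof (induction k arbitrary: b w)
  case 0
  have "(w \<longlongrightarrow> w p) (at p)" if "p \<in> P" for p
  proof -
    \<comment> \<open>The difference \<open>w q - w p\<close> splits into changes of
      \<open>b\<close> and \<open>L\<close> at fixed \<open>w p\<close> and a term that
      \<open>L q\<close> halves. Absorbing that term produces the factor 2.\<close>
    define r where "r q = 2 * (norm (b q - b p) + norm (L q - L p) * norm (w p))" for q
    have cb: "(b \<longlongrightarrow> b p) (at p)" and cL: "(L \<longlongrightarrow> L p) (at p)"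
      using 0(1,2) \<open>open P\<close> \<open>p \<in> P\<close> by (auto simp: continuous_on_eq_continuous_at isCont_def)
    have "(r \<longlongrightarrow> 2 * (norm (b p - b p) + norm (L p - L p) * norm (w p))) (at p)"
      unfolding r_def by (intro tendsto_intros cb cL)
    then have "(r \<longlongrightarrow> 0) (at p)" by simp
    moreover have "\<forall>\<^sub>F q in at p. norm (w q - w p) \<le> r q"
    proof -
      have "norm (w q - w p) \<le> r q" if "q \<in> P" for q
      proof -
        have eq: "w q - w p = (b q - b p) + (L q - L p) (w p) + L q (w q - w p)"
        proof -
          have "w q - w p = (b q + L q (w q)) - (b p + L p (w p))"
            by (rule arg_cong2[where f = minus, OF 0(3)[OF \<open>q \<in> P\<close>] 0(3)[OF \<open>p \<in> P\<close>]])
          also have "\<dots> = (b q - b p) + (L q - L p) (w p) + L q (w q - w p)"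
            by (simp add: blinfun.diff_left blinfun.diff_right algebra_simps)
          finally show ?thesis .
        qed
        have "norm ((b q - b p) + (L q - L p) (w p) + L q (w q - w p))
            \<le> norm (b q - b p) + norm ((L q - L p) (w p)) + norm (L q (w q - w p))"
          by (rule norm_triangle_le[OF add_right_mono[OF norm_triangle_ineq]])
        then have "norm (w q - w p) \<le> norm (b q - b p) + norm ((L q - L p) (w p)) + norm (L q (w q - w p))"
          unfolding eq[symmetric] .
        moreover have "norm (L q (w q - w p)) \<le> 1/2 * norm (w q - w p)"
          by (rule norm_blinfun_half[OF L[OF \<open>q \<in> P\<close>]])
        moreover have "norm ((L q - L p) (w p)) \<le> norm (L q - L p) * norm (w p)"
          by (rule norm_blinfun)
        ultimately show ?thesis by (simp add: r_def)
      qed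
      then show ?thesis
        using eventually_at_in_open'[OF \<open>open P\<close> \<open>p \<in> P\<close>] by (auto elim: eventually_mono)
    qed
    ultimately have "((\<lambda>q. w q - w p) \<longlongrightarrow> 0) (at p)"
      by (rule Lim_null_comparison[rotated])
    then show ?thesis by (simp add: LIM_zero_iff)
  qed
  then show ?case by (simp add: continuous_at_imp_continuous_on isCont_def)
next
  case (Suc k)
  note Ck = Suc.prems(1,2)[THEN Ck_on_SucD]
  \<comment> \<open>A first use of the induction hypothesis gives \<open>w\<close> itself; only then
    is the inhomogeneity \<open>b'\<close>, which contains \<open>w\<close>, known to be of class
    \<open>k\<close>.\<close>
  have wk: "Ck_on k P w" by (rule Suc.IH[OF Ck Suc.prems(3)])
  then have wc: "isCont w p" if "p \<in> P" for p
    using Ck_on_continuous_on[OF wk] \<open>open P\<close> that by (simp add: continuous_on_eq_continuous_at)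
  define b' where "b' v p = frechet_derivative b (at p) v + frechet_derivative L (at p) v (w p)" for v p
  define W where "W v p = (THE x. x = b' v p + L p x)" for v p
  have W: "W v p = b' v p + L p (W v p)" if "p \<in> P" for p v
    unfolding W_def by (rule theI') (rule blinfun_affine_fixpoint[OF L[OF that]])
  have "(w has_derivative (\<lambda>v. W v p)) (at p)" if "p \<in> P" for p
  proof (rule fixpoint_has_derivative[OF \<open>open P\<close> that _ _ wc[OF that]])
    let ?H = "\<lambda>(q, x). b q + L q x" and ?DH = "\<lambda>(v, x). b' v p + L p x"
    show "w q = ?H (q, w q)" if "q \<in> P" for q by (simp only: prod.case) (rule Suc.prems(3)[OF that])
    have db: "((\<lambda>z. b (fst z)) has_derivative (\<lambda>z. frechet_derivative b (at p) (fst z))) (at (p, w p))"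
      using Ck_on_Suc_has_derivative[OF Suc.prems(2) that]
      by (auto intro!: has_derivative_compose[of fst fst _ _ b] has_derivative_fst[OF has_derivative_ident])
    have dL: "((\<lambda>z. L (fst z)) has_derivative (\<lambda>z. frechet_derivative L (at p) (fst z))) (at (p, w p))"
      using Ck_on_Suc_has_derivative[OF Suc.prems(1) that]
      by (auto intro!: has_derivative_compose[of fst fst _ _ L] has_derivative_fst[OF has_derivative_ident])
    have "((\<lambda>z. b (fst z) + L (fst z) (snd z)) has_derivative
        (\<lambda>z. frechet_derivative b (at p) (fst z) +
          (L (fst (p, w p)) (snd z) + frechet_derivative L (at p) (fst z) (snd (p, w p))))) (at (p, w p))"
      by (intro has_derivative_add[OF db] bounded_bilinear.FDERIV[OF bounded_bilinear_blinfun_apply dL]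
          has_derivative_snd has_derivative_ident)
    then show "(?H has_derivative ?DH) (at (p, w p))"
      by (simp add: b'_def case_prod_unfold algebra_simps)
    then have "linear ?DH" by (rule has_derivative_linear)
    then have b0: "b' 0 p = 0" using linear_0[of ?DH] by (simp add: zero_prod_def blinfun.zero_right)
    show "norm (?DH (0, x)) \<le> 1/2 * norm x" for x
      using norm_blinfun_half[OF L[OF that], of x] b0 by simp
    show "W v p = ?DH (v, W v p)" for v by (simp only: prod.case) (rule W[OF that])
  qed
  moreover have "Ck_on k P (\<lambda>p. W v p)" for v
  proof (rule Suc.IH[OF Ck(1) _ W])
    show "Ck_on k P (b' v)" unfolding b'_def
      using Suc.prems(1,2) wk
      by (intro Ck_on_add[OF \<open>open P\<close>] Ck_on_bilinear[OF bounded_bilinear_blinfun_apply \<open>open P\<close>]) auto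
  qed
  ultimately show ?case by (rule Ck_on_SucI[OF \<open>open P\<close>])
qed

text \<open>The bootstrap for a nonlinear equation: if \<open>e\<close> is of class
  \<open>k\<close>, so are the coefficients \<open>T'\<close>, then the derivative of
  \<open>e\<close> by the affine case, and \<open>e\<close> is of class \<open>Suc k\<close>. As
  \<open>T'\<close> is indexed by the parameter, \<open>T\<close> has to be differentiable only at
  the fixed points. The second conclusion is the variational equation in integrated form.\<close>

lemma fixpoint_smooth_on:
  fixes e :: "'p::real_normed_vector \<Rightarrow> 'e::banach" and T' :: "'p \<Rightarrow> 'e \<Rightarrow>\<^sub>L 'e"
  assumes "open P" and b: "smooth_on P b" and fp: "\<And>p. p \<in> P \<Longrightarrow> e p = b p + T (e p)"
    and cont: "continuous_on P e"
    and T: "\<And>p. p \<in> P \<Longrightarrow> (T has_derivative T' p) (at (e p))"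
    and norm: "\<And>p. p \<in> P \<Longrightarrow> norm (T' p) \<le> 1/2"
    and Ck: "\<And>k. Ck_on k P e \<Longrightarrow> Ck_on k P T'"
  shows "smooth_on P e"
    and "\<And>p v. p \<in> P \<Longrightarrow> frechet_derivative e (at p) v =
      frechet_derivative b (at p) v + T' p (frechet_derivative e (at p) v)"
proof -
  define W where "W v p = (THE x. x = frechet_derivative b (at p) v + T' p x)" for v p
  have W: "W v p = frechet_derivative b (at p) v + T' p (W v p)" if "p \<in> P" for p v
    unfolding W_def by (rule theI') (rule blinfun_affine_fixpoint[OF norm[OF that]])
  have D: "(e has_derivative (\<lambda>v. W v p)) (at p)" if "p \<in> P" for p
  proof (rule fixpoint_has_derivative[OF \<open>open P\<close> that])
    let ?H = "\<lambda>(q, x). b q + T x" and ?DH = "\<lambda>(v, x). frechet_derivative b (at p) v + T' p x"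
    show "e q = ?H (q, e q)" if "q \<in> P" for q by (simp only: prod.case) (rule fp[OF that])
    have db: "((\<lambda>z. b (fst z)) has_derivative (\<lambda>z. frechet_derivative b (at p) (fst z))) (at (p, e p))"
      using smooth_on_has_derivative[OF b that]
      by (auto intro!: has_derivative_compose[of fst fst _ _ b] has_derivative_fst[OF has_derivative_ident])
    have dT: "((\<lambda>z. T (snd z)) has_derivative (\<lambda>z. T' p (snd z))) (at (p, e p))"
      using T[OF that]
      by (auto intro!: has_derivative_compose[of snd snd _ _ T] has_derivative_snd[OF has_derivative_ident])
    show H: "(?H has_derivative ?DH) (at (p, e p))"
      using has_derivative_add[OF db dT] by (simp add: case_prod_unfold)
    show "isCont e p" using cont \<open>open P\<close> that by (simp add: continuous_on_eq_continuous_at)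
    have "linear (frechet_derivative b (at p))"
      using smooth_on_has_derivative[OF b that] by (rule has_derivative_linear)
    then show "norm (?DH (0, x)) \<le> 1/2 * norm x" for x
      using norm_blinfun_half[OF norm[OF that], of x] by (simp add: linear_0)
    show "W v p = ?DH (v, W v p)" for v by (simp only: prod.case) (rule W[OF that])
  qed
  have fd: "(\<lambda>v. W v p) = frechet_derivative e (at p)" if "p \<in> P" for p
    by (rule frechet_derivative_at[OF D[OF that]])
  show "frechet_derivative e (at p) v =
      frechet_derivative b (at p) v + T' p (frechet_derivative e (at p) v)" if "p \<in> P" for p v
    using W[OF that, of v] unfolding fun_cong[OF fd[OF that], of v] .
  have "Ck_on k P e" for k
  proof (induction k)
    case 0
    then show ?case using cont by simp
  next
    case (Suc k)
    have "Ck_on k P (\<lambda>p. W v p)" for v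
      by (rule blinfun_fixpoint_Ck_on[OF \<open>open P\<close> norm Ck[OF Suc] _ W])
        (use smooth_on_frechet_derivative[OF b] in \<open>auto simp: smooth_on_def\<close>)
    with D show ?case by (rule Ck_on_SucI[OF \<open>open P\<close>])
  qed
  then show "smooth_on P e" by (simp add: smooth_on_def)
qed

section \<open>Flows of smooth vector fields\<close>

unbundle bcontfun.lifting

section \<open>Integration and superposition as operators on curves\<close>

lemma bounded_linear_apply_bcontfun: "bounded_linear (\<lambda>e. apply_bcontfun e t)"
  by (rule bounded_linear_intro[of _ 1]) (simp_all add: norm_bounded)

lemma bounded_linear_const_bcontfun: "bounded_linear const_bcontfun"
  by (rule bounded_linear_intro[of _ 1])
    (auto intro!: bcontfun_eqI norm_bound simp: const_bcontfun.rep_eq plus_bcontfun.rep_eq scaleR_bcontfun.rep_eq)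

text \<open>Clamping time to [0,1] makes the integral a bounded continuous function on the whole
  line, so curves on the unit interval can live in the Banach space of such functions, and it keeps
  the operator norm at most 1.\<close>

lift_definition antideriv :: "(real \<Rightarrow>\<^sub>C 'a::euclidean_space) \<Rightarrow> (real \<Rightarrow>\<^sub>C 'a)"
  is "\<lambda>f t. integral {0..max 0 (min 1 t)} f"
proof -
  fix f :: "real \<Rightarrow> 'a" assume f: "f \<in> bcontfun"
  then have c: "continuous_on T f" for T by (auto simp: bcontfun_def intro: continuous_on_subset)
  obtain B where B: "\<And>x. norm (f x) \<le> B" using f by (auto simp: bcontfun_def bounded_iff)
  show "(\<lambda>t. integral {0..max 0 (min 1 t)} f) \<in> bcontfun"
  proof (rule bcontfun_normI)
    have "continuous_on {0..1} (\<lambda>x. integral {0..x} f)"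
      by (intro indefinite_integral_continuous_1 integrable_continuous_real c)
    then show "continuous_on UNIV (\<lambda>t. integral {0..max 0 (min 1 t)} f)"
      by (rule continuous_on_compose2) (auto intro!: continuous_intros)
    show "norm (integral {0..max 0 (min 1 t)} f) \<le> B" for t
    proof -
      have "norm (integral {0..max 0 (min 1 t)} f) \<le> B * (max 0 (min 1 t) - 0)"
        by (intro integral_bound c B) auto
      also have "\<dots> \<le> B * 1" using order_trans[OF norm_ge_zero B] by (intro mult_left_mono) auto
      finally show ?thesis by simp
    qed
  qed
qed

lemma norm_antideriv_le: "norm (antideriv f) \<le> norm f"
proof (rule norm_bound)
  fix t :: real
  let ?u = "max 0 (min 1 t)"
  have "norm (integral {0..?u} (apply_bcontfun f)) \<le> norm f * (?u - 0)"
  proof (rule integral_bound)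
    show "norm (apply_bcontfun f s) \<le> norm f" for s by (rule norm_bounded)
  qed auto
  also have "\<dots> \<le> norm f * 1" by (rule mult_left_mono) auto
  finally show "norm (apply_bcontfun (antideriv f) t) \<le> norm f" by (simp add: antideriv.rep_eq)
qed

lemma bounded_linear_antideriv: "bounded_linear antideriv"
proof (rule bounded_linear_intro[of _ 1])
  have i: "apply_bcontfun f integrable_on {0..u}" for f :: "real \<Rightarrow>\<^sub>C 'a" and u :: real
    by (intro integrable_continuous_real continuous_on_apply_bcontfun)
  show "antideriv (f + g) = antideriv f + antideriv g" for f g :: "real \<Rightarrow>\<^sub>C 'a"
    by (rule bcontfun_eqI) (simp add: antideriv.rep_eq integral_add[OF i i] plus_bcontfun.rep_eq)
  show "antideriv (c *\<^sub>R f) = c *\<^sub>R antideriv f" for c and f :: "real \<Rightarrow>\<^sub>C 'a"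
    by (rule bcontfun_eqI) (simp add: antideriv.rep_eq scaleR_bcontfun.rep_eq)
qed (simp add: norm_antideriv_le)

text \<open>The superposition (Nemytskii) operator of \<open>F\<close>. \<open>Bcontfun\<close>
  gives the intended curve only if the composition is continuous and bounded; values in a compact
  set ensure this.\<close>

definition superpos :: "('a::metric_space \<Rightarrow> 'b::metric_space) \<Rightarrow> ('t::topological_space \<Rightarrow>\<^sub>C 'a) \<Rightarrow> ('t \<Rightarrow>\<^sub>C 'b)"
  where "superpos F e = Bcontfun (\<lambda>t. F (e t))"

lemma superpos_apply:
  assumes "compact K" "continuous_on K F" "\<And>t. apply_bcontfun e t \<in> K"
  shows "apply_bcontfun (superpos F e) t = F (e t)"
proof -
  have "continuous_on UNIV (\<lambda>t. F (e t))"
    by (rule continuous_on_compose2[OF assms(2)]) (use assms(3) in auto)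
  moreover have "bounded (range (\<lambda>t. F (e t)))"
    by (rule bounded_subset[OF compact_imp_bounded[OF compact_continuous_image[OF assms(2,1)]]])
      (use assms(3) in auto)
  ultimately have "(\<lambda>t. F (e t)) \<in> bcontfun" by (simp add: bcontfun_def)
  then show ?thesis by (simp add: superpos_def Bcontfun_inverse)
qed

text \<open>Bilinear building block for the derivative of a superposition operator: \<open>a\<close>
  will be a directional derivative of the field along a curve and \<open>h\<close> the variation of
  that curve.\<close>

lift_definition coord_scale ::
  "'a \<Rightarrow> ('t::topological_space \<Rightarrow>\<^sub>C 'b::real_normed_vector) \<Rightarrow> ('t \<Rightarrow>\<^sub>C 'a::euclidean_space) \<Rightarrow> ('t \<Rightarrow>\<^sub>C 'b)"
  is "\<lambda>i a h t. (h t \<bullet> i) *\<^sub>R a t"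
proof -
  fix i :: 'a and a :: "'t \<Rightarrow> 'b" and h :: "'t \<Rightarrow> 'a"
  assume a: "a \<in> bcontfun" and h: "h \<in> bcontfun"
  obtain A H where A: "\<And>t. norm (a t) \<le> A" and H: "\<And>t. norm (h t) \<le> H"
    using a h by (auto simp: bcontfun_def bounded_iff)
  show "(\<lambda>t. (h t \<bullet> i) *\<^sub>R a t) \<in> bcontfun"
  proof (rule bcontfun_normI)
    show "continuous_on UNIV (\<lambda>t. (h t \<bullet> i) *\<^sub>R a t)"
      using a h by (auto simp: bcontfun_def intro!: continuous_intros)
    show "norm ((h t \<bullet> i) *\<^sub>R a t) \<le> (H * norm i) * A" for t
    proof -
      have "\<bar>h t \<bullet> i\<bar> \<le> H * norm i"
        by (rule order_trans[OF Cauchy_Schwarz_ineq2 mult_right_mono[OF H]]) simp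
      moreover from this have "0 \<le> H * norm i" by linarith
      ultimately show ?thesis using A[of t] by (auto intro!: mult_mono)
    qed
  qed
qed

lemma bounded_bilinear_coord_scale:
  fixes i :: "'a::euclidean_space"
  shows "bounded_bilinear (coord_scale i :: ('t::topological_space \<Rightarrow>\<^sub>C 'b::real_normed_vector) \<Rightarrow> _)"
proof (rule bounded_bilinear.intro)
  show "\<exists>K. \<forall>(a :: 't \<Rightarrow>\<^sub>C 'b) b. norm (coord_scale i a b) \<le> norm a * norm b * K"
  proof (intro exI[of _ "norm i"] allI norm_bound)
    fix a :: "'t \<Rightarrow>\<^sub>C 'b" and h :: "'t \<Rightarrow>\<^sub>C 'a" and t
    have "\<bar>h t \<bullet> i\<bar> \<le> norm h * norm i"
      by (rule order_trans[OF Cauchy_Schwarz_ineq2 mult_right_mono[OF norm_bounded]]) simp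
    then have "\<bar>h t \<bullet> i\<bar> * norm (a t) \<le> (norm h * norm i) * norm a"
      by (intro mult_mono norm_bounded) auto
    then show "norm (apply_bcontfun (coord_scale i a h) t) \<le> norm a * norm h * norm i"
      by (simp add: coord_scale.rep_eq mult_ac)
  qed
qed (rule bcontfun_eqI, simp add: coord_scale.rep_eq plus_bcontfun.rep_eq scaleR_bcontfun.rep_eq
    inner_add_left scaleR_add_left scaleR_add_right mult.commute)+

lemma sum_bcontfun_apply:
  "apply_bcontfun (\<Sum>i\<in>I. f i) t = (\<Sum>i\<in>I. apply_bcontfun (f i) t)"
  by (induction I rule: infinite_finite_induct) (auto simp: plus_bcontfun.rep_eq zero_bcontfun.rep_eq)

text \<open>Two radii are needed because differentiation at a curve in the ball of radius
  \<open>r\<close> compares it with nearby curves. In the sup norm these stay in the compact ball of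
  radius \<open>R\<close>, where derivatives are uniformly continuous.\<close>

locale superposition =
  fixes S :: "'a::euclidean_space set" and z :: 'a and r R :: real
  assumes S: "open S" and rR: "r < R" and cball: "cball z R \<subseteq> S"
begin

definition B :: "('t::topological_space \<Rightarrow>\<^sub>C 'a) set" where
  "B = {e. \<forall>t. apply_bcontfun e t \<in> cball z r}"

lemma B_cball:
  assumes "e \<in> B" shows "apply_bcontfun e t \<in> cball z R"
proof -
  have "dist z (e t) \<le> r" using assms by (simp add: B_def)
  then show ?thesis using rR by simp
qed

lemma superpos_B_apply:
  assumes "e \<in> B" "continuous_on S F"
  shows "apply_bcontfun (superpos F e) t = F (e t)"
  by (rule superpos_apply[OF compact_cball[of z R] continuous_on_subset[OF assms(2) cball]])
    (rule B_cball[OF assms(1)])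

text \<open>This is the curve of values \<open>dF (e t) (h t)\<close>. In the basis expansion
  \<open>e\<close> enters only through superpositions of directional derivatives of
  \<open>F\<close>, the shape that an induction over the order can use.\<close>

definition D :: "('a \<Rightarrow> 'b::real_normed_vector) \<Rightarrow> ('t::topological_space \<Rightarrow>\<^sub>C 'a) \<Rightarrow> ('t \<Rightarrow>\<^sub>C 'a) \<Rightarrow> ('t \<Rightarrow>\<^sub>C 'b)"
  where "D F e h = (\<Sum>i\<in>Basis. coord_scale i (superpos (\<lambda>x. frechet_derivative F (at x) i) e) h)"

lemma D_apply:
  assumes "e \<in> B" "Ck_on 1 S F"
  shows "apply_bcontfun (D F e h) t = frechet_derivative F (at (e t)) (h t)"
proof -
  have F: "continuous_on S (\<lambda>x. frechet_derivative F (at x) i)" for i using assms(2) by simp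
  have "apply_bcontfun e t \<in> S" using B_cball[OF assms(1)] cball by blast
  then have "linear (frechet_derivative F (at (e t)))"
    using assms(2) by (auto intro!: linear_frechet_derivative)
  then show ?thesis
    by (simp add: D_def sum_bcontfun_apply coord_scale.rep_eq superpos_B_apply[OF assms(1) F]
        linear_euclidean_expand[of "frechet_derivative F (at (e t))" "h t"])
qed

text \<open>At each time this is the differentiability of \<open>F\<close>; uniform continuity of
  its derivative on the compact ball makes the remainder small uniformly in time, which the sup norm
  demands.\<close>

lemma superpos_has_derivative:
  assumes e: "e \<in> B" and F: "Ck_on 1 S F"
  shows "(superpos F has_derivative D F e) (at e)"
  unfolding has_derivative_at_alt
proof (intro conjI allI impI)
  show "bounded_linear (D F e)" unfolding D_def
    by (intro bounded_linear_sum bounded_bilinear.bounded_linear_right[OF bounded_bilinear_coord_scale])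
  fix c :: real assume "c > 0"
  let ?n = "real DIM('a)"
  have cF: "continuous_on S F" using F Ck_on_continuous_on by blast
  have dF: "(F has_derivative frechet_derivative F (at x)) (at x)" if "x \<in> S" for x
    using F that by (simp add: frechet_derivative_works[symmetric])
  define Q where "Q i d \<longleftrightarrow> d > 0 \<and> (\<forall>x\<in>cball z R. \<forall>y\<in>cball z R. dist y x < d \<longrightarrow>
      dist (frechet_derivative F (at y) i) (frechet_derivative F (at x) i) < c / ?n)" for i d
  have "\<exists>d. Q i d" for i
  proof -
    have "continuous_on S (\<lambda>x. frechet_derivative F (at x) i)" using F by simp
    then have "uniformly_continuous_on (cball z R) (\<lambda>x. frechet_derivative F (at x) i)"
      by (intro compact_uniformly_continuous continuous_on_subset[OF _ cball]) auto
    moreover have "c / ?n > 0" using \<open>c > 0\<close> by simp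
    ultimately show ?thesis unfolding uniformly_continuous_on_def Q_def by blast
  qed
  then obtain d where Q: "\<And>i. Q i (d i)" by metis
  then have d: "\<And>i. d i > 0" "\<And>i x y. x \<in> cball z R \<Longrightarrow> y \<in> cball z R \<Longrightarrow> dist y x < d i \<Longrightarrow>
      dist (frechet_derivative F (at y) i) (frechet_derivative F (at x) i) < c / ?n"
    unfolding Q_def by simp_all
  \<comment> \<open>\<open>R - r\<close> keeps the segment between the two curve points inside the
    large ball. The minimum over the basis makes each directional derivative vary by less than
    \<open>c / ?n\<close>, so the \<open>?n\<close> terms of the expansion add up to at most
    \<open>c\<close>.\<close>
  define \<rho> where "\<rho> = min (R - r) (Min (d ` Basis))"
  have "\<rho> > 0" using rR d(1) by (simp add: \<rho>_def)
  show "\<exists>d>0. \<forall>y. norm (y - e) < d \<longrightarrow>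
      norm (superpos F y - superpos F e - D F e (y - e)) \<le> c * norm (y - e)"
  proof (intro exI[of _ \<rho>] conjI allI impI \<open>\<rho> > 0\<close>)
    fix y assume y: "norm (y - e) < \<rho>"
    have yt: "norm (y t - e t) < \<rho>" for t
      using norm_bounded[of "y - e" t] y by (simp add: minus_bcontfun.rep_eq)
    have et: "apply_bcontfun e t \<in> cball z r" for t using e by (simp add: B_def)
    have sub: "ball (e t) \<rho> \<subseteq> cball z R" for t
    proof
      fix x assume "x \<in> ball (e t) \<rho>"
      then show "x \<in> cball z R" using et[of t] dist_triangle[of z x "e t"] by (auto simp: \<rho>_def)
    qed
    have ytR: "apply_bcontfun y t \<in> cball z R" for t
    proof -
      have "apply_bcontfun y t \<in> ball (e t) \<rho>" using yt[of t] by (simp add: dist_norm norm_minus_commute)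
      then show ?thesis using sub[of t] by blast
    qed
    show "norm (superpos F y - superpos F e - D F e (y - e)) \<le> c * norm (y - e)"
    proof (rule norm_bound)
      fix t
      have a: "apply_bcontfun (superpos F y) t = F (y t)"
        by (rule superpos_apply[OF compact_cball[of z R] continuous_on_subset[OF cF cball] ytR])
      have "norm (F (y t) - F (e t) - frechet_derivative F (at (e t)) (y t - e t)) \<le> norm (y t - e t) * c"
      proof (rule differentiable_bound_linearization[where S = "ball (e t) \<rho>" and f' = "\<lambda>x. frechet_derivative F (at x)"])
        show "apply_bcontfun e t + u *\<^sub>R (apply_bcontfun y t - apply_bcontfun e t) \<in> ball (apply_bcontfun e t) \<rho>"
          if "u \<in> {0..1}" for u
        proof -
          have "\<bar>u\<bar> * norm (y t - e t) \<le> 1 * norm (y t - e t)" using that by (intro mult_right_mono) auto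
          then show ?thesis using yt[of t] by (simp add: dist_norm)
        qed
        show "(F has_derivative frechet_derivative F (at x)) (at x within ball (apply_bcontfun e t) \<rho>)"
          if "x \<in> ball (apply_bcontfun e t) \<rho>" for x
          by (rule has_derivative_at_withinI[OF dF]) (use sub[of t] cball that in blast)
        show "apply_bcontfun e t \<in> ball (apply_bcontfun e t) \<rho>" using \<open>\<rho> > 0\<close> by simp
        fix x assume x: "x \<in> ball (apply_bcontfun e t) \<rho>"
        have lin: "linear (frechet_derivative F (at x))" "linear (frechet_derivative F (at (e t)))"
          by (rule has_derivative_linear[OF dF], use x sub[of t] cball \<open>\<rho> > 0\<close> in force)+
        show "onorm (frechet_derivative F (at x) - frechet_derivative F (at (apply_bcontfun e t))) \<le> c"
        proof (rule onorm_bound)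
          fix h
          have "(frechet_derivative F (at x) - frechet_derivative F (at (e t))) h =
              (\<Sum>i\<in>Basis. (h \<bullet> i) *\<^sub>R (frechet_derivative F (at x) i - frechet_derivative F (at (e t)) i))"
            using linear_euclidean_expand[OF lin(1), of h] linear_euclidean_expand[OF lin(2), of h]
            by (simp add: scaleR_diff_right sum_subtractf)
          also have "norm \<dots> \<le> (\<Sum>i\<in>(Basis::'a set). norm h * (c / ?n))"
          proof (rule sum_norm_le)
            fix i :: 'a assume i: "i \<in> Basis"
            have "dist x (e t) < d i"
              using x i by (auto simp: \<rho>_def dist_commute Min_gr_iff)
            moreover have "apply_bcontfun e t \<in> cball z R" by (rule B_cball[OF e])
            moreover have "x \<in> cball z R" using sub[of t] x by blast
            ultimately have "norm (frechet_derivative F (at x) i - frechet_derivative F (at (e t)) i) \<le> c / ?n"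
              using d(2)[of "e t" x i] by (simp add: dist_norm)
            then show "norm ((h \<bullet> i) *\<^sub>R (frechet_derivative F (at x) i - frechet_derivative F (at (e t)) i)) \<le> norm h * (c / ?n)"
              unfolding norm_scaleR using Basis_le_norm[OF i, of h] by (intro mult_mono) auto
          qed
          also have "\<dots> = c * norm h" by simp
          finally show "norm ((frechet_derivative F (at x) - frechet_derivative F (at (apply_bcontfun e t))) h) \<le> c * norm h" .
        qed (use \<open>c > 0\<close> in simp)
      qed
      also have "norm (y t - e t) * c \<le> c * norm (y - e)"
        using norm_bounded[of "y - e" t] \<open>c > 0\<close> by (simp add: minus_bcontfun.rep_eq)
      finally show "norm (apply_bcontfun (superpos F y - superpos F e - D F e (y - e)) t) \<le> c * norm (y - e)"
        by (simp add: minus_bcontfun.rep_eq a superpos_B_apply[OF e cF] D_apply[OF e F])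
    qed
  qed
qed

text \<open>\<open>Ck_on_compose\<close> requires a Euclidean middle space, whereas here it is a
  space of curves. The induction works nevertheless: the derivative consists of superpositions of
  directional derivatives of \<open>F\<close>, which are smooth again, multiplied by the derivative
  of the family.\<close>

lemma Ck_on_superpos:
  assumes "open P" "\<And>p. p \<in> P \<Longrightarrow> e p \<in> B" "Ck_on k P e" "smooth_on S F"
  shows "Ck_on k P (\<lambda>p. superpos F (e p))"
  using assms(3,4)
proof (induction k arbitrary: F)
  case 0
  have "isCont (\<lambda>p. superpos F (e p)) p" if "p \<in> P" for p
  proof (rule isCont_o2[where f = e and g = "superpos F"])
    show "isCont e p" using 0(1) \<open>open P\<close> that by (simp add: continuous_on_eq_continuous_at)
    show "isCont (superpos F) (e p)"
      using superpos_has_derivative[OF assms(2)[OF that] smooth_on_Ck[OF 0(2)]] has_derivative_continuous by blast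
  qed
  then show ?case by (simp add: continuous_at_imp_continuous_on)
next
  case (Suc k)
  have "((\<lambda>p. superpos F (e p)) has_derivative (\<lambda>v. D F (e p) (frechet_derivative e (at p) v))) (at p)"
    if "p \<in> P" for p
    using diff_chain_at[OF Ck_on_Suc_has_derivative[OF Suc.prems(1) that]
       superpos_has_derivative[OF assms(2)[OF that] smooth_on_Ck[OF Suc.prems(2)]]] by (simp add: o_def)
  moreover have "Ck_on k P (\<lambda>p. D F (e p) (frechet_derivative e (at p) v))" for v
    unfolding D_def
    using Suc.prems(1) smooth_on_frechet_derivative[OF Suc.prems(2)] Ck_on_SucD[OF Suc.prems(1)]
    by (intro Ck_on_sum[OF \<open>open P\<close>] Ck_on_bilinear[OF bounded_bilinear_coord_scale \<open>open P\<close>] Suc.IH) auto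
  ultimately show ?case by (rule Ck_on_SucI[OF \<open>open P\<close>])
qed

end

instance bcontfun :: (metric_space, banach) banach ..

lemma bounded_bilinear_postcompose:
  assumes B: "bounded_bilinear B" and G: "bounded_linear G"
  shows "bounded_bilinear (\<lambda>a b. G (B a b))"
proof -
  interpret B: bounded_bilinear B by fact
  interpret G: bounded_linear G by fact
  obtain K where K: "K \<ge> 0" "\<And>a b. norm (B a b) \<le> norm a * norm b * K" using B.nonneg_bounded by blast
  obtain M where M: "M \<ge> 0" "\<And>x. norm (G x) \<le> norm x * M" using G.nonneg_bounded by blast
  have "norm (G (B a b)) \<le> norm a * norm b * (K * M)" for a b
    using order_trans[OF M(2) mult_right_mono[OF K(2) M(1)]] by (simp add: mult.assoc)
  then show ?thesis
    by unfold_locales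
      (auto simp: B.add_left B.add_right B.scaleR_left B.scaleR_right G.add G.scaleR)
qed

text \<open>Picard's integral equation on [0,1] for the rescaled field. The last clause states
  uniqueness for the variational equation in usable form: to compute a derivative of the time-one
  map it is enough to guess a solution \<open>m\<close> and to verify it.\<close>

theorem smooth_flow:
  fixes F :: "'a::euclidean_space \<Rightarrow> 'a"
  assumes "open S" and F: "smooth_on S F" and "z0 \<in> S"
  obtains \<delta> U \<phi> where "\<delta> > 0" "open U" "z0 \<in> U"
    "\<And>z t. z \<in> U \<Longrightarrow> t \<in> {0..1} \<Longrightarrow> \<phi> z t \<in> S"
    "\<And>z. z \<in> U \<Longrightarrow> \<phi> z 0 = z"
    "\<And>z t. z \<in> U \<Longrightarrow> t \<in> {0..1} \<Longrightarrow> (\<phi> z has_vector_derivative \<delta> *\<^sub>R F (\<phi> z t)) (at t within {0..1})"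
    "\<And>t. smooth_on U (\<lambda>z. \<phi> z t)"
    "\<And>z v m. z \<in> U \<Longrightarrow> m 0 = v \<Longrightarrow>
      (\<And>t. t \<in> {0..1} \<Longrightarrow>
        (m has_vector_derivative \<delta> *\<^sub>R frechet_derivative F (at (\<phi> z t)) (m t)) (at t within {0..1})) \<Longrightarrow>
      frechet_derivative (\<lambda>z. \<phi> z 1) (at z) v = m (1::real)"
proof -
  obtain R where R: "R > 0" "cball z0 R \<subseteq> S" using assms open_contains_cball by blast
  define r where "r = R / 2"
  have r: "r > 0" "r < R" "cball z0 r \<subseteq> S" using R by (auto simp: r_def)
  interpret superposition S z0 r R using \<open>open S\<close> R r by unfold_locales auto
  have F1: "Ck_on 1 S F" by (rule smooth_on_Ck[OF F])
  have cF: "continuous_on S F" by (rule smooth_on_continuous_on[OF F])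
  have cD: "continuous_on S (\<lambda>x. frechet_derivative F (at x) i)" for i
    by (rule smooth_on_continuous_on[OF smooth_on_frechet_derivative[OF F]])
  have "bounded (F ` cball z0 r)"
    by (intro compact_imp_bounded compact_continuous_image continuous_on_subset[OF cF r(3)] compact_cball)
  then obtain M where M: "M > 0" "\<And>x. x \<in> cball z0 r \<Longrightarrow> norm (F x) \<le> M"
    unfolding bounded_pos by blast
  have "bounded ((\<lambda>x. \<Sum>i\<in>Basis. norm (frechet_derivative F (at x) i)) ` cball z0 r)"
    by (intro compact_imp_bounded compact_continuous_image continuous_on_sum continuous_on_norm
        continuous_on_subset[OF cD r(3)] compact_cball)
  then obtain L where L: "L > 0" "\<And>x. x \<in> cball z0 r \<Longrightarrow> norm (\<Sum>i\<in>Basis. norm (frechet_derivative F (at x) i)) \<le> L"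
    unfolding bounded_pos by blast
  \<comment> \<open>The first bound limits the integral term to \<open>r / 2\<close>, so a curve
    starting within \<open>r / 2\<close> of \<open>z0\<close> stays in the ball of radius
    \<open>r\<close>. The second makes the derivative of the integral operator have norm at most
    1/2.\<close>
  define \<delta> where "\<delta> = min (r / (2 * M)) (1 / (2 * L))"
  have \<delta>: "\<delta> > 0" "\<delta> * M \<le> r / 2" "\<delta> * L \<le> 1/2"
  proof -
    show "\<delta> > 0" using M(1) L(1) r(1) by (simp add: \<delta>_def)
    have "\<delta> * M \<le> (r / (2 * M)) * M" using M(1) by (intro mult_right_mono) (auto simp: \<delta>_def)
    then show "\<delta> * M \<le> r / 2" using M(1) by simp
    have "\<delta> * L \<le> (1 / (2 * L)) * L" using L(1) by (intro mult_right_mono) (auto simp: \<delta>_def)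
    then show "\<delta> * L \<le> 1/2" using L(1) by simp
  qed
  define G :: "(real \<Rightarrow>\<^sub>C 'a) \<Rightarrow> (real \<Rightarrow>\<^sub>C 'a)" where "G e = \<delta> *\<^sub>R antideriv e" for e
  have G: "bounded_linear G" unfolding G_def
    by (rule bounded_linear_scaleR_right[THEN bounded_linear_compose, OF bounded_linear_antideriv])
  have G_norm: "norm (G e) \<le> \<delta> * norm e" for e
    using mult_left_mono[OF norm_antideriv_le[of e], of \<delta>] \<delta>(1) by (simp add: G_def)
  define T where "T e = G (superpos F e)" for e
  \<comment> \<open>Regularity of \<open>T'\<close> is needed in the operator norm.
    \<open>J i\<close> is a bounded linear map into operators, so \<open>T'\<close> is a finite sum
    of linear images of superpositions and inherits their regularity.\<close>
  define J where "J i a = Blinfun (\<lambda>h. G (coord_scale i a h))" for i :: 'a and a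
  have J_bil: "bounded_bilinear (\<lambda>a h. G (coord_scale i a h))" for i :: 'a
    by (rule bounded_bilinear_postcompose[OF bounded_bilinear_coord_scale G])
  have J_apply: "blinfun_apply (J i a) = (\<lambda>h. G (coord_scale i a h))" for i a
    unfolding J_def
    by (rule bounded_linear_Blinfun_apply[OF bounded_bilinear.bounded_linear_right[OF J_bil]])
  have J_lin: "bounded_linear (J i)" for i
    using transfer_bounded_bilinear_bounded_linearI[of "\<lambda>a h. G (coord_scale i a h)" "J i"] J_bil[of i]
    by (simp add: J_apply)
  define T' where "T' e = (\<Sum>i\<in>Basis. J i (superpos (\<lambda>x. frechet_derivative F (at x) i) e))" for e
  have T'_apply: "blinfun_apply (T' e) = (\<lambda>h. G (D F e h))" for e
    by (simp add: T'_def D_def blinfun.sum_left J_apply linear_sum[OF bounded_linear.linear[OF G]] fun_eq_iff)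
  \<comment> \<open>As a closed ball around a constant curve, \<open>B\<close> is complete, for the
    fixed point theorem, and convex, for the mean value inequality.\<close>
  have B_eq: "(B :: (real \<Rightarrow>\<^sub>C 'a) set) = cball (const_bcontfun z0) r"
  proof (intro set_eqI iffI)
    fix e :: "real \<Rightarrow>\<^sub>C 'a"
    show "e \<in> cball (const_bcontfun z0) r" if "e \<in> B"
      using that by (auto simp: B_def const_bcontfun.rep_eq intro!: dist_bound)
    show "e \<in> B" if e: "e \<in> cball (const_bcontfun z0) r"
      unfolding B_def
    proof (intro CollectI allI)
      fix t
      show "apply_bcontfun e t \<in> cball z0 r"
        using dist_bounded[of "const_bcontfun z0" t e] e by (simp add: const_bcontfun.rep_eq)
    qed
  qed
  have T_deriv: "(T has_derivative T' e) (at e)" if "e \<in> B" for e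
    using bounded_linear.has_derivative[OF G superpos_has_derivative[OF that F1]]
    by (simp add: T_def[abs_def] T'_apply)
  have T'_norm: "norm (T' e) \<le> 1/2" if "e \<in> B" for e
  proof (rule norm_blinfun_bound)
    fix h
    have "norm (D F e h) \<le> L * norm h"
    proof (rule norm_bound)
      fix t
      have et: "apply_bcontfun e t \<in> cball z0 r" using that by (simp add: B_def)
      have "linear (frechet_derivative F (at (e t)))"
        using smooth_on_has_derivative[OF F, of "e t"] et r(3) has_derivative_linear by blast
      from linear_euclidean_expand[OF this, of "h t"]
      have "norm (apply_bcontfun (D F e h) t) = norm (\<Sum>i\<in>Basis. (h t \<bullet> i) *\<^sub>R frechet_derivative F (at (e t)) i)"
        by (simp add: D_apply[OF that F1])
      also have "\<dots> \<le> (\<Sum>i\<in>Basis. norm h * norm (frechet_derivative F (at (e t)) i))"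
      proof (rule sum_norm_le)
        fix i :: 'a assume "i \<in> Basis"
        from Basis_le_norm[OF this, of "h t"] norm_bounded[of h t]
        show "norm ((h t \<bullet> i) *\<^sub>R frechet_derivative F (at (e t)) i) \<le> norm h * norm (frechet_derivative F (at (e t)) i)"
          by (auto intro!: mult_right_mono)
      qed
      also have "\<dots> \<le> norm h * L"
        using L(2)[OF et] by (auto simp: sum_distrib_left[symmetric] sum_nonneg intro!: mult_left_mono)
      finally show "norm (apply_bcontfun (D F e h) t) \<le> L * norm h" by (simp add: mult.commute)
    qed
    then have "\<delta> * norm (D F e h) \<le> \<delta> * (L * norm h)" using \<delta>(1) by (intro mult_left_mono) auto
    also have "\<dots> = (\<delta> * L) * norm h" by simp
    also have "\<dots> \<le> 1/2 * norm h" using \<delta>(3) by (rule mult_right_mono) simp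
    finally show "norm (T' e h) \<le> 1/2 * norm h"
      using G_norm[of "D F e h"] by (simp add: T'_apply)
  qed simp
  have T_lip: "dist (T d) (T e) \<le> 1/2 * dist d e" if "d \<in> B" "e \<in> B" for d e
    unfolding dist_norm
  proof (rule differentiable_bound[of B T "\<lambda>e. blinfun_apply (T' e)" "1/2"])
    show "convex (B :: (real \<Rightarrow>\<^sub>C 'a) set)" unfolding B_eq by (rule convex_cball)
    show "(T has_derivative blinfun_apply (T' x)) (at x within B)" if "x \<in> B" for x
      by (rule has_derivative_at_withinI[OF T_deriv[OF that]])
    show "onorm (blinfun_apply (T' x)) \<le> 1/2" if "x \<in> B" for x
      using T'_norm[OF that] by (simp add: norm_blinfun.rep_eq)
  qed (use that in auto)
  define U where "U = ball z0 (r / 2)"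
  have maps: "const_bcontfun z + T e \<in> B" if "z \<in> U" "e \<in> B" for z e
    unfolding B_def
  proof (intro CollectI allI)
    fix t :: real
    have "norm (superpos F e) \<le> M"
    proof (rule norm_bound)
      show "norm (apply_bcontfun (superpos F e) s) \<le> M" for s
        using M(2) \<open>e \<in> B\<close> by (simp add: superpos_B_apply[OF \<open>e \<in> B\<close> cF]) (simp add: B_def)
    qed
    then have "\<delta> * norm (superpos F e) \<le> \<delta> * M" using \<delta>(1) by (intro mult_left_mono) auto
    then have "norm (T e) \<le> r / 2" using G_norm[of "superpos F e"] \<delta>(2) by (simp add: T_def)
    then have "norm (apply_bcontfun (T e) t) \<le> r / 2" using norm_bounded[of "T e" t] by simp
    moreover have "norm (z - z0) < r / 2" using \<open>z \<in> U\<close> by (simp add: U_def dist_norm norm_minus_commute)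
    ultimately have "norm ((z - z0) + apply_bcontfun (T e) t) \<le> r"
      using norm_triangle_ineq[of "z - z0" "apply_bcontfun (T e) t"] by simp
    then show "apply_bcontfun (const_bcontfun z + T e) t \<in> cball z0 r"
      by (simp add: plus_bcontfun.rep_eq const_bcontfun.rep_eq dist_norm norm_minus_commute algebra_simps)
  qed
  have "\<exists>e. z \<in> U \<longrightarrow> e \<in> B \<and> const_bcontfun z + T e = e" for z
  proof (cases "z \<in> U")
    case True
    have "\<exists>!e. e \<in> B \<and> const_bcontfun z + T e = e"
    proof (rule Banach_fix)
      show "complete (B :: (real \<Rightarrow>\<^sub>C 'a) set)" unfolding B_eq by (simp add: complete_eq_closed)
      show "B \<noteq> ({} :: (real \<Rightarrow>\<^sub>C 'a) set)" unfolding B_eq using r(1) by auto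
      show "(\<lambda>e. const_bcontfun z + T e) ` B \<subseteq> B" using maps[OF True] by auto
      show "dist (const_bcontfun z + T d) (const_bcontfun z + T e) \<le> 1/2 * dist d e"
        if "d \<in> B" "e \<in> B" for d e using T_lip[OF that] by simp
    qed auto
    then show ?thesis by blast
  qed simp
  then obtain \<psi> where \<psi>: "\<And>z. z \<in> U \<Longrightarrow> \<psi> z \<in> B" "\<And>z. z \<in> U \<Longrightarrow> const_bcontfun z + T (\<psi> z) = \<psi> z"
    by metis
  have "open U" by (simp add: U_def)
  \<comment> \<open>Half of the distance of the solutions is absorbed by the contraction, which
    leaves the Lipschitz constant 2.\<close>
  have cont: "continuous_on U \<psi>"
  proof (rule lipschitz_on_continuous_on[OF lipschitz_onI])
    fix y z assume yz: "y \<in> U" "z \<in> U"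
    have "dist (\<psi> y) (\<psi> z) = dist (const_bcontfun y + T (\<psi> y)) (const_bcontfun z + T (\<psi> z))"
      by (simp add: \<psi>(2) yz)
    also have "\<dots> \<le> dist (const_bcontfun y :: real \<Rightarrow>\<^sub>C 'a) (const_bcontfun z) + dist (T (\<psi> y)) (T (\<psi> z))"
      by (rule dist_triangle_add)
    also have "\<dots> \<le> dist y z + 1/2 * dist (\<psi> y) (\<psi> z)"
      by (intro add_mono T_lip \<psi> yz dist_bound) (simp add: const_bcontfun.rep_eq)
    finally show "dist (\<psi> y) (\<psi> z) \<le> 2 * dist y z" by simp
  qed simp
  have b: "smooth_on U (const_bcontfun :: 'a \<Rightarrow> (real \<Rightarrow>\<^sub>C 'a))"
    by (rule smooth_on_bounded_linear[OF bounded_linear_const_bcontfun \<open>open U\<close>])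
  have fp: "\<psi> z = const_bcontfun z + T (\<psi> z)" if "z \<in> U" for z using \<psi>(2)[OF that] by simp
  have Ck: "Ck_on k U (\<lambda>z. T' (\<psi> z))" if "Ck_on k U \<psi>" for k
    unfolding T'_def
    by (intro Ck_on_sum[OF \<open>open U\<close>] Ck_on_linear_compose[OF J_lin \<open>open U\<close>]
        Ck_on_superpos[OF \<open>open U\<close> \<psi>(1) that] smooth_on_frechet_derivative[OF F])
  note sm = fixpoint_smooth_on[where T' = "\<lambda>z. T' (\<psi> z)", OF \<open>open U\<close> b fp cont T_deriv[OF \<psi>(1)] T'_norm[OF \<psi>(1)] Ck]
  have smooth: "smooth_on U \<psi>" "\<And>z v. z \<in> U \<Longrightarrow> frechet_derivative \<psi> (at z) v =
      frechet_derivative const_bcontfun (at z) v + T' (\<psi> z) (frechet_derivative \<psi> (at z) v)"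
    by (rule sm(1); assumption) (rule sm(2); assumption)
  have \<psi>_range: "apply_bcontfun (\<psi> z) t \<in> S" if "z \<in> U" for z t
    using \<psi>(1)[OF that] r(3) by (auto simp: B_def)
  have int_eq: "apply_bcontfun (\<psi> z) t = z + \<delta> *\<^sub>R integral {0..t} (apply_bcontfun (superpos F (\<psi> z)))"
    if "z \<in> U" "t \<in> {0..1}" for z t
  proof -
    have "apply_bcontfun (\<psi> z) t = apply_bcontfun (const_bcontfun z + T (\<psi> z)) t"
      by (simp add: \<psi>(2) that)
    moreover have "max 0 (min 1 t) = t" using that(2) by auto
    ultimately show ?thesis
      by (simp add: T_def G_def plus_bcontfun.rep_eq const_bcontfun.rep_eq scaleR_bcontfun.rep_eq antideriv.rep_eq)
  qed
  show thesis
  proof (rule that[of \<delta> U "\<lambda>z. apply_bcontfun (\<psi> z)"])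
    show "\<delta> > 0" "open U" "z0 \<in> U" using \<delta>(1) r(1) by (auto simp: U_def)
    show "apply_bcontfun (\<psi> z) t \<in> S" if "z \<in> U" "t \<in> {0..1}" for z t by (rule \<psi>_range[OF that(1)])
    show "apply_bcontfun (\<psi> z) 0 = z" if "z \<in> U" for z using int_eq[OF that, of 0] by simp
    show "(apply_bcontfun (\<psi> z) has_vector_derivative \<delta> *\<^sub>R F (apply_bcontfun (\<psi> z) t)) (at t within {0..1})"
      if "z \<in> U" "t \<in> {0..1}" for z t
    proof (rule has_vector_derivative_transform[OF that(2) int_eq[OF that(1)]])
      have "((\<lambda>u. integral {0..u} (apply_bcontfun (superpos F (\<psi> z)))) has_vector_derivative apply_bcontfun (superpos F (\<psi> z)) t) (at t within {0..1})"
        by (rule integral_has_vector_derivative[OF _ that(2)]) simp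
      from has_vector_derivative_add[OF has_vector_derivative_const[of z] bounded_linear.has_vector_derivative[OF bounded_linear_scaleR_right[of \<delta>] this]]
      show "((\<lambda>u. z + \<delta> *\<^sub>R integral {0..u} (apply_bcontfun (superpos F (\<psi> z)))) has_vector_derivative
          \<delta> *\<^sub>R F (apply_bcontfun (\<psi> z) t)) (at t within {0..1})"
        by (simp add: superpos_B_apply[OF \<psi>(1)[OF that(1)] cF])
    qed
    show "smooth_on U (\<lambda>z. apply_bcontfun (\<psi> z) t)" for t
      by (rule smooth_on_linear_compose[OF bounded_linear_apply_bcontfun \<open>open U\<close> smooth(1)])
    fix z v and m :: "real \<Rightarrow> 'a"
    assume z: "z \<in> U" and m0: "m 0 = v" and
      m: "\<And>t. t \<in> {0..1} \<Longrightarrow> (m has_vector_derivative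
        \<delta> *\<^sub>R frechet_derivative F (at (apply_bcontfun (\<psi> z) t)) (m t)) (at t within {0..1})"
    have mc: "continuous_on {0..1} m"
      using m has_vector_derivative_continuous continuous_on_eq_continuous_within by blast
    \<comment> \<open>The solution is known on [0,1] only; clamping turns it into an element of the
      space of curves without changing it there.\<close>
    let ?m = "\<lambda>t. m (max 0 (min 1 t))"
    have mcl: "continuous_on UNIV ?m"
      by (rule continuous_on_compose2[OF mc]) (auto intro!: continuous_intros)
    have "range ?m \<subseteq> m ` {0..1}" by auto
    then have "bounded (range ?m)"
      using bounded_subset compact_imp_bounded[OF compact_continuous_image[OF mc compact_Icc]] by blast
    with mcl have "?m \<in> bcontfun" by (simp add: bcontfun_def)
    then obtain \<mu> where \<mu>: "?m = apply_bcontfun \<mu>" by (rule bcontfunE)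
    \<comment> \<open>Integrating the variational equation gives the affine fixed point equation
      that the derivative of \<open>\<psi>\<close> in direction \<open>v\<close> satisfies too;
      uniqueness makes them equal.\<close>
    have "\<mu> = const_bcontfun v + T' (\<psi> z) \<mu>"
    proof (rule bcontfun_eqI)
      fix t :: real
      define u where "u = max 0 (min 1 t)"
      have u: "u \<in> {0..1}" by (auto simp: u_def)
      have \<mu>s: "apply_bcontfun \<mu> s = m s" if "s \<in> {0..u}" for s
      proof -
        have "max 0 (min 1 s) = s" using that u by auto
        then show ?thesis using fun_cong[OF \<mu>, of s] by simp
      qed
      have "((\<lambda>s. \<delta> *\<^sub>R frechet_derivative F (at (apply_bcontfun (\<psi> z) s)) (m s)) has_integral (m u - m 0)) {0..u}"
        by (rule fundamental_theorem_of_calculus)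
          (use u in \<open>auto intro!: has_vector_derivative_within_subset[OF m]\<close>)
      from integral_unique[OF this] have "m u - v = integral {0..u} (\<lambda>s. \<delta> *\<^sub>R frechet_derivative F (at (apply_bcontfun (\<psi> z) s)) (m s))"
        unfolding m0 by (rule sym)
      also have "\<dots> = integral {0..u} (\<lambda>s. \<delta> *\<^sub>R apply_bcontfun (D F (\<psi> z) \<mu>) s)"
        by (intro integral_cong) (simp add: D_apply[OF \<psi>(1)[OF z] F1] \<mu>s)
      also have "\<dots> = apply_bcontfun (T' (\<psi> z) \<mu>) t"
        by (simp add: T'_apply G_def scaleR_bcontfun.rep_eq antideriv.rep_eq u_def)
      finally show "apply_bcontfun \<mu> t = apply_bcontfun (const_bcontfun v + T' (\<psi> z) \<mu>) t"
        using fun_cong[OF \<mu>, of t] by (simp add: plus_bcontfun.rep_eq const_bcontfun.rep_eq u_def algebra_simps)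
    qed
    moreover have "frechet_derivative const_bcontfun (at z) = (const_bcontfun :: 'a \<Rightarrow> (real \<Rightarrow>\<^sub>C 'a))"
      by (rule frechet_derivative_at[symmetric, OF bounded_linear_imp_has_derivative[OF bounded_linear_const_bcontfun]])
    ultimately have "frechet_derivative \<psi> (at z) v = \<mu>"
      using smooth(2)[OF z, of v] blinfun_affine_fixpoint[OF T'_norm[OF \<psi>(1)[OF z]], of "const_bcontfun v"]
      by metis
    moreover have "((\<lambda>z. apply_bcontfun (\<psi> z) 1) has_derivative (\<lambda>v. apply_bcontfun (frechet_derivative \<psi> (at z) v) 1)) (at z)"
      by (rule bounded_linear.has_derivative[OF bounded_linear_apply_bcontfun smooth_on_has_derivative[OF smooth(1) z]])
    ultimately show "frechet_derivative (\<lambda>z. apply_bcontfun (\<psi> z) 1) (at z) v = m 1"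
      using frechet_derivative_at[symmetric] fun_cong[OF \<mu>, of 1] by fastforce
  qed
qed

section \<open>Smooth inverse functions\<close>

text \<open>In finite dimensions regularity in each fixed direction is regularity in operator norm:
  the operator is the sum of its values on the basis, each turned into a rank-one operator by a
  bounded linear map \<open>R i\<close>.\<close>

lemma Ck_on_Blinfun:
  fixes l :: "'p::real_normed_vector \<Rightarrow> 'a::euclidean_space \<Rightarrow> 'b::real_normed_vector"
  assumes "open S" and lin: "\<And>y. y \<in> S \<Longrightarrow> linear (l y)" and Ck: "\<And>v. Ck_on k S (\<lambda>y. l y v)"
  shows "Ck_on k S (\<lambda>y. Blinfun (l y))"
proof -
  define R where "R i a = Blinfun (\<lambda>v. (v \<bullet> i) *\<^sub>R a)" for i :: 'a and a :: 'b
  have bil: "bounded_bilinear (\<lambda>(a::'b) v. (v \<bullet> i) *\<^sub>R a)" for i :: 'a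
    by (rule bounded_bilinear.flip[OF bounded_bilinear.comp[OF bounded_bilinear_scaleR bounded_linear_inner_left bounded_linear_ident]])
  have R_apply: "blinfun_apply (R i a) = (\<lambda>v. (v \<bullet> i) *\<^sub>R a)" for i a
    unfolding R_def by (rule bounded_linear_Blinfun_apply[OF bounded_bilinear.bounded_linear_right[OF bil]])
  have R_lin: "bounded_linear (R i)" for i
    using transfer_bounded_bilinear_bounded_linearI[of "\<lambda>a v. (v \<bullet> i) *\<^sub>R a" "R i"] bil[of i]
    by (simp add: R_apply)
  have "Ck_on k S (\<lambda>y. \<Sum>i\<in>Basis. R i (l y i))"
    by (intro Ck_on_sum[OF \<open>open S\<close>] Ck_on_linear_compose[OF R_lin \<open>open S\<close>] Ck)
  moreover have "(\<Sum>i\<in>Basis. R i (l y i)) = Blinfun (l y)" if "y \<in> S" for y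
  proof (rule blinfun_eqI)
    fix v
    show "blinfun_apply (\<Sum>i\<in>Basis. R i (l y i)) v = blinfun_apply (Blinfun (l y)) v"
      using lin[OF that]
      by (simp add: blinfun.sum_left R_apply bounded_linear_Blinfun_apply linear_conv_bounded_linear[symmetric]
          linear_euclidean_expand[OF lin[OF that], of v])
  qed
  ultimately show ?thesis by (rule Ck_on_cong[OF \<open>open S\<close>, rotated])
qed

lemma smooth_on_Blinfun:
  fixes l :: "'p::real_normed_vector \<Rightarrow> 'a::euclidean_space \<Rightarrow> 'b::real_normed_vector"
  shows "open S \<Longrightarrow> (\<And>y. y \<in> S \<Longrightarrow> linear (l y)) \<Longrightarrow> (\<And>v. smooth_on S (\<lambda>y. l y v)) \<Longrightarrow>
    smooth_on S (\<lambda>y. Blinfun (l y))"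
  unfolding smooth_on_def using Ck_on_Blinfun[of S l] by blast

text \<open>Near \<open>z\<close>, an equation \<open>l y x = c\<close> is equivalent to a contractive fixed point equation.\<close>

lemma linear_perturbation:
  fixes l :: "'p::real_normed_vector \<Rightarrow> 'a::euclidean_space \<Rightarrow> 'b::euclidean_space"
  assumes "open S" "z \<in> S" and lin: "\<And>y. y \<in> S \<Longrightarrow> linear (l y)" and Ck: "\<And>v. Ck_on k S (\<lambda>y. l y v)"
    and A: "linear A" "\<And>v. A (l z v) = v" "\<And>w. l z (A w) = w"
  obtains T L where "open T" "z \<in> T" "T \<subseteq> S" "Ck_on k T L" "\<And>y. y \<in> T \<Longrightarrow> norm (L y) \<le> 1/2"
    "\<And>y v. y \<in> T \<Longrightarrow> blinfun_apply (L y) v = v - A (l y v)" "L z = 0"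
proof -
  \<comment> \<open>This deviation of \<open>A \<circ> l y\<close> from the identity vanishes at
    \<open>z\<close>, so by continuity its norm is at most 1/2 nearby.\<close>
  define L where "L y = Blinfun (\<lambda>v. v - A (l y v))" for y
  have lin': "linear (\<lambda>v. v - A (l y v))" if "y \<in> S" for y
    using linear_compose_sub[OF linear_id linear_compose[OF lin[OF that] A(1)]] by (simp add: o_def id_def)
  have L_apply: "blinfun_apply (L y) v = v - A (l y v)" if "y \<in> S" for y v
    using lin'[OF that] by (simp add: L_def bounded_linear_Blinfun_apply linear_conv_bounded_linear[symmetric])
  have bA: "bounded_linear A" using A(1) by (simp add: linear_conv_bounded_linear)
  have "Ck_on k S L" unfolding L_def
    by (intro Ck_on_Blinfun[OF \<open>open S\<close> lin'] Ck_on_diff[OF \<open>open S\<close>] Ck_on_const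
        Ck_on_linear_compose[OF bA \<open>open S\<close>] Ck)
  then have cont: "continuous_on S L" by (rule Ck_on_continuous_on)
  have L0: "L z = 0" by (rule blinfun_eqI) (simp add: L_apply[OF \<open>z \<in> S\<close>] A(2))
  define T where "T = S \<inter> L -` ball 0 (1/2)"
  show thesis
  proof (rule that)
    show "open T" unfolding T_def by (rule continuous_open_preimage[OF cont \<open>open S\<close> open_ball])
    show "z \<in> T" using \<open>z \<in> S\<close> L0 by (simp add: T_def)
    show "T \<subseteq> S" by (simp add: T_def)
    show "Ck_on k T L" by (rule Ck_on_subset[OF \<open>Ck_on k S L\<close>]) (simp add: T_def)
    show "norm (L y) \<le> 1/2" if "y \<in> T" for y using that by (simp add: T_def)
    show "blinfun_apply (L y) v = v - A (l y v)" if "y \<in> T" for y v using that L_apply by (simp add: T_def)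
  qed (rule L0)
qed

text \<open>Bootstrap on the formula for the derivative: if \<open>g\<close> is of class
  \<open>k\<close>, so is the Jacobian of \<open>f\<close> along \<open>g\<close>, and a column of
  the inverse Jacobian is the solution of an affine fixed point equation with coefficients of that
  class.\<close>

lemma smooth_on_inverse:
  fixes f g :: "'a::euclidean_space \<Rightarrow> 'a"
  assumes "open U" "open V" and f: "smooth_on U f" and gU: "\<And>y. y \<in> V \<Longrightarrow> g y \<in> U"
    and g: "\<And>y. y \<in> V \<Longrightarrow> (g has_derivative inv (frechet_derivative f (at (g y)))) (at y)"
    and bij: "\<And>y. y \<in> V \<Longrightarrow> bij (frechet_derivative f (at (g y)))"
  shows "smooth_on V g"
proof -
  have "Ck_on k V g" for k
  proof (induction k)
    case 0
    show ?case unfolding Ck_on.simps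
      using g has_derivative_continuous continuous_at_imp_continuous_on by blast
  next
    case (Suc k)
    let ?l = "\<lambda>y. frechet_derivative f (at (g y))" and ?w = "\<lambda>v y. inv (frechet_derivative f (at (g y))) v"
    have lin: "linear (?l y)" if "y \<in> V" for y
      by (rule has_derivative_linear[OF smooth_on_has_derivative[OF f gU[OF that]]])
    have Ckl: "Ck_on k V (\<lambda>y. ?l y v)" for v
      by (rule Ck_on_compose[OF assms(2,1) gU Suc smooth_on_Ck[OF smooth_on_frechet_derivative[OF f]]])
    have inv1: "inv (?l y) (?l y v) = v" and inv2: "?l y (inv (?l y) v) = v" if "y \<in> V" for y v
      using bij[OF that] by (simp_all add: bij_is_inj bij_is_surj surj_f_inv_f)
    have "Ck_on k V (?w v)" for v
    proof (rule Ck_on_local)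
      \<comment> \<open>The contractive form holds only near a given point, on a neighbourhood that
        may depend on \<open>k\<close>; hence the passage to a local statement.\<close>
      fix z assume z: "z \<in> V"
      have linv: "linear (inv (?l z))" by (rule has_derivative_linear[OF g[OF z]])
      obtain T L where T: "open T" "z \<in> T" "T \<subseteq> V" "Ck_on k T L" "\<And>y. y \<in> T \<Longrightarrow> norm (L y) \<le> 1/2"
        "\<And>y v. y \<in> T \<Longrightarrow> blinfun_apply (L y) v = v - inv (?l z) (?l y v)" "L z = 0"
        by (rule linear_perturbation[OF \<open>open V\<close> z lin Ckl linv inv1[OF z] inv2[OF z]]) blast+
      have "Ck_on k T (?w v)"
      proof (rule blinfun_fixpoint_Ck_on[OF T(1,5,4) Ck_on_const])
        show "?w v y = inv (?l z) v + blinfun_apply (L y) (?w v y)" if "y \<in> T" for y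
          using inv2[of y v] that T(3) by (simp add: T(6)[OF that] subset_iff)
      qed
      then show "\<exists>T. open T \<and> z \<in> T \<and> Ck_on k T (?w v)" using T by blast
    qed
    then show ?case using g by (intro Ck_on_SucI[OF \<open>open V\<close>])
  qed
  then show ?thesis by (simp add: smooth_on_def)
qed

text \<open>The continuously differentiable inverse function theorem gives \<open>g\<close>, and the
  bootstrap above makes it smooth. Injectivity of the Jacobian suffices as domain and range have the
  same dimension.\<close>

lemma smooth_inverse_function:
  fixes f :: "'a::euclidean_space \<Rightarrow> 'a"
  assumes "open S" "x0 \<in> S" and f: "smooth_on S f" and inj: "inj (frechet_derivative f (at x0))"
  obtains U V g where "open U" "x0 \<in> U" "U \<subseteq> S" "open V" "homeomorphism U V f g" "smooth_on V g"
    "\<And>y. y \<in> V \<Longrightarrow> (g has_derivative inv (frechet_derivative f (at (g y)))) (at y)"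
    "\<And>y. y \<in> V \<Longrightarrow> bij (frechet_derivative f (at (g y)))"
proof -
  define f' where "f' x = Blinfun (frechet_derivative f (at x))" for x
  have lin: "linear (frechet_derivative f (at x))" if "x \<in> S" for x
    by (rule has_derivative_linear[OF smooth_on_has_derivative[OF f that]])
  have f'_apply: "blinfun_apply (f' x) = frechet_derivative f (at x)" if "x \<in> S" for x
    using lin[OF that] by (simp add: f'_def bounded_linear_Blinfun_apply linear_conv_bounded_linear[symmetric])
  have cf': "continuous_on S f'" unfolding f'_def
    by (rule smooth_on_continuous_on[OF smooth_on_Blinfun[OF \<open>open S\<close> lin smooth_on_frechet_derivative[OF f]]])
  have bij0: "bij (frechet_derivative f (at x0))"
    using inj linear_injective_imp_surjective[OF lin[OF \<open>x0 \<in> S\<close>] inj] by (simp add: bij_def)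
  have lininv: "linear (inv (frechet_derivative f (at x0)))"
    using inj_linear_imp_inv_linear[OF lin[OF \<open>x0 \<in> S\<close>] inj] .
  have inv0: "Blinfun (inv (frechet_derivative f (at x0))) o\<^sub>L f' x0 = id_blinfun"
    using lininv inj
    by (intro blinfun_eqI)
      (simp add: bounded_linear_Blinfun_apply linear_conv_bounded_linear[symmetric] f'_apply[OF \<open>x0 \<in> S\<close>])
  have derf: "(f has_derivative blinfun_apply (f' x)) (at x)" if "x \<in> S" for x
    using smooth_on_has_derivative[OF f that] by (simp add: f'_apply[OF that])
  obtain U V g g' where U: "open U" "U \<subseteq> S" "x0 \<in> U" "open V" "f x0 \<in> V" "homeomorphism U V f g"
    and g: "\<And>y. y \<in> V \<Longrightarrow> (g has_derivative g' y) (at y)"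
      "\<And>y. y \<in> V \<Longrightarrow> g' y = inv (blinfun_apply (f' (g y)))"
      "\<And>y. y \<in> V \<Longrightarrow> bij (blinfun_apply (f' (g y)))"
    by (rule inverse_function_theorem[OF \<open>open S\<close> derf cf' \<open>x0 \<in> S\<close> inv0]) blast+
  have gS: "g y \<in> S" if "y \<in> V" for y using U(2) homeomorphism_image2[OF U(6)] that by blast
  have d: "(g has_derivative inv (frechet_derivative f (at (g y)))) (at y)" if "y \<in> V" for y
    using g(1,2)[OF that] by (simp add: f'_apply[OF gS[OF that]])
  have b: "bij (frechet_derivative f (at (g y)))" if "y \<in> V" for y
    using g(3)[OF that] by (simp add: f'_apply[OF gS[OF that]])
  show thesis
    by (rule that[OF U(1,3,2,4,6) smooth_on_inverse[OF \<open>open S\<close> \<open>open V\<close> f gS d b] d b])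
qed

section \<open>The Frobenius theorem\<close>

lemma frechet_derivative_eqI: "(f has_derivative f') (at x) \<Longrightarrow> frechet_derivative f (at x) = f'"
  by (rule frechet_derivative_at[symmetric])

lemma constant_of_vector_derivative_zero:
  fixes f :: "real \<Rightarrow> 'a::real_normed_vector"
  assumes "\<And>t. t \<in> {0..1} \<Longrightarrow> (f has_vector_derivative 0) (at t within {0..1})" and "t \<in> {0..1}"
  shows "f t = f 0"
proof -
  obtain c where "\<And>s. s \<in> {0..1} \<Longrightarrow> f s = c"
    using has_vector_derivative_zero_constant[of "{0..1}" f] assms(1) by auto
  then show ?thesis using assms(2) by simp
qed

text \<open>A product rule for applying forms to vector fields. Passing to operators turns the
  evaluation into a bounded bilinear map although \<open>l\<close> is assumed smooth in fixed
  directions only.\<close>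

lemma frechet_derivative_linear_family:
  fixes l :: "'p::real_normed_vector \<Rightarrow> 'a::euclidean_space \<Rightarrow> 'b::real_normed_vector"
  assumes "open S" "y \<in> S" and lin: "\<And>y. y \<in> S \<Longrightarrow> linear (l y)"
    and l: "\<And>v. smooth_on S (\<lambda>y. l y v)" and X: "(X has_derivative X') (at y)"
  shows "((\<lambda>z. l z (X z)) has_derivative (\<lambda>w. frechet_derivative (\<lambda>z. l z (X y)) (at y) w + l y (X' w))) (at y)"
proof -
  define L where "L y = Blinfun (l y)" for y
  have L_apply: "blinfun_apply (L z) = l z" if "z \<in> S" for z
    using lin[OF that] by (simp add: L_def bounded_linear_Blinfun_apply linear_conv_bounded_linear[symmetric])
  have L: "smooth_on S L" unfolding L_def by (rule smooth_on_Blinfun[OF \<open>open S\<close> lin l])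
  note dL = smooth_on_has_derivative[OF L \<open>y \<in> S\<close>]
  have "((\<lambda>z. blinfun_apply (L z) v) has_derivative (\<lambda>w. blinfun_apply (frechet_derivative L (at y) w) v)) (at y)" for v
    using bounded_linear.has_derivative[OF blinfun.bounded_linear_left dL] .
  then have "((\<lambda>z. l z v) has_derivative (\<lambda>w. blinfun_apply (frechet_derivative L (at y) w) v)) (at y)" for v
    by (rule has_derivative_transform_within_open[OF _ \<open>open S\<close> \<open>y \<in> S\<close>]) (simp add: L_apply)
  then have fd: "frechet_derivative (\<lambda>z. l z v) (at y) = (\<lambda>w. blinfun_apply (frechet_derivative L (at y) w) v)" for v
    by (rule frechet_derivative_eqI)
  have "((\<lambda>z. blinfun_apply (L z) (X z)) has_derivative
      (\<lambda>w. blinfun_apply (L y) (X' w) + blinfun_apply (frechet_derivative L (at y) w) (X y))) (at y)"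
    by (rule bounded_bilinear.FDERIV[OF bounded_bilinear_blinfun_apply dL X])
  then have "((\<lambda>z. l z (X z)) has_derivative
      (\<lambda>w. blinfun_apply (L y) (X' w) + blinfun_apply (frechet_derivative L (at y) w) (X y))) (at y)"
    by (rule has_derivative_transform_within_open[OF _ \<open>open S\<close> \<open>y \<in> S\<close>]) (simp add: L_apply)
  then show ?thesis by (simp add: fd L_apply[OF \<open>y \<in> S\<close>] add.commute)
qed

text \<open>
  The flows of commuting vector fields fit together to an immersion \<open>\<Phi> (q, \<sigma>)\<close>, the time \<open>1\<close> flow of
  \<open>\<delta> *\<^sub>R X \<sigma>\<close> from \<open>q\<close>: both the derivative of the flow in direction \<open>\<tau>\<close> and \<open>t *\<^sub>R \<delta> *\<^sub>R X \<tau>\<close> solve the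
  same linear equation along the flow line.
\<close>

lemma commuting_flow:
  fixes X :: "'b::euclidean_space \<Rightarrow> 'v::euclidean_space \<Rightarrow> 'v"
  assumes "open V" "z0 \<in> V" and X: "\<And>\<sigma>. smooth_on V (X \<sigma>)"
    and lin: "\<And>y. y \<in> V \<Longrightarrow> linear (\<lambda>\<sigma>. X \<sigma> y)"
    and comm: "\<And>y \<sigma> \<tau>. y \<in> V \<Longrightarrow>
      frechet_derivative (X \<sigma>) (at y) (X \<tau> y) = frechet_derivative (X \<tau>) (at y) (X \<sigma> y)"
  obtains \<delta> U \<Phi> where "\<delta> > 0" "open U" "(z0, 0) \<in> U" "smooth_on U \<Phi>"
    "\<And>p. p \<in> U \<Longrightarrow> \<Phi> p \<in> V" "\<And>q. (q, 0) \<in> U \<Longrightarrow> \<Phi> (q, 0) = q"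
    "\<And>p \<tau>. p \<in> U \<Longrightarrow> frechet_derivative \<Phi> (at p) (0, \<tau>) = \<delta> *\<^sub>R X \<tau> (\<Phi> p)"
proof -
  define S where "S = V \<times> (UNIV :: 'b set)"
  have S: "open S" using \<open>open V\<close> by (simp add: S_def open_Times)
  have Xsum: "X \<sigma> y = (\<Sum>j\<in>Basis. (\<sigma> \<bullet> j) *\<^sub>R X j y)" if "y \<in> V" for \<sigma> y
    by (rule linear_euclidean_expand[OF lin[OF that]])
  have DX: "(X \<sigma> has_derivative frechet_derivative (X \<sigma>) (at y)) (at y)" if "y \<in> V" for \<sigma> y
    by (rule smooth_on_has_derivative[OF X that])
  have DXsum: "frechet_derivative (X \<sigma>) (at y) w = (\<Sum>j\<in>Basis. (\<sigma> \<bullet> j) *\<^sub>R frechet_derivative (X j) (at y) w)"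
    if "y \<in> V" for \<sigma> y w
  proof -
    have "((\<lambda>y. \<Sum>j\<in>Basis. (\<sigma> \<bullet> j) *\<^sub>R X j y) has_derivative
        (\<lambda>w. \<Sum>j\<in>Basis. (\<sigma> \<bullet> j) *\<^sub>R frechet_derivative (X j) (at y) w)) (at y)"
      by (intro has_derivative_sum has_derivative_scaleR_right DX that)
    then have "(X \<sigma> has_derivative
        (\<lambda>w. \<Sum>j\<in>Basis. (\<sigma> \<bullet> j) *\<^sub>R frechet_derivative (X j) (at y) w)) (at y)"
      by (rule has_derivative_transform_within_open[OF _ \<open>open V\<close> that]) (rule Xsum[symmetric])
    then show ?thesis by (rule fun_cong[OF frechet_derivative_eqI])
  qed
  \<comment> \<open>The parameter is carried along as a constant component, so smooth dependence on
    it is smooth dependence on the initial value. The basis expansion in \<open>\<sigma>\<close>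
    makes the field jointly smooth.\<close>
  define F :: "'v \<times> 'b \<Rightarrow> 'v \<times> 'b" where "F p = (\<Sum>j\<in>Basis. (snd p \<bullet> j) *\<^sub>R X j (fst p), 0)" for p
  have F_eq: "F (y, \<sigma>) = (X \<sigma> y, 0)" if "y \<in> V" for y \<sigma> by (simp add: F_def Xsum[OF that, symmetric])
  have bl: "bounded_linear (\<lambda>p :: 'v \<times> 'b. snd p \<bullet> j)" for j
    by (rule bounded_linear_compose[OF bounded_linear_inner_left bounded_linear_snd])
  have XS: "smooth_on S (\<lambda>p. X j (fst p))" for j
  proof (rule smooth_on_compose[where f = "X j" and g = fst, OF S \<open>open V\<close>])
    show "fst x \<in> V" if "x \<in> S" for x using that by (simp add: S_def mem_Times_iff)
  qed (rule smooth_on_bounded_linear[OF bounded_linear_fst S] X)+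
  have "smooth_on S (\<lambda>p. \<Sum>j\<in>Basis. (snd p \<bullet> j) *\<^sub>R X j (fst p))"
    by (rule smooth_on_sum[OF S], rule smooth_on_scaleR[OF S smooth_on_bounded_linear[OF bl S] XS])
  then have F: "smooth_on S F"
    unfolding F_def[abs_def] by (rule smooth_on_Pair[OF S _ smooth_on_const])
  have DF: "frechet_derivative F (at (y, \<sigma>)) (w, \<tau>) = (frechet_derivative (X \<sigma>) (at y) w + X \<tau> y, 0)"
    if "y \<in> V" for y \<sigma> w \<tau>
  proof -
    have dj: "((\<lambda>p. X j (fst p)) has_derivative (\<lambda>h. frechet_derivative (X j) (at y) (fst h))) (at (y, \<sigma>))" for j
      using DX[OF that] by (auto intro!: has_derivative_compose[of fst fst _ _ "X j"] has_derivative_fst[OF has_derivative_ident])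
    have "(F has_derivative (\<lambda>h. (\<Sum>j\<in>Basis. ((snd (y, \<sigma>) \<bullet> j) *\<^sub>R frechet_derivative (X j) (at y) (fst h)
        + (snd h \<bullet> j) *\<^sub>R X j (fst (y, \<sigma>))), 0))) (at (y, \<sigma>))"
      unfolding F_def[abs_def]
      by (intro has_derivative_Pair has_derivative_sum has_derivative_const
          bounded_bilinear.FDERIV[OF bounded_bilinear_scaleR] dj bounded_linear_imp_has_derivative bl)
    from frechet_derivative_eqI[OF this] show ?thesis
      by (simp add: DXsum[OF that, symmetric] Xsum[OF that, symmetric] sum.distrib)
  qed
  have "(z0, 0) \<in> S" using \<open>z0 \<in> V\<close> by (simp add: S_def)
  show thesis
  proof (rule smooth_flow[OF S F \<open>(z0, 0) \<in> S\<close>])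
    fix \<delta> :: real and U and \<phi> :: "'v \<times> 'b \<Rightarrow> real \<Rightarrow> 'v \<times> 'b" assume \<phi>: "\<delta> > 0" "open U" "(z0, 0) \<in> U"
      "\<And>z t. z \<in> U \<Longrightarrow> t \<in> {0..1} \<Longrightarrow> \<phi> z t \<in> S"
      "\<And>z. z \<in> U \<Longrightarrow> \<phi> z 0 = z"
      "\<And>z t. z \<in> U \<Longrightarrow> t \<in> {0..1} \<Longrightarrow> (\<phi> z has_vector_derivative \<delta> *\<^sub>R F (\<phi> z t)) (at t within {0..1})"
      "\<And>t. smooth_on U (\<lambda>z. \<phi> z t)"
      "\<And>z v m. z \<in> U \<Longrightarrow> m 0 = v \<Longrightarrow>
        (\<And>t. t \<in> {0..1} \<Longrightarrow>
          (m has_vector_derivative \<delta> *\<^sub>R frechet_derivative F (at (\<phi> z t)) (m t)) (at t within {0..1})) \<Longrightarrow>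
        frechet_derivative (\<lambda>z. \<phi> z 1) (at z) v = m (1::real)"
    have sndF: "snd (F p) = 0" for p by (simp add: F_def)
    have snd_\<phi>: "snd (\<phi> z t) = snd z" if "z \<in> U" "t \<in> {0..1}" for z t
    proof -
      have "((\<lambda>s. snd (\<phi> z s)) has_vector_derivative 0) (at s within {0..1})" if "s \<in> {0..1}" for s
        using bounded_linear.has_vector_derivative[OF bounded_linear_snd \<phi>(6)[OF \<open>z \<in> U\<close> that]]
        by (simp add: sndF)
      from constant_of_vector_derivative_zero[OF this that(2)] show ?thesis by (simp add: \<phi>(5)[OF that(1)])
    qed
    have fst_\<phi>: "fst (\<phi> z t) \<in> V" if "z \<in> U" "t \<in> {0..1}" for z t
      using \<phi>(4)[OF that] by (auto simp: S_def mem_Times_iff)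
    have \<phi>_eq: "\<phi> z t = (fst (\<phi> z t), snd z)" if "z \<in> U" "t \<in> {0..1}" for z t
      using snd_\<phi>[OF that] by (simp add: prod_eq_iff)
    have F\<phi>: "F (\<phi> z t) = (X (snd z) (fst (\<phi> z t)), 0)" if "z \<in> U" "t \<in> {0..1}" for z t
      using F_eq[OF fst_\<phi>[OF that], of "snd z"] \<phi>_eq[OF that] by simp
    have d\<phi>: "((\<lambda>s. fst (\<phi> z s)) has_vector_derivative \<delta> *\<^sub>R X (snd z) (fst (\<phi> z t))) (at t within {0..1})"
      if "z \<in> U" "t \<in> {0..1}" for z t
      using bounded_linear.has_vector_derivative[OF bounded_linear_fst \<phi>(6)[OF that]] by (simp add: F\<phi>[OF that])
    define \<Phi> where "\<Phi> p = fst (\<phi> p 1)" for p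
    show thesis
    proof (rule that[OF \<phi>(1-3)])
      show "smooth_on U \<Phi>" unfolding \<Phi>_def[abs_def] by (rule smooth_on_linear_compose[OF bounded_linear_fst \<phi>(2,7)])
      show "\<Phi> p \<in> V" if "p \<in> U" for p using fst_\<phi>[OF that] by (simp add: \<Phi>_def)
      show "\<Phi> (q, 0) = q" if q: "(q, 0) \<in> U" for q
      proof -
        have "((\<lambda>s. fst (\<phi> (q, 0) s)) has_vector_derivative 0) (at s within {0..1})" if "s \<in> {0..1}" for s
          using d\<phi>[OF q that] linear_0[OF lin[OF fst_\<phi>[OF q that]]] by simp
        from constant_of_vector_derivative_zero[OF this, of 1] show ?thesis by (simp add: \<phi>(5)[OF q] \<Phi>_def)
      qed
      fix p \<tau> assume p: "p \<in> U"
      let ?u = "\<lambda>t. fst (\<phi> p t)"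
      \<comment> \<open>The guess for the variational equation. Its derivative contains the
        derivative of \<open>X \<tau>\<close> along \<open>X (snd p)\<close>, the equation that of
        \<open>X (snd p)\<close> along \<open>X \<tau>\<close>; commutation identifies the
        two.\<close>
      let ?m = "\<lambda>t::real. (t *\<^sub>R (\<delta> *\<^sub>R X \<tau> (?u t)), \<tau>)"
      have "frechet_derivative (\<lambda>z. \<phi> z 1) (at p) (0, \<tau>) = ?m 1"
      proof (rule \<phi>(8)[OF p])
        show "(?m has_vector_derivative \<delta> *\<^sub>R frechet_derivative F (at (\<phi> p t)) (?m t)) (at t within {0..1})"
          if t: "t \<in> {0..1}" for t
        proof -
          have u: "?u t \<in> V" by (rule fst_\<phi>[OF p t])
          note DXt = DX[OF u, of \<tau>]
          have lD: "linear (frechet_derivative (X \<rho>) (at (?u t)))" for \<rho>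
            by (rule has_derivative_linear[OF DX[OF u]])
          have "((X \<tau> \<circ> ?u) has_vector_derivative frechet_derivative (X \<tau>) (at (?u t)) (\<delta> *\<^sub>R X (snd p) (?u t)))
              (at t within {0..1})"
            using diff_chain_within[OF d\<phi>[OF p t, unfolded has_vector_derivative_def] has_derivative_at_withinI[OF DXt]]
            by (simp add: has_vector_derivative_def o_def linear_scale[OF lD] scaleR_left_commute)
          then have 1: "((\<lambda>s. X \<tau> (?u s)) has_vector_derivative \<delta> *\<^sub>R frechet_derivative (X \<tau>) (at (?u t)) (X (snd p) (?u t)))
              (at t within {0..1})"
            by (simp add: o_def linear_scale[OF lD])
          have 2: "((\<lambda>s. s *\<^sub>R (\<delta> *\<^sub>R X \<tau> (?u s))) has_vector_derivative
              t *\<^sub>R (\<delta> *\<^sub>R (\<delta> *\<^sub>R frechet_derivative (X \<tau>) (at (?u t)) (X (snd p) (?u t)))) + 1 *\<^sub>R (\<delta> *\<^sub>R X \<tau> (?u t)))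
              (at t within {0..1})"
            by (rule has_vector_derivative_scaleR[OF DERIV_ident
                bounded_linear.has_vector_derivative[OF bounded_linear_scaleR_right 1]])
          have "\<delta> *\<^sub>R frechet_derivative F (at (\<phi> p t)) (?m t) =
              (\<delta> *\<^sub>R (frechet_derivative (X (snd p)) (at (?u t)) (t *\<^sub>R (\<delta> *\<^sub>R X \<tau> (?u t))) + X \<tau> (?u t)), 0)"
            by (subst \<phi>_eq[OF p t]) (simp add: DF[OF u])
          also have "\<dots> = (t *\<^sub>R (\<delta> *\<^sub>R (\<delta> *\<^sub>R frechet_derivative (X \<tau>) (at (?u t)) (X (snd p) (?u t)))) + 1 *\<^sub>R (\<delta> *\<^sub>R X \<tau> (?u t)), 0)"
            by (simp add: linear_scale[OF lD] comm[OF u, of "snd p" \<tau>] scaleR_add_right mult_ac)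
          finally show ?thesis
            using has_vector_derivative_Pair[OF 2 has_vector_derivative_const[of \<tau>]] by simp
        qed
      qed simp
      moreover have "(\<Phi> has_derivative (\<lambda>h. fst (frechet_derivative (\<lambda>z. \<phi> z 1) (at p) h))) (at p)"
        unfolding \<Phi>_def[abs_def]
        by (rule bounded_linear.has_derivative[OF bounded_linear_fst smooth_on_has_derivative[OF \<phi>(7) p]])
      ultimately show "frechet_derivative \<Phi> (at p) (0, \<tau>) = \<delta> *\<^sub>R X \<tau> (\<Phi> p)"
        by (simp add: frechet_derivative_eqI \<Phi>_def)
    qed
  qed
qed

text \<open>The map \<open>\<pi>\<close> chooses a complement to the forms at \<open>z0\<close>, and
  \<open>A\<close> inverts the pair, so that the affine space of points
  \<open>z0 + A (\<xi>, 0)\<close> is transversal to the kernel. The flows sweep out the leaves from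
  this transversal, and \<open>h\<close> reads off the \<open>\<xi>\<close> of the leaf through a
  point. Hypothesis \<open>integrable\<close> says that the exterior derivative vanishes on pairs of
  kernel vectors.\<close>

theorem frobenius:
  fixes \<omega> :: "'v::euclidean_space \<Rightarrow> 'v \<Rightarrow> 'a::euclidean_space" and \<pi> :: "'v \<Rightarrow> 'b::euclidean_space"
  assumes "open V" "z0 \<in> V" and \<omega>: "\<And>v. smooth_on V (\<lambda>y. \<omega> y v)" and lin: "\<And>y. y \<in> V \<Longrightarrow> linear (\<omega> y)"
    and \<pi>: "linear \<pi>" and A: "linear A" "\<And>v. A (\<omega> z0 v, \<pi> v) = v" "\<And>p. (\<omega> z0 (A p), \<pi> (A p)) = p"
    and integrable: "\<And>y v w. y \<in> V \<Longrightarrow> \<omega> y v = 0 \<Longrightarrow> \<omega> y w = 0 \<Longrightarrow>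
      frechet_derivative (\<lambda>z. \<omega> z w) (at y) v = frechet_derivative (\<lambda>z. \<omega> z v) (at y) w"
  obtains U h where "open U" "z0 \<in> U" "U \<subseteq> V" "smooth_on U h"
    "\<And>y v. y \<in> U \<Longrightarrow> (frechet_derivative h (at y) v :: 'a) = 0 \<longleftrightarrow> \<omega> y v = 0"
proof -
  define l where "l y v = (\<omega> y v, \<pi> v)" for y v
  have l_lin: "linear (l y)" if "y \<in> V" for y
  proof
    show "l y (u + v) = l y u + l y v" "l y (c *\<^sub>R v) = c *\<^sub>R l y v" for u v c
      by (simp_all add: l_def linear_add[OF lin[OF that]] linear_add[OF \<pi>] linear_scale[OF lin[OF that]] linear_scale[OF \<pi>])
  qed
  have l_smooth: "smooth_on V (\<lambda>y. l y v)" for v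
    unfolding l_def by (rule smooth_on_Pair[OF \<open>open V\<close> \<omega> smooth_on_const])
  have Al: "A (l z0 v) = v" and lA: "l z0 (A p) = p" for v p using A(2,3) by (simp_all add: l_def)
  have A_inj: "A p = A q \<longleftrightarrow> p = q" for p q using lA by metis
  define c where "c y v = v - A (l y v)" for y v
  have "\<exists>T L. open T \<and> z0 \<in> T \<and> T \<subseteq> V \<and> smooth_on T L \<and> (\<forall>y\<in>T. norm (L y) \<le> 1/2 \<and> blinfun_apply (L y) = c y)"
  proof -
    \<comment> \<open>The neighbourhood from the perturbation lemma could shrink with the order. It
      is therefore taken once, for order 0, and \<open>L\<close> is then seen to be smooth on it
      from its explicit form.\<close>
    have Ck0: "Ck_on 0 V (\<lambda>y. l y v)" for v by (rule smooth_on_Ck[OF l_smooth])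
    obtain T L where T: "open T" "z0 \<in> T" "T \<subseteq> V" "Ck_on 0 T L" "\<And>y. y \<in> T \<Longrightarrow> norm (L y) \<le> 1/2"
      "\<And>y v. y \<in> T \<Longrightarrow> blinfun_apply (L y) v = v - A (l y v)" "L z0 = 0"
      by (rule linear_perturbation[OF \<open>open V\<close> \<open>z0 \<in> V\<close> l_lin Ck0 A(1) Al lA]) blast+
    have bA: "bounded_linear A" using A(1) by (simp add: linear_conv_bounded_linear)
    have Lc: "blinfun_apply (L y) = c y" if "y \<in> T" for y
      by (rule ext) (simp add: T(6)[OF that] c_def)
    have L: "L y = Blinfun (c y)" if "y \<in> T" for y
      by (simp add: Lc[OF that, symmetric] blinfun_apply_inverse)
    have cl: "linear (c y)" if "y \<in> T" for y
      unfolding Lc[OF that, symmetric] by (rule bounded_linear.linear[OF blinfun.bounded_linear_right])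
    have "smooth_on T (\<lambda>y. c y v)" for v unfolding c_def
      by (intro smooth_on_diff[OF \<open>open T\<close>] smooth_on_const smooth_on_linear_compose[OF bA \<open>open T\<close>]
          smooth_on_subset[OF l_smooth T(3)])
    with cl have "smooth_on T (\<lambda>y. Blinfun (c y))" by (rule smooth_on_Blinfun[OF \<open>open T\<close>])
    then have "smooth_on T L" by (rule smooth_on_cong[OF \<open>open T\<close>, rotated]) (rule L[symmetric])
    with T(1-3,5) Lc show ?thesis by blast
  qed
  then obtain T L where T: "open T" "z0 \<in> T" "T \<subseteq> V" "smooth_on T L"
    and L: "\<And>y. y \<in> T \<Longrightarrow> norm (L y) \<le> 1/2" "\<And>y. y \<in> T \<Longrightarrow> blinfun_apply (L y) = c y" by blast
  \<comment> \<open>The unique vector in the kernel of \<open>\<omega> y\<close> whose projection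
    under \<open>\<pi>\<close> is \<open>\<sigma>\<close>; the fixed point form makes it smooth in
    \<open>y\<close>.\<close>
  define X where "X \<sigma> y = (THE x. x = A (0, \<sigma>) + L y x)" for \<sigma> y
  have fix_iff: "x = A (0, \<sigma>) + L y x \<longleftrightarrow> \<omega> y x = 0 \<and> \<pi> x = \<sigma>" if "y \<in> T" for x y \<sigma>
  proof -
    have "x = A (0, \<sigma>) + L y x \<longleftrightarrow> A (l y x) = A (0, \<sigma>)" by (auto simp: L(2)[OF that] c_def algebra_simps)
    then show ?thesis by (simp add: A_inj l_def)
  qed
  have ex1: "\<exists>!x. x = A (0, \<sigma>) + L y x" if "y \<in> T" for \<sigma> y by (rule blinfun_affine_fixpoint[OF L(1)[OF that]])
  have X_eq: "X \<sigma> y = A (0, \<sigma>) + L y (X \<sigma> y)" if "y \<in> T" for \<sigma> y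
    unfolding X_def by (rule theI') (rule ex1[OF that])
  have X: "\<omega> y (X \<sigma> y) = 0" "\<pi> (X \<sigma> y) = \<sigma>" if "y \<in> T" for \<sigma> y
    using X_eq[OF that, of \<sigma>] unfolding fix_iff[OF that] by auto
  have X_unique: "x = X (\<pi> x) y" if "y \<in> T" "\<omega> y x = 0" for x y
  proof -
    have "x = A (0, \<pi> x) + L y x" using that by (simp only: fix_iff)
    then show ?thesis using ex1[OF that(1), of "\<pi> x"] X_eq[OF that(1), of "\<pi> x"] by blast
  qed
  have X_smooth: "smooth_on T (X \<sigma>)" for \<sigma>
    unfolding smooth_on_def
  proof
    show "Ck_on k T (X \<sigma>)" for k
      by (rule blinfun_fixpoint_Ck_on[OF T(1) L(1) smooth_on_Ck[OF T(4)] Ck_on_const X_eq])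
  qed
  have linT: "linear (\<omega> y)" if "y \<in> T" for y using lin that T(3) by blast
  have \<omega>T: "smooth_on T (\<lambda>y. \<omega> y v)" for v by (rule smooth_on_subset[OF \<omega> T(3)])
  have X_lin: "linear (\<lambda>\<sigma>. X \<sigma> y)" if "y \<in> T" for y
  proof
    note la = linear_add[OF linT[OF that]] linear_scale[OF linT[OF that]] linear_add[OF \<pi>] linear_scale[OF \<pi>]
    show "X (\<sigma> + \<tau>) y = X \<sigma> y + X \<tau> y" for \<sigma> \<tau>
      using X_unique[OF that, of "X \<sigma> y + X \<tau> y"] by (simp add: la X[OF that])
    show "X (r *\<^sub>R \<sigma>) y = r *\<^sub>R X \<sigma> y" for r \<sigma>
      using X_unique[OF that, of "r *\<^sub>R X \<sigma> y"] by (simp add: la X[OF that])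
  qed
  have X_zero: "X 0 y = 0" if "y \<in> T" for y by (rule linear_0[OF X_lin[OF that]])
  have \<pi>D: "\<pi> (frechet_derivative (X \<sigma>) (at y) w) = 0" if "y \<in> T" for \<sigma> y w
  proof -
    have "bounded_linear \<pi>" using \<pi> by (simp add: linear_conv_bounded_linear)
    from bounded_linear.has_derivative[OF this smooth_on_has_derivative[OF X_smooth that]]
    have "((\<lambda>z. \<pi> (X \<sigma> z)) has_derivative (\<lambda>w. \<pi> (frechet_derivative (X \<sigma>) (at y) w))) (at y)" .
    moreover have "((\<lambda>z. \<pi> (X \<sigma> z)) has_derivative (\<lambda>w. 0)) (at y)"
      by (rule has_derivative_transform_within_open[OF has_derivative_const T(1) that]) (simp add: X)
    ultimately show ?thesis by (rule has_derivative_unique[THEN fun_cong])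
  qed
  have \<omega>D: "\<omega> y (frechet_derivative (X \<sigma>) (at y) w) = - frechet_derivative (\<lambda>z. \<omega> z (X \<sigma> y)) (at y) w"
    if "y \<in> T" for \<sigma> y w
  proof -
    note frechet_derivative_linear_family[OF T(1) that linT \<omega>T smooth_on_has_derivative[OF X_smooth that]]
    moreover have "((\<lambda>z. \<omega> z (X \<sigma> z)) has_derivative (\<lambda>w. 0)) (at y)"
      by (rule has_derivative_transform_within_open[OF has_derivative_const T(1) that]) (simp add: X)
    ultimately have "frechet_derivative (\<lambda>z. \<omega> z (X \<sigma> y)) (at y) w + \<omega> y (frechet_derivative (X \<sigma>) (at y) w) = 0"
      by (rule has_derivative_unique[THEN fun_cong])
    then show ?thesis by (simp add: eq_neg_iff_add_eq_0 add.commute)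
  qed
  have comm: "frechet_derivative (X \<sigma>) (at y) (X \<tau> y) = frechet_derivative (X \<tau>) (at y) (X \<sigma> y)" if "y \<in> T" for y \<sigma> \<tau>
  proof -
    let ?d = "frechet_derivative (X \<sigma>) (at y) (X \<tau> y) - frechet_derivative (X \<tau>) (at y) (X \<sigma> y)"
    have "y \<in> V" using that T(3) by blast
    \<comment> \<open>Differentiating \<open>\<omega> z (X \<sigma> z) = 0\<close> moves the
      derivative onto the forms, where integrability applies. The bracket thus lies in the kernel;
      its projection is zero because \<open>\<pi>\<close> is constant on the fields, so it
      vanishes.\<close>
    have "\<omega> y ?d = 0"
      using integrable[OF \<open>y \<in> V\<close> X(1)[OF that, of \<tau>] X(1)[OF that, of \<sigma>]]
      by (simp add: linear_diff[OF linT[OF that]] \<omega>D[OF that])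
    moreover have "\<pi> ?d = 0" by (simp add: linear_diff[OF \<pi>] \<pi>D[OF that])
    ultimately have "?d = 0" using X_unique[OF that, of ?d] X_zero[OF that] by simp
    then show ?thesis by simp
  qed
  show thesis
  proof (rule commuting_flow[OF T(1,2) X_smooth X_lin comm])
    fix \<delta> U0 \<Phi>
    assume \<delta>: "\<delta> > 0" and U0: "open U0" "(z0, 0) \<in> U0" and \<Phi>: "smooth_on U0 \<Phi>"
      "\<And>p. p \<in> U0 \<Longrightarrow> \<Phi> p \<in> T" "\<And>q. (q, 0) \<in> U0 \<Longrightarrow> \<Phi> (q, 0) = q"
      and D\<Phi>: "\<And>p \<tau>. p \<in> U0 \<Longrightarrow> frechet_derivative \<Phi> (at p) (0, \<tau>) = \<delta> *\<^sub>R X \<tau> (\<Phi> p)"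
    \<comment> \<open>Places \<open>\<xi>\<close> on the transversal through \<open>z0\<close> and
      leaves the flow parameter unchanged.\<close>
    define j where "j p = (z0 + A (fst p, 0), snd p)" for p :: "'a \<times> 'b"
    define j' where "j' h = (A (fst h, 0), snd h)" for h :: "'a \<times> 'b"
    have bA: "bounded_linear A" using A(1) by (simp add: linear_conv_bounded_linear)
    have j'_lin: "bounded_linear j'" unfolding j'_def[abs_def]
      by (intro bounded_linear_Pair bounded_linear_compose[OF bA] bounded_linear_fst bounded_linear_zero bounded_linear_snd)
    have j_eq: "j p = (z0, 0) + j' p" for p by (simp add: j_def j'_def)
    have dj: "(j has_derivative j') (at p)" for p
      unfolding j_eq[abs_def] using has_derivative_add[OF has_derivative_const bounded_linear_imp_has_derivative[OF j'_lin]] by simp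
    have j_smooth: "smooth_on W j" if "open W" for W
      unfolding j_eq[abs_def] by (intro smooth_on_add smooth_on_const smooth_on_bounded_linear j'_lin that)
    define P where "P = j -` U0"
    have "continuous_on UNIV j" by (rule smooth_on_continuous_on[OF j_smooth[OF open_UNIV]])
    then have P: "open P" unfolding P_def using U0(1) by (simp add: open_vimage)
    have "0 \<in> P" using U0(2) linear_0[OF A(1)] by (simp add: P_def j_def zero_prod_def[symmetric])
    \<comment> \<open>A linear isomorphism that turns the straightening map into a map from
      \<open>'a \<times> 'b\<close> to itself, as the inverse function theorem requires. The factor
      \<open>1 / \<delta>\<close> undoes the time rescaling, so its derivative at 0 is the
      identity.\<close>
    define M where "M v = (\<omega> z0 v, (1 / \<delta>) *\<^sub>R \<pi> v)" for v
    define N where "N p = A (fst p, \<delta> *\<^sub>R snd p)" for p :: "'a \<times> 'b"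
    have MN: "M (N p) = p" for p
    proof -
      have "\<omega> z0 (N p) = fst p" "\<pi> (N p) = \<delta> *\<^sub>R snd p" using A(3)[of "(fst p, \<delta> *\<^sub>R snd p)"] by (simp_all add: N_def)
      then show ?thesis using \<delta> by (simp add: M_def)
    qed
    have NM: "N (M v) = v" for v using A(2)[of v] \<delta> by (simp add: N_def M_def)
    have M_inj: "M u = M v \<longleftrightarrow> u = v" for u v using NM by metis
    have M_lin: "linear M"
    proof
      show "M (u + v) = M u + M v" "M (r *\<^sub>R v) = r *\<^sub>R M v" for u v r
        by (simp_all add: M_def linear_add[OF lin[OF \<open>z0 \<in> V\<close>]] linear_add[OF \<pi>]
            linear_scale[OF lin[OF \<open>z0 \<in> V\<close>]] linear_scale[OF \<pi>] scaleR_add_right)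
    qed
    then have bM: "bounded_linear M" by (simp add: linear_conv_bounded_linear)
    define G where "G p = M (\<Phi> (j p))" for p
    have "smooth_on P (\<lambda>p. \<Phi> (j p))"
      by (rule smooth_on_compose[where g = j, OF P U0(1) _ j_smooth[OF P] \<Phi>(1)]) (simp add: P_def)
    then have G_smooth: "smooth_on P G" unfolding G_def[abs_def] by (rule smooth_on_linear_compose[OF bM P])
    have dG: "frechet_derivative G (at p) h = M (frechet_derivative \<Phi> (at (j p)) (j' h))" if "p \<in> P" for p h
    proof -
      have "j p \<in> U0" using that by (simp add: P_def)
      from bounded_linear.has_derivative[OF bM diff_chain_at[OF dj smooth_on_has_derivative[OF \<Phi>(1) this]]]
      have "(G has_derivative (\<lambda>h. M (frechet_derivative \<Phi> (at (j p)) (j' h)))) (at p)"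
        by (simp add: G_def[abs_def] o_def)
      then show ?thesis by (rule fun_cong[OF frechet_derivative_eqI])
    qed
    have dG2: "frechet_derivative G (at p) (0, \<tau>) = M (\<delta> *\<^sub>R X \<tau> (\<Phi> (j p)))" if "p \<in> P" for p \<tau>
    proof -
      have "j p \<in> U0" using that by (simp add: P_def)
      moreover have "j' (0, \<tau>) = (0, \<tau>)" using linear_0[OF A(1)] by (simp add: j'_def zero_prod_def)
      ultimately show ?thesis by (simp add: dG[OF that] D\<Phi>)
    qed
    have j0: "j 0 = (z0, 0)" using linear_0[OF A(1)] by (simp add: j_def zero_prod_def)
    have \<Phi>0: "\<Phi> (j 0) = z0" using \<Phi>(3)[OF U0(2)] by (simp add: j0)
    have inj: "inj (frechet_derivative G (at 0))"
    proof -
      have lG: "linear (frechet_derivative G (at 0))"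
        by (rule has_derivative_linear[OF smooth_on_has_derivative[OF G_smooth \<open>0 \<in> P\<close>]])
      have "((\<lambda>\<xi>. G (\<xi>, 0)) has_derivative (\<lambda>\<xi>. frechet_derivative G (at 0) (\<xi>, 0))) (at 0)"
      proof -
        have "((\<lambda>\<xi>::'a. (\<xi>, 0::'b)) has_derivative (\<lambda>\<xi>. (\<xi>, 0))) (at 0)"
          by (rule bounded_linear_imp_has_derivative[OF bounded_linear_Pair[OF bounded_linear_ident bounded_linear_zero]])
        moreover have "(G has_derivative frechet_derivative G (at 0)) (at (0, 0))"
          using smooth_on_has_derivative[OF G_smooth \<open>0 \<in> P\<close>] by (simp add: zero_prod_def)
        ultimately show ?thesis
          using diff_chain_at[where f = "\<lambda>\<xi>::'a. (\<xi>, 0::'b)" and g = G and x = 0] by (simp add: o_def)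
      qed
      moreover have "((\<lambda>\<xi>. G (\<xi>, 0)) has_derivative (\<lambda>\<xi>. M (A (\<xi>, 0)))) (at 0)"
      proof (rule has_derivative_transform_within_open)
        have "bounded_linear (\<lambda>\<xi>. M (A (\<xi>, 0)))"
          by (rule bounded_linear_compose[OF bM bounded_linear_compose[OF bA bounded_linear_Pair[OF bounded_linear_ident bounded_linear_zero]]])
        from has_derivative_add[OF has_derivative_const bounded_linear_imp_has_derivative[OF this]]
        show "((\<lambda>\<xi>. M z0 + M (A (\<xi>, 0))) has_derivative (\<lambda>\<xi>. M (A (\<xi>, 0)))) (at 0)" by simp
        show "open ((\<lambda>\<xi>. (\<xi>, 0)) -` P)" by (intro open_vimage P continuous_intros)
        show "0 \<in> (\<lambda>\<xi>. (\<xi>, 0)) -` P" using \<open>0 \<in> P\<close> by (simp add: zero_prod_def)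
        show "M z0 + M (A (\<xi>, 0)) = G (\<xi>, 0)" if "\<xi> \<in> (\<lambda>\<xi>. (\<xi>, 0)) -` P" for \<xi>
          using that \<Phi>(3)[of "z0 + A (\<xi>, 0)"] by (simp add: P_def j_def G_def linear_add[OF M_lin])
      qed
      ultimately have dG1: "frechet_derivative G (at 0) (\<xi>, 0) = M (A (\<xi>, 0))" for \<xi>
        by (rule has_derivative_unique[THEN fun_cong])
      have "X \<tau> z0 = A (0, \<tau>)" for \<tau>
        using X_eq[OF T(2), of \<tau>] by (simp add: L(2)[OF T(2)] c_def Al)
      then have "frechet_derivative G (at 0) (0, \<tau>) = M (\<delta> *\<^sub>R A (0, \<tau>))" for \<tau>
        using dG2[OF \<open>0 \<in> P\<close>, of \<tau>] by (simp add: \<Phi>0)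
      then have "frechet_derivative G (at 0) (\<xi>, \<tau>) = (\<xi>, \<tau>)" for \<xi> \<tau>
        using linear_add[OF lG, of "(\<xi>, 0)" "(0, \<tau>)"] MN[of "(\<xi>, \<tau>)"]
          linear_add[OF A(1), of "(\<xi>, 0)" "(0, \<delta> *\<^sub>R \<tau>)"] linear_scale[OF A(1), of \<delta> "(0, \<tau>)"]
        by (simp add: dG1 N_def linear_add[OF M_lin])
      then show ?thesis by (auto intro!: injI)
    qed
    show thesis
    proof (rule smooth_inverse_function[OF P \<open>0 \<in> P\<close> G_smooth inj])
      fix U' V' g
      assume U': "open U'" "0 \<in> U'" "U' \<subseteq> P" "open V'" and hom: "homeomorphism U' V' G g"
        and g: "smooth_on V' g" "\<And>y. y \<in> V' \<Longrightarrow> (g has_derivative inv (frechet_derivative G (at (g y)))) (at y)"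
          "\<And>y. y \<in> V' \<Longrightarrow> bij (frechet_derivative G (at (g y)))"
      define U where "U = M -` V' \<inter> T"
      define h where "h y = fst (g (M y))" for y
      have U: "open U" unfolding U_def
        by (intro open_Int open_vimage U'(4) T(1) linear_continuous_on[OF bM])
      have dh: "(h has_derivative (\<lambda>v. fst (inv (frechet_derivative G (at (g (M y)))) (M v)))) (at y)" if "y \<in> U" for y
      proof -
        have "M y \<in> V'" using that by (simp add: U_def)
        from bounded_linear.has_derivative[OF bounded_linear_fst diff_chain_at[OF bounded_linear_imp_has_derivative[OF bM] g(2)[OF this]]]
        show ?thesis by (simp add: h_def[abs_def] o_def)
      qed
      show thesis
      proof (rule that[OF U])
        have "G 0 \<in> V'" using homeomorphism_image1[OF hom] U'(2) by blast
        then show "z0 \<in> U" using T(2) by (simp add: U_def G_def \<Phi>0)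
        show "U \<subseteq> V" using T(3) by (auto simp: U_def)
        have "smooth_on U (\<lambda>y. g (M y))"
          by (rule smooth_on_compose[where g = M, OF U U'(4) _ smooth_on_bounded_linear[OF bM U] g(1)]) (simp add: U_def)
        then show "smooth_on U h" unfolding h_def[abs_def] by (rule smooth_on_linear_compose[OF bounded_linear_fst U])
        fix y v assume y: "y \<in> U"
        let ?p = "g (M y)" and ?D = "frechet_derivative G (at (g (M y)))"
        have "M y \<in> V'" "y \<in> T" using y by (auto simp: U_def)
        have p: "?p \<in> P" using homeomorphism_image2[OF hom] \<open>M y \<in> V'\<close> U'(3) by blast
        have "G ?p = M y" by (rule homeomorphism_apply2[OF hom \<open>M y \<in> V'\<close>])
        then have \<Phi>p: "\<Phi> (j ?p) = y" by (simp add: G_def M_inj)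
        have D: "?D (0, \<tau>) = M (\<delta> *\<^sub>R X \<tau> y)" for \<tau> using dG2[OF p] by (simp add: \<Phi>p)
        have inv1: "inv ?D (?D w) = w" and inv2: "?D (inv ?D w) = w" for w
          using g(3)[OF \<open>M y \<in> V'\<close>] by (simp_all add: bij_is_inj bij_is_surj surj_f_inv_f)
        \<comment> \<open>The derivative of the straightening map sends the flow directions
          \<open>(0, \<tau>)\<close> onto the image under \<open>M\<close> of the kernel at
          \<open>y\<close>, since the vectors \<open>X \<tau> y\<close> exhaust that kernel.\<close>
        have "fst (inv ?D (M v)) = 0 \<longleftrightarrow> \<omega> y v = 0"
        proof
          assume "fst (inv ?D (M v)) = 0"
          then obtain \<tau> where "inv ?D (M v) = (0, \<tau>)" by (metis prod.collapse)
          then have "M v = M (\<delta> *\<^sub>R X \<tau> y)" using inv2[of "M v"] D by simp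
          then show "\<omega> y v = 0"
            by (simp add: M_inj linear_scale[OF linT[OF \<open>y \<in> T\<close>]] X[OF \<open>y \<in> T\<close>])
        next
          assume "\<omega> y v = 0"
          then have "v = X (\<pi> v) y" by (rule X_unique[OF \<open>y \<in> T\<close>])
          also have "\<dots> = \<delta> *\<^sub>R X ((1 / \<delta>) *\<^sub>R \<pi> v) y"
            using \<delta> by (simp add: linear_scale[OF X_lin[OF \<open>y \<in> T\<close>]])
          finally have "M v = ?D (0, (1 / \<delta>) *\<^sub>R \<pi> v)" unfolding D by (rule arg_cong)
          then show "fst (inv ?D (M v)) = 0" by (simp add: inv1)
        qed
        then show "frechet_derivative h (at y) v = 0 \<longleftrightarrow> \<omega> y v = 0"
          by (simp add: frechet_derivative_eqI[OF dh[OF y]])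
      qed
    qed
  qed
qed

section \<open>Symmetry of second derivatives\<close>

text \<open>The second difference is the increment in direction \<open>u\<close> of the difference
  in direction \<open>w\<close>. The mean value inequality reduces it to first derivatives in
  direction \<open>u\<close>, which need to be differentiable at the single point \<open>y\<close>
  only.\<close>

lemma second_difference_bound:
  fixes f :: "'a::real_normed_vector \<Rightarrow> real"
  assumes "open S" "y \<in> S" and f: "\<And>x. x \<in> S \<Longrightarrow> (f has_derivative f' x) (at x)"
    and F: "((\<lambda>x. f' x u) has_derivative F) (at y)" and "\<epsilon> > 0"
  shows "\<exists>d>0. \<forall>h. 0 < h \<and> h < d \<longrightarrow>
    \<bar>f (y + h *\<^sub>R u + h *\<^sub>R w) - f (y + h *\<^sub>R u) - f (y + h *\<^sub>R w) + f y - h\<^sup>2 * F w\<bar>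
      \<le> \<epsilon> * (2 * norm u + norm w) * h\<^sup>2"
proof -
  obtain r where r: "r > 0" "ball y r \<subseteq> S" using assms(1,2) open_contains_ball by blast
  obtain s where s: "s > 0" "\<And>x. norm (x - y) < s \<Longrightarrow> \<bar>f' x u - f' y u - F (x - y)\<bar> \<le> \<epsilon> * norm (x - y)"
    using F \<open>\<epsilon> > 0\<close> unfolding has_derivative_at_alt real_norm_def by blast
  have linF: "linear F" by (rule has_derivative_linear[OF F])
  \<comment> \<open>All points that occur lie within \<open>h * C\<close> of \<open>y\<close>; the
    summand 1 keeps \<open>C\<close> positive when both vectors are zero.\<close>
  define C where "C = norm u + norm w + 1"
  have "C > 0" by (simp add: C_def add_nonneg_pos)
  show ?thesis
  proof (intro exI[of _ "min r s / C"] conjI allI impI)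
    show "min r s / C > 0" using r(1) s(1) \<open>C > 0\<close> by simp
    fix h assume h: "0 < h \<and> h < min r s / C"
    then have hC: "h * C < min r s" using \<open>C > 0\<close> by (simp add: pos_less_divide_eq)
    have small: "norm (t *\<^sub>R h *\<^sub>R u + b *\<^sub>R h *\<^sub>R w) < min r s" "norm (t *\<^sub>R h *\<^sub>R u + b *\<^sub>R h *\<^sub>R w) \<le> h * (norm u + b * norm w)"
      if "t \<in> {0..1}" "b \<in> {0, 1}" for t b :: real
    proof -
      have "norm (t *\<^sub>R h *\<^sub>R u) \<le> h * norm u" using that h by (auto intro!: mult_left_le_one_le)
      then show 1: "norm (t *\<^sub>R h *\<^sub>R u + b *\<^sub>R h *\<^sub>R w) \<le> h * (norm u + b * norm w)"
        using norm_triangle_ineq[of "t *\<^sub>R h *\<^sub>R u" "b *\<^sub>R h *\<^sub>R w"] that(2) h by (auto simp: algebra_simps)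
      have "h * (norm u + b * norm w) \<le> h * C" using that(2) h by (intro mult_left_mono) (auto simp: C_def)
      then show "norm (t *\<^sub>R h *\<^sub>R u + b *\<^sub>R h *\<^sub>R w) < min r s" using 1 hC by linarith
    qed
    let ?p = "\<lambda>b t. y + (t *\<^sub>R h *\<^sub>R u + b *\<^sub>R h *\<^sub>R w)"
    have pS: "?p b t \<in> S" if "t \<in> {0..1}" "b \<in> {0, 1}" for t b :: real
    proof -
      have "dist (?p b t) y < r" using small(1)[OF that] by (simp add: dist_norm)
      then have "?p b t \<in> ball y r" by (simp add: dist_commute)
      then show ?thesis using r(2) by blast
    qed
    \<comment> \<open>Subtracting the expected linear growth makes the increment of \<open>g\<close>
      over [0,1] exactly the error to be bounded.\<close>
    define g where "g t = f (?p 1 t) - f (?p 0 t) - t * (h\<^sup>2 * F w)" for t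
    have dg: "(g has_derivative (\<lambda>\<tau>. \<tau> * (h * (f' (?p 1 t) u - f' (?p 0 t) u) - h\<^sup>2 * F w))) (at t within {0..1})"
      if t: "t \<in> {0..1}" for t
    proof -
      have "((\<lambda>t. f (?p b t)) has_derivative (\<lambda>\<tau>. \<tau> * (h * f' (?p b t) u))) (at t within {0..1})" if b: "b \<in> {0, 1}" for b
      proof -
        have p: "(?p b has_derivative (\<lambda>\<tau>. \<tau> *\<^sub>R h *\<^sub>R u)) (at t within {0..1})" by (auto intro!: derivative_eq_intros)
        have "linear (f' (?p b t))" by (rule has_derivative_linear[OF f[OF pS[OF t b]]])
        then show ?thesis
          using diff_chain_within[OF p has_derivative_at_withinI[OF f[OF pS[OF t b]]]]
          by (simp add: o_def linear_scale mult.assoc)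
      qed
      from has_derivative_diff[OF has_derivative_diff[OF this[of 1] this[of 0]]
          has_derivative_mult_left[OF has_derivative_ident, of "h\<^sup>2 * F w"]]
      show ?thesis unfolding g_def[abs_def]
        by (rule has_derivative_eq_rhs) (simp_all add: algebra_simps)
    qed
    have "norm (g 1 - g 0) \<le> \<epsilon> * (2 * norm u + norm w) * h\<^sup>2 * norm (1 - 0 :: real)"
    proof (rule differentiable_bound[OF _ dg])
      fix t :: real assume t: "t \<in> {0..1}"
      let ?E = "\<lambda>b. f' (?p b t) u - f' y u - F (t *\<^sub>R h *\<^sub>R u + b *\<^sub>R h *\<^sub>R w)"
      have E: "\<bar>?E b\<bar> \<le> \<epsilon> * (h * (norm u + b * norm w))" if "b \<in> {0, 1}" for b
      proof -
        have "\<bar>?E b\<bar> \<le> \<epsilon> * norm (t *\<^sub>R h *\<^sub>R u + b *\<^sub>R h *\<^sub>R w)"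
          using s(2)[of "?p b t"] small(1)[OF t that] by simp
        also have "\<dots> \<le> \<epsilon> * (h * (norm u + b * norm w))"
          using small(2)[OF t that] \<open>\<epsilon> > 0\<close> by (intro mult_left_mono) auto
        finally show ?thesis .
      qed
      \<comment> \<open>The common contribution of \<open>t *\<^sub>R h *\<^sub>R u\<close> cancels.
        The two errors, of size \<open>norm u + norm w\<close> and \<open>norm u\<close>, account
        for \<open>2 * norm u + norm w\<close>.\<close>
      have "f' (?p 1 t) u - f' (?p 0 t) u - h * F w = ?E 1 - ?E 0"
        by (simp add: linear_add[OF linF] linear_scale[OF linF])
      then have "\<bar>f' (?p 1 t) u - f' (?p 0 t) u - h * F w\<bar> \<le> \<bar>?E 1\<bar> + \<bar>?E 0\<bar>"
        by (metis abs_triangle_ineq4)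
      also have "\<dots> \<le> \<epsilon> * (h * (norm u + 1 * norm w)) + \<epsilon> * (h * (norm u + 0 * norm w))"
        by (intro add_mono E) auto
      also have "\<dots> = h * (\<epsilon> * (2 * norm u + norm w))" by (simp add: algebra_simps)
      finally have "h * \<bar>f' (?p 1 t) u - f' (?p 0 t) u - h * F w\<bar> \<le> h * (h * (\<epsilon> * (2 * norm u + norm w)))"
        using h by (intro mult_left_mono) auto
      note le = this
      have factor: "\<bar>h * a - h\<^sup>2 * c\<bar> = h * \<bar>a - h * c\<bar>" for a c
      proof -
        have "h * a - h\<^sup>2 * c = h * (a - h * c)" by (simp add: power2_eq_square algebra_simps)
        then show ?thesis using h by (simp add: abs_mult)
      qed
      have b: "\<bar>h * (f' (?p 1 t) u - f' (?p 0 t) u) - h\<^sup>2 * F w\<bar> \<le> \<epsilon> * (2 * norm u + norm w) * h\<^sup>2"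
        unfolding factor by (rule order_trans[OF le]) (simp add: power2_eq_square mult_ac)
      show "onorm (\<lambda>\<tau>. \<tau> * (h * (f' (?p 1 t) u - f' (?p 0 t) u) - h\<^sup>2 * F w)) \<le> \<epsilon> * (2 * norm u + norm w) * h\<^sup>2"
      proof (rule onorm_bound)
        fix \<tau> :: real
        show "norm (\<tau> * (h * (f' (?p 1 t) u - f' (?p 0 t) u) - h\<^sup>2 * F w)) \<le> \<epsilon> * (2 * norm u + norm w) * h\<^sup>2 * norm \<tau>"
          using mult_right_mono[OF b, of "\<bar>\<tau>\<bar>"] by (subst mult.commute) (simp only: real_norm_def abs_mult abs_ge_zero)
      qed (use \<open>\<epsilon> > 0\<close> in simp)
    qed auto
    moreover have "f (y + h *\<^sub>R u + h *\<^sub>R w) - f (y + h *\<^sub>R u) - f (y + h *\<^sub>R w) + f y - h\<^sup>2 * F w = g 1 - g 0"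
      by (simp add: g_def add.assoc)
    ultimately show "\<bar>f (y + h *\<^sub>R u + h *\<^sub>R w) - f (y + h *\<^sub>R u) - f (y + h *\<^sub>R w) + f y - h\<^sup>2 * F w\<bar>
        \<le> \<epsilon> * (2 * norm u + norm w) * h\<^sup>2"
      by simp
  qed
qed

text \<open>The second difference is symmetric in the two directions, and after division by
  \<open>h\<^sup>2\<close> it is close to both iterated derivatives.\<close>

lemma frechet_derivative_commute:
  fixes f :: "'a::real_normed_vector \<Rightarrow> real"
  assumes "open S" "y \<in> S" and f: "smooth_on S f"
  shows "frechet_derivative (\<lambda>x. frechet_derivative f (at x) u) (at y) w =
    frechet_derivative (\<lambda>x. frechet_derivative f (at x) w) (at y) u"
proof -
  let ?F = "\<lambda>u. frechet_derivative (\<lambda>x. frechet_derivative f (at x) u) (at y)"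
  note df = smooth_on_has_derivative[OF f]
  have dF: "((\<lambda>x. frechet_derivative f (at x) u) has_derivative ?F u) (at y)" for u
    by (rule smooth_on_has_derivative[OF smooth_on_frechet_derivative[OF f] \<open>y \<in> S\<close>])
  have "\<bar>?F u w - ?F w u\<bar> \<le> 0 + e" if "e > 0" for e
  proof -
    \<comment> \<open>The error constants for the two orders of the directions add up to three times
      the sum of the norms.\<close>
    define C where "C = 3 * (norm u + norm w) + 1"
    have "C > 0" by (simp add: C_def add_nonneg_pos)
    define \<epsilon> where "\<epsilon> = e / C"
    have "\<epsilon> > 0" using that \<open>C > 0\<close> by (simp add: \<epsilon>_def)
    let ?s = "\<lambda>h. f (y + h *\<^sub>R u + h *\<^sub>R w) - f (y + h *\<^sub>R u) - f (y + h *\<^sub>R w) + f y"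
    obtain d1 where d1: "d1 > 0" "\<And>h. 0 < h \<Longrightarrow> h < d1 \<Longrightarrow> \<bar>?s h - h\<^sup>2 * ?F u w\<bar> \<le> \<epsilon> * (2 * norm u + norm w) * h\<^sup>2"
      using second_difference_bound[OF assms(1,2) df dF \<open>\<epsilon> > 0\<close>, of u w] by blast
    obtain d2 where d2: "d2 > 0" "\<And>h. 0 < h \<Longrightarrow> h < d2 \<Longrightarrow>
        \<bar>f (y + h *\<^sub>R w + h *\<^sub>R u) - f (y + h *\<^sub>R w) - f (y + h *\<^sub>R u) + f y - h\<^sup>2 * ?F w u\<bar> \<le> \<epsilon> * (2 * norm w + norm u) * h\<^sup>2"
      using second_difference_bound[OF assms(1,2) df dF \<open>\<epsilon> > 0\<close>, of w u] by blast
    define h where "h = min d1 d2 / 2"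
    have h: "0 < h" "h < d1" "h < d2" using d1(1) d2(1) by (auto simp: h_def)
    have eq: "f (y + h *\<^sub>R w + h *\<^sub>R u) - f (y + h *\<^sub>R w) - f (y + h *\<^sub>R u) + f y = ?s h" by (simp add: add_ac)
    have "\<bar>h\<^sup>2 * ?F u w - h\<^sup>2 * ?F w u\<bar> \<le> \<epsilon> * (2 * norm u + norm w) * h\<^sup>2 + \<epsilon> * (2 * norm w + norm u) * h\<^sup>2"
      using d1(2)[OF h(1,2)] d2(2)[OF h(1,3)] unfolding eq by linarith
    also have "\<dots> = \<epsilon> * (3 * (norm u + norm w)) * h\<^sup>2" by (simp add: algebra_simps)
    also have "\<dots> \<le> \<epsilon> * C * h\<^sup>2" using \<open>\<epsilon> > 0\<close> by (intro mult_right_mono mult_left_mono) (auto simp: C_def)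
    also have "\<epsilon> * C = e" using \<open>C > 0\<close> by (simp add: \<epsilon>_def)
    finally have "\<bar>h\<^sup>2 * (?F u w - ?F w u)\<bar> \<le> e * h\<^sup>2" by (simp add: right_diff_distrib)
    then have "h\<^sup>2 * \<bar>?F u w - ?F w u\<bar> \<le> h\<^sup>2 * e" by (simp add: abs_mult mult.commute)
    then show ?thesis using h(1) by simp
  qed
  then have "\<bar>?F u w - ?F w u\<bar> \<le> 0" by (rule field_le_epsilon)
  then show ?thesis by simp
qed

section \<open>Wedge products in low degree\<close>

lemma lessThan_2_nat: "{..<2::nat} = {0, 1}" and lessThan_4_nat: "{..<4::nat} = {0, 1, 2, 3}"
  by auto

lemma sum_permutes_2:
  fixes Q :: "nat \<Rightarrow> nat \<Rightarrow> real"
  shows "(\<Sum>\<sigma> | \<sigma> permutes {..<2}. of_int (sign \<sigma>) * Q (\<sigma> 0) (\<sigma> 1)) = Q 0 1 - Q 1 0"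
proof -
  have f: "finite {1::nat}" "0 \<notin> {1::nat}" by auto
  show ?thesis unfolding lessThan_2_nat sum_over_permutations_insert[OF f] permutes_sing
    by (simp add: sign_swap_id sign_id swap_id_eq)
qed

text \<open>The 24 permutations fall into six shuffles with four members each, related by swaps
  inside the two pairs. The factor 4 cancels the two factorials in the normalisation of
  \<open>wedge\<close>.\<close>

lemma sum_permutes_4:
  fixes P Q :: "nat \<Rightarrow> nat \<Rightarrow> real"
  assumes P: "\<And>i j. P i j = - P j i" and Q: "\<And>i j. Q i j = - Q j i"
  shows "(\<Sum>\<sigma> | \<sigma> permutes {..<4}. of_int (sign \<sigma>) * (P (\<sigma> 0) (\<sigma> 1) * Q (\<sigma> 2) (\<sigma> 3))) =
    4 * (P 0 1 * Q 2 3 - P 0 2 * Q 1 3 + P 0 3 * Q 1 2 + P 1 2 * Q 0 3 - P 1 3 * Q 0 2 + P 2 3 * Q 0 1)"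
proof -
  have f1: "finite {1::nat,2,3}" "0 \<notin> {1::nat,2,3}" and f2: "finite {2::nat,3}" "1 \<notin> {2::nat,3}"
    and f3: "finite {3::nat}" "2 \<notin> {3::nat}" by auto
  have r: "P 1 0 = - P 0 1" "P 2 0 = - P 0 2" "P 3 0 = - P 0 3" "P 2 1 = - P 1 2" "P 3 1 = - P 1 3" "P 3 2 = - P 2 3"
    "Q 1 0 = - Q 0 1" "Q 2 0 = - Q 0 2" "Q 3 0 = - Q 0 3" "Q 2 1 = - Q 1 2" "Q 3 1 = - Q 1 3" "Q 3 2 = - Q 2 3"
    by (rule P Q)+
  show ?thesis
    unfolding lessThan_4_nat sum_over_permutations_insert[OF f1] sum_over_permutations_insert[OF f2]
      sum_over_permutations_insert[OF f3] permutes_sing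
    by (simp add: sign_swap_id permutation_swap_id permutation_compose sign_compose sign_id swap_id_eq r del: One_nat_def)
qed

lemma k_linear_1_const:
  assumes "k_linear 1 f" shows "f v = f (\<lambda>_. v 0)"
proof -
  have "\<forall>v w. (\<forall>i<1. v i = w i) \<longrightarrow> f v = f w" using assms unfolding k_linear_def by (rule conjunct1)
  from this[THEN spec, THEN spec, of v "\<lambda>_. v 0"] show ?thesis by simp
qed

lemma k_linear_1_linear:
  assumes "k_linear 1 f" shows "linear (\<lambda>u. f (\<lambda>_. u))"
proof -
  have "\<forall>v. \<forall>i<1. linear (\<lambda>u. f (v(i := u)))" using assms unfolding k_linear_def by (rule conjunct2)
  from this[THEN spec, of "\<lambda>_. 0"] have "linear (\<lambda>u. f ((\<lambda>_. 0)(0 := u)))" by simp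
  moreover have "f ((\<lambda>_. 0)(0 := u)) = f (\<lambda>_. u)" for u
    using k_linear_1_const[OF assms, of "(\<lambda>_. 0)(0 := u)"] unfolding fun_upd_same .
  ultimately show ?thesis by simp
qed

lemma wedge_one_forms:
  assumes \<alpha>: "k_linear 1 (\<alpha> c y)" and \<beta>: "k_linear 1 (\<beta> c y)"
  shows "wedge 1 1 \<alpha> \<beta> c y v = \<alpha> c y (\<lambda>_. v 0) * \<beta> c y (\<lambda>_. v 1) - \<alpha> c y (\<lambda>_. v 1) * \<beta> c y (\<lambda>_. v 0)"
proof -
  have p: "tensor_prod 1 \<alpha> \<beta> c y (\<lambda>i. v (\<sigma> i)) = \<alpha> c y (\<lambda>_. v (\<sigma> 0)) * \<beta> c y (\<lambda>_. v (\<sigma> 1))" for \<sigma> :: "nat \<Rightarrow> nat"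
    unfolding tensor_prod_def k_linear_1_const[OF \<alpha>, of "\<lambda>i. v (\<sigma> i)"]
      k_linear_1_const[OF \<beta>, of "\<lambda>i. v (\<sigma> (1 + i))"] add_0_right ..
  show ?thesis
    using sum_permutes_2[of "\<lambda>i j. \<alpha> c y (\<lambda>_. v i) * \<beta> c y (\<lambda>_. v j)"]
    by (simp add: wedge_def p one_add_one del: One_nat_def)
qed

lemma wedge_two_forms:
  assumes \<Lambda>: "\<And>v. \<Lambda> c y v = l (v 0) (v 1)" and \<Omega>: "\<And>v. \<Omega> c y v = m (v 0) (v 1)"
    and l: "\<And>u w. l u w = - l w u" and m: "\<And>u w. m u w = - m w u"
  shows "wedge 2 2 \<Lambda> \<Omega> c y v =
    l (v 0) (v 1) * m (v 2) (v 3) - l (v 0) (v 2) * m (v 1) (v 3) + l (v 0) (v 3) * m (v 1) (v 2)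
    + l (v 1) (v 2) * m (v 0) (v 3) - l (v 1) (v 3) * m (v 0) (v 2) + l (v 2) (v 3) * m (v 0) (v 1)"
proof -
  have p: "tensor_prod 2 \<Lambda> \<Omega> c y (\<lambda>i. v (\<sigma> i)) = l (v (\<sigma> 0)) (v (\<sigma> 1)) * m (v (\<sigma> 2)) (v (\<sigma> 3))" for \<sigma> :: "nat \<Rightarrow> nat"
  proof -
    have "(2::nat) + 0 = 2" "(2::nat) + 1 = 3" by simp_all
    then show ?thesis by (simp only: tensor_prod_def \<Lambda> \<Omega>)
  qed
  have "{..<2 + 2::nat} = {..<4}" by simp
  then show ?thesis
    using sum_permutes_4[of "\<lambda>i j. l (v i) (v j)" "\<lambda>i j. m (v i) (v j)", OF l m]
    by (simp add: wedge_def p del: One_nat_def)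
qed

text \<open>The argument sequences in \<open>ext_deriv\<close> differ from constant ones only in
  entries that a one-form ignores. That is known on \<open>N\<close> only, so the derivatives are
  compared locally.\<close>

lemma ext_deriv_one_form:
  assumes "open N" "y \<in> N" and lin: "\<forall>z\<in>N. k_linear 1 (\<epsilon> c z)"
    and diff: "\<forall>v. (\<lambda>z. \<epsilon> c z v) differentiable (at y)"
  shows "ext_deriv 1 \<epsilon> c y v =
    frechet_derivative (\<lambda>z. \<epsilon> c z (\<lambda>_. v 1)) (at y) (v 0) - frechet_derivative (\<lambda>z. \<epsilon> c z (\<lambda>_. v 0)) (at y) (v 1)"
proof -
  have fd: "frechet_derivative (\<lambda>z. \<epsilon> c z w) (at y) = frechet_derivative (\<lambda>z. \<epsilon> c z (\<lambda>_. w 0)) (at y)" for w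
  proof (rule frechet_derivative_transform_within_open[OF _ assms(1,2)])
    show "\<epsilon> c z w = \<epsilon> c z (\<lambda>_. w 0)" if "z \<in> N" for z
      by (rule k_linear_1_const[where f = "\<epsilon> c z"]) (use lin that in blast)
  qed (use diff in blast)
  have "{..1::nat} = {0, 1}" by auto
  then show ?thesis
    using fd[of "\<lambda>j. v (Suc j)"] fd[of "\<lambda>j. if j < 1 then v j else v (Suc j)"]
    by (simp add: ext_deriv_def)
qed

lemma wedge_wedge_ext_deriv:
  assumes "open N" "y \<in> N" and \<alpha>: "k_linear 1 (\<alpha> c y)" and \<beta>: "k_linear 1 (\<beta> c y)"
    and lin: "\<forall>z\<in>N. k_linear 1 (\<epsilon> c z)" and diff: "\<forall>v. (\<lambda>z. \<epsilon> c z v) differentiable (at y)"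
  defines "l \<equiv> \<lambda>u w. \<alpha> c y (\<lambda>_. u) * \<beta> c y (\<lambda>_. w) - \<alpha> c y (\<lambda>_. w) * \<beta> c y (\<lambda>_. u)"
    and "m \<equiv> \<lambda>u w. frechet_derivative (\<lambda>z. \<epsilon> c z (\<lambda>_. w)) (at y) u - frechet_derivative (\<lambda>z. \<epsilon> c z (\<lambda>_. u)) (at y) w"
  shows "wedge 2 2 (wedge 1 1 \<alpha> \<beta>) (ext_deriv 1 \<epsilon>) c y v =
    l (v 0) (v 1) * m (v 2) (v 3) - l (v 0) (v 2) * m (v 1) (v 3) + l (v 0) (v 3) * m (v 1) (v 2)
    + l (v 1) (v 2) * m (v 0) (v 3) - l (v 1) (v 3) * m (v 0) (v 2) + l (v 2) (v 3) * m (v 0) (v 1)"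
proof (rule wedge_two_forms)
  show "wedge 1 1 \<alpha> \<beta> c y v = l (v 0) (v 1)" for v
    unfolding l_def by (rule wedge_one_forms[where \<alpha> = \<alpha> and \<beta> = \<beta>, OF \<alpha> \<beta>])
  show "ext_deriv 1 \<epsilon> c y v = m (v 0) (v 1)" for v
    unfolding m_def by (rule ext_deriv_one_form[where \<epsilon> = \<epsilon>, OF assms(1,2) lin diff])
qed (auto simp: l_def m_def)

text \<open>The four-form is evaluated on \<open>a, b, u, w\<close>. As \<open>u\<close> and
  \<open>w\<close> are killed by both one-forms, only the shuffle with \<open>a, b\<close> in the
  first factor survives, and by duality its value is the exterior derivative on
  \<open>u, w\<close>.\<close>

lemma wedge_eq_0_imp:
  assumes "open N" "y \<in> N" and \<alpha>: "k_linear 1 (\<alpha> c y)" and \<beta>: "k_linear 1 (\<beta> c y)"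
    and lin: "\<forall>z\<in>N. k_linear 1 (\<epsilon> c z)" and diff: "\<forall>v. (\<lambda>z. \<epsilon> c z v) differentiable (at y)"
    and zero: "\<And>v. wedge 2 2 (wedge 1 1 \<alpha> \<beta>) (ext_deriv 1 \<epsilon>) c y v = 0"
    and dual: "\<alpha> c y (\<lambda>_. a) = 1" "\<beta> c y (\<lambda>_. a) = 0" "\<alpha> c y (\<lambda>_. b) = 0" "\<beta> c y (\<lambda>_. b) = 1"
    and ker: "\<alpha> c y (\<lambda>_. u) = 0" "\<beta> c y (\<lambda>_. u) = 0" "\<alpha> c y (\<lambda>_. w) = 0" "\<beta> c y (\<lambda>_. w) = 0"
  shows "frechet_derivative (\<lambda>z. \<epsilon> c z (\<lambda>_. w)) (at y) u = frechet_derivative (\<lambda>z. \<epsilon> c z (\<lambda>_. u)) (at y) w"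
  using wedge_wedge_ext_deriv[where \<alpha> = \<alpha> and \<beta> = \<beta> and \<epsilon> = \<epsilon>, OF assms(1-6),
      of "\<lambda>i. if i = 0 then a else if i = 1 then b else if i = 2 then u else w"]
  unfolding zero by (simp add: dual ker)

text \<open>The product of \<open>\<alpha>\<close> and \<open>\<beta>\<close> is a multiple of
  \<open>P \<and> Q\<close>, and the exterior derivative has the form
  \<open>\<theta> \<and> P + \<kappa> \<and> Q\<close>; every term of the product repeats
  \<open>P\<close> or \<open>Q\<close>.\<close>

lemma wedge_eq_0I:
  assumes "open N" "y \<in> N" and \<alpha>: "k_linear 1 (\<alpha> c y)" and \<beta>: "k_linear 1 (\<beta> c y)"
    and lin: "\<forall>z\<in>N. k_linear 1 (\<epsilon> c z)" and diff: "\<forall>v. (\<lambda>z. \<epsilon> c z v) differentiable (at y)"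
    and \<alpha>_eq: "\<And>u. \<alpha> c y (\<lambda>_. u) = a1 * P u + a2 * Q u" and \<beta>_eq: "\<And>u. \<beta> c y (\<lambda>_. u) = b1 * P u + b2 * Q u"
    and d\<epsilon>: "\<And>u w. frechet_derivative (\<lambda>z. \<epsilon> c z (\<lambda>_. w)) (at y) u - frechet_derivative (\<lambda>z. \<epsilon> c z (\<lambda>_. u)) (at y) w
      = \<theta> u * P w - \<theta> w * P u + \<kappa> u * Q w - \<kappa> w * Q u"
  shows "wedge 2 2 (wedge 1 1 \<alpha> \<beta>) (ext_deriv 1 \<epsilon>) c y v = 0"
proof -
  have l: "\<alpha> c y (\<lambda>_. u) * \<beta> c y (\<lambda>_. w) - \<alpha> c y (\<lambda>_. w) * \<beta> c y (\<lambda>_. u) = (a1 * b2 - a2 * b1) * (P u * Q w - P w * Q u)" for u w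
    by (simp add: \<alpha>_eq \<beta>_eq algebra_simps)
  show ?thesis
    unfolding wedge_wedge_ext_deriv[where \<alpha> = \<alpha> and \<beta> = \<beta> and \<epsilon> = \<epsilon>, OF assms(1-6)] l d\<epsilon>
    by algebra
qed

section \<open>Charts\<close>

lemma chart_topspace: "is_chart X c \<Longrightarrow> topspace (subtopology X (fst c)) = fst c"
  unfolding is_chart_def by (auto dest: openin_subset)

lemma chart_inj_on: "is_chart X c \<Longrightarrow> inj_on (snd c) (fst c)"
  using homeomorphic_imp_injective_map[of "subtopology X (fst c)" _ "snd c"] chart_topspace[of X c]
  by (metis is_chart_def)

lemma chart_open_image:
  assumes "is_chart X c" "openin X N" shows "open (snd c ` (fst c \<inter> N))"
proof -
  have "openin (subtopology X (fst c)) (fst c \<inter> N)"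
    using assms(2) by (metis Int_commute openin_subtopology)
  then have "openin (top_of_set (snd c ` fst c)) (snd c ` (fst c \<inter> N))"
    using assms(1) homeomorphic_imp_open_map unfolding is_chart_def open_map_def by blast
  then show ?thesis using assms(1) openin_open_trans unfolding is_chart_def by blast
qed

lemma chart_preimage_open:
  assumes "is_chart X c" "open N" shows "openin X {p \<in> fst c. snd c p \<in> N}"
proof -
  have "continuous_map (subtopology X (fst c)) (top_of_set (snd c ` fst c)) (snd c)"
    using assms(1) homeomorphic_imp_continuous_map unfolding is_chart_def by blast
  moreover have "openin (top_of_set (snd c ` fst c)) (snd c ` fst c \<inter> N)" using assms(2) by blast
  ultimately have "openin (subtopology X (fst c)) {p \<in> topspace (subtopology X (fst c)). snd c p \<in> snd c ` fst c \<inter> N}"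
    by (rule openin_continuous_map_preimage)
  moreover have "{p \<in> topspace (subtopology X (fst c)). snd c p \<in> snd c ` fst c \<inter> N} = {p \<in> fst c. snd c p \<in> N}"
    unfolding chart_topspace[OF assms(1)] by auto
  ultimately show ?thesis using assms(1) openin_trans_full unfolding is_chart_def by metis
qed

lemma transition_apply: "is_chart X c \<Longrightarrow> p \<in> fst c \<Longrightarrow> transition c d (snd c p) = snd d p"
  unfolding transition_def by (simp add: inv_into_f_f chart_inj_on)

lemma transition_transition:
  assumes "is_chart X c" "is_chart X a" "y \<in> snd c ` (fst c \<inter> fst a)"
  shows "transition a d (transition c a y) = transition c d y"
  using assms(3) by (auto simp: transition_apply[OF assms(1)] transition_apply[OF assms(2)])

lemma local_coords_chart: "c \<in> local_coords X A \<Longrightarrow> is_chart X c"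
  by (simp add: local_coords_def)

lemma local_coords_open: "c \<in> local_coords X A \<Longrightarrow> openin X (fst c)"
  by (simp add: local_coords_def is_chart_def)

lemma atlas_subset_local_coords: "smooth_manifold X A \<Longrightarrow> A \<subseteq> local_coords X A"
  by (auto simp: smooth_manifold_def local_coords_def)

lemma local_coords_atlas_smooth:
  assumes "c \<in> local_coords X A" "a \<in> A"
  shows "smooth_on (snd c ` (fst c \<inter> fst a)) (transition c a)" "smooth_on (snd a ` (fst c \<inter> fst a)) (transition a c)"
  using assms by (auto simp: local_coords_def compatible_def)

text \<open>Charts of the maximal atlas are required to be compatible only with members of
  \<open>A\<close>; near each point the transition factors through such a member.\<close>

lemma transition_smooth:
  assumes "smooth_manifold X A" and c: "c \<in> local_coords X A" and d: "d \<in> local_coords X A"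
  shows "smooth_on (snd c ` (fst c \<inter> fst d)) (transition c d)"
proof (rule smooth_on_local)
  fix y assume "y \<in> snd c ` (fst c \<inter> fst d)"
  then obtain p where p: "p \<in> fst c" "p \<in> fst d" "y = snd c p" by auto
  have "p \<in> topspace X" using p(1) openin_subset[OF local_coords_open[OF c]] by blast
  moreover have "(\<Union>c\<in>A. fst c) = topspace X" using assms(1) by (simp add: smooth_manifold_def)
  ultimately obtain a where a: "a \<in> A" "p \<in> fst a" by blast
  have a': "a \<in> local_coords X A" using atlas_subset_local_coords[OF assms(1)] a(1) by blast
  note ch = local_coords_chart[OF c] local_coords_chart[OF d] local_coords_chart[OF a']
  note op = local_coords_open[OF c] local_coords_open[OF d] local_coords_open[OF a']
  let ?N = "snd c ` (fst c \<inter> (fst d \<inter> fst a))"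
  have N: "open ?N" by (rule chart_open_image[OF ch(1) openin_Int[OF op(2,3)]])
  have "smooth_on ?N (\<lambda>y. transition a d (transition c a y))"
  proof (rule smooth_on_compose[where g = "transition c a", OF N chart_open_image[OF ch(3) op(2)]])
    show "transition c a y \<in> snd a ` (fst a \<inter> fst d)" if "y \<in> ?N" for y
      using that by (auto simp: transition_apply[OF ch(1)])
    show "smooth_on ?N (transition c a)"
      by (rule smooth_on_subset[OF local_coords_atlas_smooth(1)[OF c a(1)]]) auto
    show "smooth_on (snd a ` (fst a \<inter> fst d)) (transition a d)"
      using local_coords_atlas_smooth(2)[OF d a(1)] by (simp add: Int_commute)
  qed
  then have "smooth_on ?N (transition c d)"
    by (rule smooth_on_cong[OF N, rotated]) (auto intro!: transition_transition[OF ch(1,3)])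
  then show "\<exists>T. open T \<and> y \<in> T \<and> smooth_on T (transition c d)" using N p a(2) by blast
qed

lemma transition_frechet_derivative:
  assumes "smooth_manifold X A" and c: "c \<in> local_coords X A" and d: "d \<in> local_coords X A" and a: "a \<in> local_coords X A"
    and y: "y \<in> snd c ` (fst c \<inter> (fst a \<inter> fst d))"
  shows "frechet_derivative (transition c d) (at y) v =
    frechet_derivative (transition a d) (at (transition c a y)) (frechet_derivative (transition c a) (at y) v)"
proof -
  note ch = local_coords_chart[OF c] local_coords_chart[OF a]
  let ?N = "snd c ` (fst c \<inter> (fst a \<inter> fst d))"
  have N: "open ?N" by (rule chart_open_image[OF ch(1) openin_Int[OF local_coords_open[OF a] local_coords_open[OF d]]])
  have y': "y \<in> snd c ` (fst c \<inter> fst a)" "transition c a y \<in> snd a ` (fst a \<inter> fst d)"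
    using y by (auto simp: transition_apply[OF ch(1)])
  have "((\<lambda>y. transition a d (transition c a y)) has_derivative
      (\<lambda>v. frechet_derivative (transition a d) (at (transition c a y)) (frechet_derivative (transition c a) (at y) v))) (at y)"
    using diff_chain_at[OF smooth_on_has_derivative[OF transition_smooth[OF assms(1) c a] y'(1)]
        smooth_on_has_derivative[OF transition_smooth[OF assms(1) a d] y'(2)]] by (simp add: o_def)
  then have "(transition c d has_derivative
      (\<lambda>v. frechet_derivative (transition a d) (at (transition c a y)) (frechet_derivative (transition c a) (at y) v))) (at y)"
    by (rule has_derivative_transform_within_open[OF _ N y]) (auto intro!: transition_transition[OF ch])
  then show ?thesis by (rule fun_cong[OF frechet_derivative_eqI])
qed

section \<open>Bilinear forms in components, orthonormalisation, pullback of one-forms\<close>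

lemma
  assumes "k_linear 2 f"
  shows k_linear_2_const: "f v = f (\<lambda>i. if i = 0 then v 0 else v 1)"
    and k_linear_2_linear1: "linear (\<lambda>u. f (\<lambda>i. if i = 0 then u else w))"
    and k_linear_2_linear2: "linear (\<lambda>u. f (\<lambda>i. if i = 0 then w else u))"
proof -
  have 1: "\<forall>v w. (\<forall>i<2. v i = w i) \<longrightarrow> f v = f w" using assms unfolding k_linear_def by (rule conjunct1)
  have c: "f v = f w" if "v 0 = w 0" "v 1 = w 1" for v w
  proof (rule 1[THEN spec, THEN spec, THEN mp])
    show "\<forall>i<2. v i = w i" using that by (auto simp: less_2_cases_iff)
  qed
  show "f v = f (\<lambda>i. if i = 0 then v 0 else v 1)" by (rule c) simp_all
  have 2: "\<forall>v. \<forall>i<2. linear (\<lambda>u. f (v(i := u)))" using assms unfolding k_linear_def by (rule conjunct2)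
  from 2[THEN spec, of "\<lambda>_. w"] have "linear (\<lambda>u. f ((\<lambda>_. w)(0 := u)))" "linear (\<lambda>u. f ((\<lambda>_. w)(1 := u)))" by simp_all
  moreover have "f ((\<lambda>_. w)(0 := u)) = f (\<lambda>i. if i = 0 then u else w)" "f ((\<lambda>_. w)(1 := u)) = f (\<lambda>i. if i = 0 then w else u)" for u
    by (rule c; simp)+
  ultimately show "linear (\<lambda>u. f (\<lambda>i. if i = 0 then u else w))" "linear (\<lambda>u. f (\<lambda>i. if i = 0 then w else u))" by simp_all
qed

lemma linear_axis_expand:
  fixes f :: "real ^ 'n::finite \<Rightarrow> real"
  assumes "linear f" shows "f u = (\<Sum>\<alpha>\<in>UNIV. u $ \<alpha> * f (axis \<alpha> 1))"
proof -
  have u: "u = (\<Sum>\<alpha>\<in>UNIV. (u $ \<alpha>) *\<^sub>R axis \<alpha> 1)"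
    using basis_expansion[of u] by (simp add: scalar_mult_eq_scaleR)
  have "f u = f (\<Sum>\<alpha>\<in>UNIV. (u $ \<alpha>) *\<^sub>R axis \<alpha> 1)" using u by (rule arg_cong)
  also have "\<dots> = (\<Sum>\<alpha>\<in>UNIV. u $ \<alpha> * f (axis \<alpha> 1))" by (simp add: linear_sum[OF assms] linear_scale[OF assms])
  finally show ?thesis .
qed

lemma smooth_on_if:
  "(b \<Longrightarrow> smooth_on S f) \<Longrightarrow> (\<not> b \<Longrightarrow> smooth_on S h) \<Longrightarrow> smooth_on S (\<lambda>z. if b then f z else h z)"
  by (cases b) simp_all

lemma smooth_on_sqrt:
  fixes f :: "'a::real_normed_vector \<Rightarrow> real"
  assumes "open S" "smooth_on S f" "\<And>x. x \<in> S \<Longrightarrow> f x > 0"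
  shows "smooth_on S (\<lambda>x. sqrt (f x))"
  by (rule smooth_on_cong[OF assms(1) _ smooth_on_powr[OF assms, of "1/2"]]) (simp_all add: powr_half_sqrt assms(3) less_imp_le)

lemma smooth_on_divide:
  fixes f h :: "'a::real_normed_vector \<Rightarrow> real"
  assumes "open S" "smooth_on S f" "smooth_on S h" "\<And>x. x \<in> S \<Longrightarrow> h x > 0"
  shows "smooth_on S (\<lambda>x. f x / h x)"
proof -
  have "smooth_on S (\<lambda>x. f x * h x powr (- 1))"
    by (rule smooth_on_mult[OF assms(1,2) smooth_on_powr[OF assms(1,3,4)]])
  then show ?thesis
  proof (rule smooth_on_cong[OF assms(1), rotated])
    show "f x * h x powr (- 1) = f x / h x" if "x \<in> S" for x
      using assms(4)[OF that] by (simp add: powr_minus divide_inverse)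
  qed
qed

text \<open>The Cholesky factorisation of the symmetric matrix with rows \<open>a, b\<close> and
  \<open>b, d\<close>, written as a sum of two products of linear forms.\<close>

lemma gram_schmidt_2:
  fixes a b d :: real
  assumes "a > 0" "d - b\<^sup>2 / a > 0"
  shows "(sqrt a * u1 + b / sqrt a * u2) * (sqrt a * w1 + b / sqrt a * w2)
      + (sqrt (d - b\<^sup>2 / a) * u2) * (sqrt (d - b\<^sup>2 / a) * w2)
    = a * u1 * w1 + b * u1 * w2 + b * u2 * w1 + d * u2 * w2"
proof -
  define s t where "s = sqrt a" and "t = sqrt (d - b\<^sup>2 / a)"
  have s: "s \<noteq> 0" "a = s * s" using assms(1) by (auto simp: s_def)
  have t: "t * t = d - b\<^sup>2 / a" using assms(2) by (simp add: t_def)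
  have "(s * u1 + b / s * u2) * (s * w1 + b / s * w2) + (t * u2) * (t * w2)
    = (s * u1 + b / s * u2) * (s * w1 + b / s * w2) + (t * t) * (u2 * w2)" by (simp add: mult_ac)
  also have "\<dots> = a * u1 * w1 + b * u1 * w2 + b * u2 * w1 + d * u2 * w2"
    unfolding t using s by (simp add: field_simps power2_eq_square)
  finally show ?thesis by (simp add: s_def t_def)
qed

text \<open>The exterior derivative of the pullback of the form with coefficients
  \<open>\<kappa> j\<close>. The terms with second derivatives of \<open>T\<close> are symmetric in
  \<open>u\<close> and \<open>w\<close> and cancel.\<close>

lemma frechet_derivative_pullback_form:
  fixes T :: "real ^ 'n::finite \<Rightarrow> real ^ 'n" and \<kappa> :: "'n \<Rightarrow> real ^ 'n \<Rightarrow> real"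
  assumes "open N" "open V" "y \<in> N" and TV: "\<And>z. z \<in> N \<Longrightarrow> T z \<in> V" and T: "smooth_on N T"
    and \<kappa>: "\<And>j. smooth_on V (\<kappa> j)"
  shows "frechet_derivative (\<lambda>z. \<Sum>j\<in>UNIV. \<kappa> j (T z) * frechet_derivative T (at z) w $ j) (at y) u
       - frechet_derivative (\<lambda>z. \<Sum>j\<in>UNIV. \<kappa> j (T z) * frechet_derivative T (at z) u $ j) (at y) w
    = (\<Sum>j\<in>UNIV. frechet_derivative (\<lambda>z. \<kappa> j (T z)) (at y) u * frechet_derivative T (at y) w $ j
       - frechet_derivative (\<lambda>z. \<kappa> j (T z)) (at y) w * frechet_derivative T (at y) u $ j)"
proof -
  let ?Tj = "\<lambda>j z. T z $ j"
  have Tj: "smooth_on N (?Tj j)" for j by (rule smooth_on_linear_compose[OF bounded_linear_vec_nth \<open>open N\<close> T])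
  have dTj: "frechet_derivative (?Tj j) (at z) w = frechet_derivative T (at z) w $ j" if "z \<in> N" for j z w
    by (rule fun_cong[OF frechet_derivative_eqI[OF bounded_linear.has_derivative[OF bounded_linear_vec_nth smooth_on_has_derivative[OF T that]]]])
  have \<kappa>T: "smooth_on N (\<lambda>z. \<kappa> j (T z))" for j by (rule smooth_on_compose[OF assms(1,2) TV T \<kappa>])
  have dd: "((\<lambda>z. frechet_derivative T (at z) w $ j) has_derivative
      frechet_derivative (\<lambda>z. frechet_derivative (?Tj j) (at z) w) (at y)) (at y)" for j w
    by (rule has_derivative_transform_within_open[OF
          smooth_on_has_derivative[OF smooth_on_frechet_derivative[OF Tj] \<open>y \<in> N\<close>] assms(1,3)]) (rule dTj)
  have "((\<lambda>z. \<Sum>j\<in>UNIV. \<kappa> j (T z) * frechet_derivative T (at z) w $ j) has_derivative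
     (\<lambda>u. \<Sum>j\<in>UNIV. \<kappa> j (T y) * frechet_derivative (\<lambda>z. frechet_derivative (?Tj j) (at z) w) (at y) u
        + frechet_derivative (\<lambda>z. \<kappa> j (T z)) (at y) u * frechet_derivative T (at y) w $ j)) (at y)" for w
    by (intro has_derivative_sum has_derivative_mult dd smooth_on_has_derivative[OF \<kappa>T \<open>y \<in> N\<close>])
  note fd = fun_cong[OF frechet_derivative_eqI[OF this]]
  show ?thesis
    unfolding fd frechet_derivative_commute[OF assms(1,3) Tj, of _ u w] by (simp add: sum_subtractf[symmetric])
qed

section \<open>Block-diagonal coordinates and adapted coframes\<close>

text \<open>The coframe is built from the components in the chart \<open>c\<close> and transported
  to every chart by pullback. The relations survive because a form with only two coordinate
  differentials has an exterior derivative in the ideal generated by them, also after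
  pullback.\<close>

lemma block_diagonal_imp_coframe:
  fixes X :: "'a topology" and A :: "('a, 4) chart set" and g :: "('a, 4) tensor"
  assumes sm: "smooth_manifold X A" and rm: "riemannian_metric X A g" and c: "c \<in> local_coords X A"
    and block: "\<And>y \<alpha> \<beta>. y \<in> snd c ` fst c \<Longrightarrow> (\<alpha>, \<beta>) \<in> {(1, 3), (1, 4), (2, 3), (2, 4)} \<Longrightarrow> component g c y \<alpha> \<beta> = 0"
  shows "\<exists>\<epsilon>. orthonormal_coframe_on X A g (fst c) \<epsilon> \<and>
       tensor_eq_on X A (fst c) (wedge 2 2 (wedge 1 1 (\<epsilon> 1) (\<epsilon> 2)) (ext_deriv 1 (\<epsilon> 1))) zero_tensor \<and>
       tensor_eq_on X A (fst c) (wedge 2 2 (wedge 1 1 (\<epsilon> 1) (\<epsilon> 2)) (ext_deriv 1 (\<epsilon> 2))) zero_tensor \<and>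
       tensor_eq_on X A (fst c) (wedge 2 2 (wedge 1 1 (\<epsilon> 3) (\<epsilon> 4)) (ext_deriv 1 (\<epsilon> 3))) zero_tensor \<and>
       tensor_eq_on X A (fst c) (wedge 2 2 (wedge 1 1 (\<epsilon> 3) (\<epsilon> 4)) (ext_deriv 1 (\<epsilon> 4))) zero_tensor"
proof -
  note chart = local_coords_chart[OF c] and openc = local_coords_open[OF c]
  define V where "V = snd c ` fst c"
  have V: "open V" using chart by (simp add: V_def is_chart_def)
  have sub: "fst c \<subseteq> topspace X" by (rule openin_subset[OF openc])
  have g: "tensor_field_on X A 2 (topspace X) g" using rm by (simp add: riemannian_metric_def)
  define C where "C \<alpha> \<beta> z = component g c z \<alpha> \<beta>" for \<alpha> \<beta> z
  define G where "G z u w = g c z (\<lambda>i. if i = 0 then u else w)" for z u w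
  have kl: "k_linear 2 (g c z)" if "z \<in> V" for z
  proof -
    have "\<forall>y\<in>snd c ` (fst c \<inter> topspace X). k_linear 2 (g c y)" using g c unfolding tensor_field_on_def by blast
    then show ?thesis using that sub by (auto simp: V_def Int_absorb2)
  qed
  have C_smooth: "smooth_on V (C \<alpha> \<beta>)" for \<alpha> \<beta>
  proof -
    have "\<forall>v. smooth_on (snd c ` (fst c \<inter> topspace X)) (\<lambda>y. g c y v)" using g c unfolding tensor_field_on_def by blast
    then show ?thesis using sub by (simp add: C_def[abs_def] component_def V_def Int_absorb2)
  qed
  have G1: "linear (\<lambda>u. G z u w)" and G2: "linear (\<lambda>w. G z u w)" if "z \<in> V" for z u w
    unfolding G_def by (rule k_linear_2_linear1[OF kl[OF that]] k_linear_2_linear2[OF kl[OF that]])+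
  have G_sym: "G z u w = G z w u" and G_pos: "u \<noteq> 0 \<Longrightarrow> G z u u > 0" if "z \<in> V" for z u w
  proof -
    have "\<forall>y\<in>snd c ` fst c.
        (\<forall>u w. g c y (\<lambda>i. if i = 0 then u else w) = g c y (\<lambda>i. if i = 0 then w else u)) \<and>
        (\<forall>u. u \<noteq> 0 \<longrightarrow> g c y (\<lambda>i. u) > 0)" using rm c unfolding riemannian_metric_def by blast
    then show "G z u w = G z w u" "u \<noteq> 0 \<Longrightarrow> G z u u > 0" using that unfolding V_def G_def if_cancel by blast+
  qed
  have G_sum: "G z u w = (\<Sum>\<alpha>\<in>UNIV. \<Sum>\<beta>\<in>UNIV. u $ \<alpha> * (w $ \<beta> * C \<alpha> \<beta> z))" if "z \<in> V" for z u w
  proof -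
    have "G z u w = (\<Sum>\<alpha>\<in>UNIV. u $ \<alpha> * G z (axis \<alpha> 1) w)" by (rule linear_axis_expand[OF G1[OF that]])
    also have "\<dots> = (\<Sum>\<alpha>\<in>UNIV. u $ \<alpha> * (\<Sum>\<beta>\<in>UNIV. w $ \<beta> * G z (axis \<alpha> 1) (axis \<beta> 1)))"
      by (intro sum.cong refl arg_cong[where f = "(*) _"] linear_axis_expand[OF G2[OF that]])
    finally show ?thesis by (simp add: sum_distrib_left C_def component_def G_def)
  qed
  have C_sym: "C \<alpha> \<beta> z = C \<beta> \<alpha> z" if "z \<in> V" for \<alpha> \<beta> z
    using G_sym[OF that, of "axis \<alpha> 1" "axis \<beta> 1"] by (simp add: C_def component_def G_def)
  have C0: "C 1 3 z = 0" "C 1 4 z = 0" "C 2 3 z = 0" "C 2 4 z = 0" "C 3 1 z = 0" "C 4 1 z = 0" "C 3 2 z = 0" "C 4 2 z = 0"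
    if "z \<in> V" for z
  proof -
    show b: "C 1 3 z = 0" "C 1 4 z = 0" "C 2 3 z = 0" "C 2 4 z = 0" using block that by (auto simp: C_def V_def)
    show "C 3 1 z = 0" "C 4 1 z = 0" "C 3 2 z = 0" "C 4 2 z = 0" using b C_sym[OF that] by metis+
  qed
  have pos1: "C \<alpha> \<alpha> z > 0" if "z \<in> V" for \<alpha> z
    using G_pos[OF that, of "axis \<alpha> 1"] by (simp add: C_def component_def G_def)
  have pos2: "C \<beta> \<beta> z - (C \<alpha> \<beta> z)\<^sup>2 / C \<alpha> \<alpha> z > 0" if "z \<in> V" "\<alpha> \<noteq> \<beta>" for \<alpha> \<beta> z
  proof -
    \<comment> \<open>The minimiser of the quadratic form along the line
      \<open>t *\<^sub>R ?a + ?b\<close>; its value there is the Schur complement, so positive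
      definiteness makes that positive.\<close>
    define t where "t = - C \<alpha> \<beta> z / C \<alpha> \<alpha> z"
    let ?a = "axis \<alpha> 1 :: real ^ 4" and ?b = "axis \<beta> 1 :: real ^ 4"
    have CG: "G z ?a ?a = C \<alpha> \<alpha> z" "G z ?a ?b = C \<alpha> \<beta> z" "G z ?b ?a = C \<alpha> \<beta> z" "G z ?b ?b = C \<beta> \<beta> z"
      using C_sym[OF that(1), of \<alpha> \<beta>] by (simp_all add: C_def component_def G_def)
    have "(t *\<^sub>R ?a + ?b) $ \<beta> = 1" using that(2) by (simp add: axis_def)
    then have "t *\<^sub>R ?a + ?b \<noteq> 0" by (metis zero_index zero_neq_one)
    from G_pos[OF that(1) this] have "t * (t * C \<alpha> \<alpha> z + C \<alpha> \<beta> z) + (t * C \<alpha> \<beta> z + C \<beta> \<beta> z) > 0"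
      by (simp add: linear_add[OF G1[OF that(1)]] linear_scale[OF G1[OF that(1)]]
          linear_add[OF G2[OF that(1)]] linear_scale[OF G2[OF that(1)]] CG)
    then show ?thesis using pos1[OF that(1), of \<alpha>] by (simp add: t_def power2_eq_square field_simps)
  qed
  \<comment> \<open>The triangular Cholesky factors of the two diagonal blocks; row \<open>i\<close>
    holds the coefficients of the \<open>i\<close>-th coframe member.\<close>
  define \<kappa> :: "4 \<Rightarrow> 4 \<Rightarrow> real ^ 4 \<Rightarrow> real" where "\<kappa> i j z =
    (if (i, j) \<in> {(1, 1), (3, 3)} then sqrt (C i i z)
     else if (i, j) \<in> {(1, 2), (3, 4)} then C i j z / sqrt (C i i z)
     else if i = 2 \<and> j = 2 then sqrt (C 2 2 z - (C 1 2 z)\<^sup>2 / C 1 1 z)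
     else if i = 4 \<and> j = 4 then sqrt (C 4 4 z - (C 3 4 z)\<^sup>2 / C 3 3 z)
     else 0)" for i j z
  have \<kappa>_smooth: "smooth_on V (\<kappa> i j)" for i j
  proof -
    have s: "smooth_on V (\<lambda>z. sqrt (C i i z))" for i by (rule smooth_on_sqrt[OF V C_smooth pos1])
    have d: "smooth_on V (\<lambda>z. C i j z / sqrt (C i i z))" for i j
      by (rule smooth_on_divide[OF V C_smooth s]) (simp add: pos1)
    have q: "smooth_on V (\<lambda>z. sqrt (C \<beta> \<beta> z - (C \<alpha> \<beta> z)\<^sup>2 / C \<alpha> \<alpha> z))" if "\<alpha> \<noteq> \<beta>" for \<alpha> \<beta>
      unfolding power2_eq_square
      by (intro smooth_on_sqrt smooth_on_diff smooth_on_divide smooth_on_mult V C_smooth pos1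
          pos2[unfolded power2_eq_square] that)
    show ?thesis unfolding \<kappa>_def[abs_def] by (intro smooth_on_if s d q smooth_on_const) simp_all
  qed
  define \<eta> where "\<eta> i z u = (\<Sum>j\<in>UNIV. \<kappa> i j z * u $ j)" for i z and u :: "real ^ 4"
  have \<eta>_lin: "linear (\<eta> i z)" for i z
    by (rule linearI) (simp_all add: \<eta>_def sum.distrib distrib_left sum_distrib_left mult_ac)
  have \<eta>12: "\<eta> i z u = \<kappa> i 1 z * u $ 1 + \<kappa> i 2 z * u $ 2" if "i \<in> {1, 2}" for i z u
    using that by (auto simp: \<eta>_def sum_4 \<kappa>_def)
  have \<eta>34: "\<eta> i z u = \<kappa> i 3 z * u $ 3 + \<kappa> i 4 z * u $ 4" if "i \<in> {3, 4}" for i z u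
    using that by (auto simp: \<eta>_def sum_4 \<kappa>_def)
  have G_\<eta>: "(\<Sum>a\<in>UNIV. \<eta> a z u * \<eta> a z w) = G z u w" if "z \<in> V" for z u w
  proof -
    have "(\<Sum>a\<in>UNIV. \<eta> a z u * \<eta> a z w) =
        (\<eta> 1 z u * \<eta> 1 z w + \<eta> 2 z u * \<eta> 2 z w) + (\<eta> 3 z u * \<eta> 3 z w + \<eta> 4 z u * \<eta> 4 z w)" by (simp add: sum_4)
    also have "\<eta> 1 z u * \<eta> 1 z w + \<eta> 2 z u * \<eta> 2 z w =
        C 1 1 z * u $ 1 * w $ 1 + C 1 2 z * u $ 1 * w $ 2 + C 1 2 z * u $ 2 * w $ 1 + C 2 2 z * u $ 2 * w $ 2"
      using gram_schmidt_2[OF pos1[OF that, of 1] pos2[OF that, of 1 2], of "u $ 1" "u $ 2" "w $ 1" "w $ 2"]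
      by (simp add: \<eta>12 \<kappa>_def)
    also have "\<eta> 3 z u * \<eta> 3 z w + \<eta> 4 z u * \<eta> 4 z w =
        C 3 3 z * u $ 3 * w $ 3 + C 3 4 z * u $ 3 * w $ 4 + C 3 4 z * u $ 4 * w $ 3 + C 4 4 z * u $ 4 * w $ 4"
      using gram_schmidt_2[OF pos1[OF that, of 3] pos2[OF that, of 3 4], of "u $ 3" "u $ 4" "w $ 3" "w $ 4"]
      by (simp add: \<eta>34 \<kappa>_def)
    finally show ?thesis
      unfolding G_sum[OF that] sum_4 C0[OF that] C_sym[OF that, of 2 1] C_sym[OF that, of 4 3] by (simp add: algebra_simps)
  qed
  let ?T = "\<lambda>d. transition d c"
  let ?D = "\<lambda>d y. frechet_derivative (transition d c) (at y)"
  \<comment> \<open>The pullback of \<open>\<eta> i\<close> along the transition to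
    \<open>c\<close>. The chain rule for transitions yields the transformation law between any two
    charts.\<close>
  define \<epsilon> :: "4 \<Rightarrow> ('a, 4) tensor" where "\<epsilon> i d y v = \<eta> i (?T d y) (?D d y (v 0))" for i d y v
  have T: "smooth_on (snd d ` (fst d \<inter> fst c)) (?T d)" if "d \<in> local_coords X A" for d
    by (rule transition_smooth[OF sm that c])
  have N: "open (snd d ` (fst d \<inter> fst c))" if "d \<in> local_coords X A" for d
    by (rule chart_open_image[OF local_coords_chart[OF that] openc])
  have TV: "?T d y \<in> V" if "d \<in> local_coords X A" "y \<in> snd d ` (fst d \<inter> fst c)" for d y
    using that(2) by (auto simp: transition_apply[OF local_coords_chart[OF that(1)]] V_def)
  have D_lin: "linear (?D d y)" if "d \<in> local_coords X A" "y \<in> snd d ` (fst d \<inter> fst c)" for d y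
    by (rule has_derivative_linear[OF smooth_on_has_derivative[OF T[OF that(1)] that(2)]])
  have kl1: "k_linear 1 (\<epsilon> i d y)" if "d \<in> local_coords X A" "y \<in> snd d ` (fst d \<inter> fst c)" for i d y
    unfolding k_linear_def
    using linear_compose[OF D_lin[OF that] \<eta>_lin[of i "?T d y"]] by (auto simp: \<epsilon>_def o_def)
  have \<kappa>T: "smooth_on (snd d ` (fst d \<inter> fst c)) (\<lambda>y. \<kappa> i j (?T d y))" if "d \<in> local_coords X A" for d i j
    by (rule smooth_on_compose[OF N[OF that] V _ T[OF that] \<kappa>_smooth]) (rule TV[OF that])
  have \<epsilon>_smooth: "smooth_on (snd d ` (fst d \<inter> fst c)) (\<lambda>y. \<epsilon> i d y v)" if "d \<in> local_coords X A" for d i v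
    unfolding \<epsilon>_def \<eta>_def
    by (intro smooth_on_sum smooth_on_mult N[OF that] \<kappa>T[OF that]
        smooth_on_linear_compose[OF bounded_linear_vec_nth] smooth_on_frechet_derivative[OF T[OF that]])
  have form: "one_form_on X A (fst c) (\<epsilon> i)" for i
    unfolding tensor_field_on_def
  proof (intro conjI ballI allI)
    fix d e y v assume d: "d \<in> local_coords X A" and e: "e \<in> local_coords X A" and y: "y \<in> snd d ` (fst d \<inter> fst e \<inter> fst c)"
    have y': "y \<in> snd d ` (fst d \<inter> fst e)" "y \<in> snd d ` (fst d \<inter> (fst e \<inter> fst c))" using y by (auto simp: Int_assoc)
    show "\<epsilon> i d y v = \<epsilon> i e (transition d e y) (\<lambda>i. frechet_derivative (transition d e) (at y) (v i))"
      unfolding \<epsilon>_def transition_frechet_derivative[OF sm d c e y'(2)]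
        transition_transition[OF local_coords_chart[OF d] local_coords_chart[OF e] y'(1)] ..
  qed (rule kl1 \<epsilon>_smooth; assumption)+
  have metric: "tensor_eq_on X A (fst c) g (\<lambda>c y v. \<Sum>a\<in>UNIV. tensor_prod 1 (\<epsilon> a) (\<epsilon> a) c y v)"
    unfolding tensor_eq_on_def
  proof (intro ballI allI)
    fix d y v assume d: "d \<in> local_coords X A" and y: "y \<in> snd d ` (fst d \<inter> fst c)"
    have "y \<in> snd d ` (fst d \<inter> fst c \<inter> topspace X)" using y sub by blast
    then have "g d y v = g c (?T d y) (\<lambda>i. ?D d y (v i))"
      using g c d unfolding tensor_field_on_def by blast
    also have "\<dots> = G (?T d y) (?D d y (v 0)) (?D d y (v 1))"
      unfolding G_def by (rule k_linear_2_const[OF kl[OF TV[OF d y]]])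
    also have "\<dots> = (\<Sum>a\<in>UNIV. tensor_prod 1 (\<epsilon> a) (\<epsilon> a) d y v)"
      by (simp add: G_\<eta>[OF TV[OF d y], symmetric] tensor_prod_def \<epsilon>_def)
    finally show "g d y v = (\<Sum>a\<in>UNIV. tensor_prod 1 (\<epsilon> a) (\<epsilon> a) d y v)" .
  qed
  \<comment> \<open>One statement for both blocks: \<open>p\<close> and \<open>q\<close> are the
    coordinates of the block to which \<open>a\<close>, \<open>b\<close> and \<open>e\<close>
    belong.\<close>
  have wedge0: "tensor_eq_on X A (fst c) (wedge 2 2 (wedge 1 1 (\<epsilon> a) (\<epsilon> b)) (ext_deriv 1 (\<epsilon> e))) zero_tensor"
    if eq: "\<And>i z u. i \<in> {a, b, e} \<Longrightarrow> \<eta> i z u = \<kappa> i p z * u $ p + \<kappa> i q z * u $ q"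
      and pq: "p \<noteq> q" and z0: "\<And>j z. j \<notin> {p, q} \<Longrightarrow> \<kappa> e j z = 0" for a b e p q
    unfolding tensor_eq_on_def zero_tensor_def
  proof (intro ballI allI)
    fix d y v assume d: "d \<in> local_coords X A" and y: "y \<in> snd d ` (fst d \<inter> fst c)"
    let ?N = "snd d ` (fst d \<inter> fst c)"
    let ?\<theta> = "\<lambda>j u. frechet_derivative (\<lambda>z. \<kappa> e j (?T d z)) (at y) u"
    show "wedge 2 2 (wedge 1 1 (\<epsilon> a) (\<epsilon> b)) (ext_deriv 1 (\<epsilon> e)) d y v = 0"
    proof (rule wedge_eq_0I[where N = ?N and P = "\<lambda>u. ?D d y u $ p" and Q = "\<lambda>u. ?D d y u $ q" and \<theta> = "?\<theta> p" and \<kappa> = "?\<theta> q"])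
      show "open ?N" "y \<in> ?N" "k_linear 1 (\<epsilon> a d y)" "k_linear 1 (\<epsilon> b d y)" "\<forall>z\<in>?N. k_linear 1 (\<epsilon> e d z)"
        using N[OF d] y kl1[OF d] by auto
      show "\<forall>v. (\<lambda>z. \<epsilon> e d z v) differentiable at y"
        using smooth_on_has_derivative[OF \<epsilon>_smooth[OF d] y] differentiableI by blast
      show "\<epsilon> a d y (\<lambda>_. u) = \<kappa> a p (?T d y) * ?D d y u $ p + \<kappa> a q (?T d y) * ?D d y u $ q" for u
        by (simp add: \<epsilon>_def eq)
      show "\<epsilon> b d y (\<lambda>_. u) = \<kappa> b p (?T d y) * ?D d y u $ p + \<kappa> b q (?T d y) * ?D d y u $ q" for u
        by (simp add: \<epsilon>_def eq)
      fix u w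
      have two: "(\<Sum>j\<in>UNIV. f j) = f p + f q" if "\<And>j. j \<notin> {p, q} \<Longrightarrow> f j = 0" for f :: "4 \<Rightarrow> real"
        using sum.mono_neutral_right[of UNIV "{p, q}" f] that pq by simp
      have \<theta>0: "?\<theta> j u = 0" if "j \<notin> {p, q}" for j u using z0[OF that] by simp
      have "frechet_derivative (\<lambda>z. \<epsilon> e d z (\<lambda>_. w)) (at y) u - frechet_derivative (\<lambda>z. \<epsilon> e d z (\<lambda>_. u)) (at y) w
        = (\<Sum>j\<in>UNIV. ?\<theta> j u * ?D d y w $ j - ?\<theta> j w * ?D d y u $ j)"
        unfolding \<epsilon>_def \<eta>_def
        by (rule frechet_derivative_pullback_form[OF N[OF d] V y _ T[OF d] \<kappa>_smooth]) (rule TV[OF d])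
      also have "\<dots> = (?\<theta> p u * ?D d y w $ p - ?\<theta> p w * ?D d y u $ p) + (?\<theta> q u * ?D d y w $ q - ?\<theta> q w * ?D d y u $ q)"
        by (rule two) (simp add: \<theta>0)
      finally show "frechet_derivative (\<lambda>z. \<epsilon> e d z (\<lambda>_. w)) (at y) u - frechet_derivative (\<lambda>z. \<epsilon> e d z (\<lambda>_. u)) (at y) w
        = ?\<theta> p u * ?D d y w $ p - ?\<theta> p w * ?D d y u $ p + ?\<theta> q u * ?D d y w $ q - ?\<theta> q w * ?D d y u $ q"
        by simp
    qed
  qed
  have z12: "\<kappa> e j z = 0" if "e \<in> {1, 2}" "j \<notin> {1, 2}" for e j z using that by (auto simp: \<kappa>_def)
  have z34: "\<kappa> e j z = 0" if "e \<in> {3, 4}" "j \<notin> {3, 4}" for e j z using that by (auto simp: \<kappa>_def)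
  have w12: "tensor_eq_on X A (fst c) (wedge 2 2 (wedge 1 1 (\<epsilon> 1) (\<epsilon> 2)) (ext_deriv 1 (\<epsilon> e))) zero_tensor" if "e \<in> {1, 2}" for e
    by (rule wedge0[of 1 2 e 1 2]) (use that z12[OF that] in \<open>auto intro!: \<eta>12\<close>)
  have w34: "tensor_eq_on X A (fst c) (wedge 2 2 (wedge 1 1 (\<epsilon> 3) (\<epsilon> 4)) (ext_deriv 1 (\<epsilon> e))) zero_tensor" if "e \<in> {3, 4}" for e
    by (rule wedge0[of 3 4 e 3 4]) (use that z34[OF that] in \<open>auto intro!: \<eta>34\<close>)
  show ?thesis
    using form metric w12[of 1] w12[of 2] w34[of 3] w34[of 4] unfolding orthonormal_coframe_on_def by blast
qed

lemma first_integrals: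
  fixes e :: "4 \<Rightarrow> real ^ 4 \<Rightarrow> real ^ 4 \<Rightarrow> real"
  assumes "open V" "z0 \<in> V" and e: "\<And>i v. smooth_on V (\<lambda>y. e i y v)" and lin: "\<And>i y. y \<in> V \<Longrightarrow> linear (e i y)"
    and inj: "\<And>u. (\<And>i. e i z0 u = 0) \<Longrightarrow> u = 0"
    and UNIV: "UNIV = {a, b, p, q}" and distinct: "distinct [a, b, p, q]"
    and integrable: "\<And>i y u w. i \<in> {a, b} \<Longrightarrow> y \<in> V \<Longrightarrow> e a y u = 0 \<Longrightarrow> e b y u = 0 \<Longrightarrow> e a y w = 0 \<Longrightarrow> e b y w = 0 \<Longrightarrow>
      frechet_derivative (\<lambda>z. e i z w) (at y) u = frechet_derivative (\<lambda>z. e i z u) (at y) w"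
  shows "\<exists>U h. open U \<and> z0 \<in> U \<and> U \<subseteq> V \<and> smooth_on U (h :: _ \<Rightarrow> real \<times> real) \<and>
    (\<forall>y\<in>U. \<forall>v. frechet_derivative h (at y) v = 0 \<longleftrightarrow> e a y v = 0 \<and> e b y v = 0)"
proof -
  define E :: "real ^ 4 \<Rightarrow> real ^ 4" where "E u = (\<chi> i. e i z0 u)" for u
  have E_lin: "linear E"
    by (rule linearI) (simp_all add: E_def vec_eq_iff linear_add[OF lin[OF \<open>z0 \<in> V\<close>]] linear_scale[OF lin[OF \<open>z0 \<in> V\<close>]])
  have E_inj: "inj E" unfolding linear_injective_0[OF E_lin] using inj by (auto simp: E_def vec_eq_iff)
  then have E_surj: "surj E" by (rule linear_injective_imp_surjective[OF E_lin _ refl])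
  \<comment> \<open>Regroups the two pairs of values into a vector indexed by 4; the inverse of
    \<open>E\<close> turns it into the tangent vector with these coframe values.\<close>
  define R :: "(real \<times> real) \<times> (real \<times> real) \<Rightarrow> real ^ 4" where
    "R r = (\<chi> i. if i = a then fst (fst r) else if i = b then snd (fst r) else if i = p then fst (snd r) else snd (snd r))" for r
  have R_lin: "linear R" by (rule linearI) (auto simp: R_def vec_eq_iff)
  have R_nth: "R r $ a = fst (fst r)" "R r $ b = snd (fst r)" "R r $ p = fst (snd r)" "R r $ q = snd (snd r)" for r
    using distinct by (auto simp: R_def)
  have vec_eq: "x = y \<longleftrightarrow> x $ a = y $ a \<and> x $ b = y $ b \<and> x $ p = y $ p \<and> x $ q = y $ q" for x y :: "real ^ 4"
  proof -
    have "x = y \<longleftrightarrow> (\<forall>i\<in>{a, b, p, q}. x $ i = y $ i)" unfolding UNIV[symmetric] by (simp add: vec_eq_iff)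
    then show ?thesis by simp
  qed
  have E_nth: "E u $ i = e i z0 u" for i u by (simp add: E_def)
  have EA: "E (inv E w) = w" and AE: "inv E (E u) = u" for u w
    using E_inj E_surj by (simp_all add: surj_f_inv_f)
  define \<omega> where "\<omega> y v = (e a y v, e b y v)" for y v
  have d\<omega>: "frechet_derivative (\<lambda>z. \<omega> z w) (at y) = (\<lambda>u. (frechet_derivative (\<lambda>z. e a z w) (at y) u, frechet_derivative (\<lambda>z. e b z w) (at y) u))"
    if "y \<in> V" for y w
    unfolding \<omega>_def
    by (rule frechet_derivative_eqI[OF has_derivative_Pair[OF smooth_on_has_derivative[OF e that] smooth_on_has_derivative[OF e that]]])
  show ?thesis
  proof (rule frobenius[where \<omega> = \<omega> and \<pi> = "\<lambda>v. (e p z0 v, e q z0 v)" and A = "\<lambda>r. inv E (R r)", OF \<open>open V\<close> \<open>z0 \<in> V\<close>])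
    show "smooth_on V (\<lambda>y. \<omega> y v)" for v unfolding \<omega>_def by (rule smooth_on_Pair[OF \<open>open V\<close> e e])
    show "linear (\<omega> y)" if "y \<in> V" for y
      by (rule linearI) (simp_all add: \<omega>_def linear_add[OF lin[OF that]] linear_scale[OF lin[OF that]])
    show "linear (\<lambda>v. (e p z0 v, e q z0 v))"
      by (rule linearI) (simp_all add: linear_add[OF lin[OF \<open>z0 \<in> V\<close>]] linear_scale[OF lin[OF \<open>z0 \<in> V\<close>]])
    show "linear (\<lambda>r. inv E (R r))"
      using linear_compose[OF R_lin inj_linear_imp_inv_linear[OF E_lin E_inj]] by (simp add: o_def)
    show "inv E (R (\<omega> z0 v, e p z0 v, e q z0 v)) = v" for v
    proof -
      have "R (\<omega> z0 v, e p z0 v, e q z0 v) = E v" by (simp add: vec_eq R_nth E_nth \<omega>_def)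
      then show ?thesis by (simp add: AE)
    qed
    show "(\<omega> z0 (inv E (R r)), e p z0 (inv E (R r)), e q z0 (inv E (R r))) = r" for r
      by (simp add: \<omega>_def E_nth[symmetric] EA R_nth)
    show "frechet_derivative (\<lambda>z. \<omega> z w) (at y) u = frechet_derivative (\<lambda>z. \<omega> z u) (at y) w"
      if "y \<in> V" "\<omega> y u = 0" "\<omega> y w = 0" for y u w
    proof -
      have k: "e a y u = 0" "e b y u = 0" "e a y w = 0" "e b y w = 0"
        using that(2,3) by (simp_all add: \<omega>_def zero_prod_def)
      have "frechet_derivative (\<lambda>z. e i z w) (at y) u = frechet_derivative (\<lambda>z. e i z u) (at y) w" if "i \<in> {a, b}" for i
        by (rule integrable[OF that \<open>y \<in> V\<close> k])
      then show ?thesis unfolding d\<omega>[OF that(1)] by simp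
    qed
    fix U and h :: "real ^ 4 \<Rightarrow> real \<times> real"
    assume "open U" "z0 \<in> U" "U \<subseteq> V" "smooth_on U h"
      "\<And>y v. y \<in> U \<Longrightarrow> (frechet_derivative h (at y) v = 0) = (\<omega> y v = 0)"
    moreover have "\<omega> y v = 0 \<longleftrightarrow> e a y v = 0 \<and> e b y v = 0" for y v
      by (simp add: \<omega>_def zero_prod_def)
    ultimately have "open U \<and> z0 \<in> U \<and> U \<subseteq> V \<and> smooth_on U h \<and>
      (\<forall>y\<in>U. \<forall>v. frechet_derivative h (at y) v = 0 \<longleftrightarrow> e a y v = 0 \<and> e b y v = 0)" by simp
    then show ?thesis by (intro exI)
  qed
qed

lemma smooth_on_vec:
  fixes f :: "'a::real_normed_vector \<Rightarrow> real ^ 'n::finite"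
  assumes "open S" "\<And>i. smooth_on S (\<lambda>x. f x $ i)" shows "smooth_on S f"
proof -
  have eq: "f x = (\<Sum>i\<in>UNIV. (f x $ i) *\<^sub>R axis i 1)" for x
    using basis_expansion[of "f x"] by (simp add: scalar_mult_eq_scaleR)
  have "smooth_on S (\<lambda>x. \<Sum>i\<in>UNIV. (f x $ i) *\<^sub>R axis i (1::real))"
    by (intro smooth_on_sum smooth_on_scaleR assms smooth_on_const)
  then show ?thesis by (rule smooth_on_cong[OF \<open>open S\<close> eq[symmetric]])
qed

lemma homeomorphism_imp_homeomorphic_map:
  "homeomorphism S T f g \<Longrightarrow> homeomorphic_map (top_of_set S) (top_of_set T) f"
  unfolding homeomorphic_map_maps homeomorphic_maps_def homeomorphism_def
  by (intro exI[of _ g]) (auto simp: continuous_map_in_subtopology)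

text \<open>Changing coordinates by a diffeomorphism of part of the image of an atlas chart stays in
  the maximal atlas: transitions to other charts factor through \<open>a\<close>. The transition
  back to \<open>a\<close> is \<open>g\<close>, which is what computes components in the new
  chart.\<close>

lemma local_coords_compose:
  assumes sm: "smooth_manifold X A" and a: "a \<in> A" and U: "open U" "U \<subseteq> snd a ` fst a" and V: "open V"
    and hom: "homeomorphism U V f g" and f: "smooth_on U f" and g: "smooth_on V g"
  defines "c \<equiv> ({p \<in> fst a. snd a p \<in> U}, \<lambda>p. f (snd a p))"
  shows "c \<in> local_coords X A" "snd c ` fst c = V" "\<And>y. y \<in> V \<Longrightarrow> transition c a y = g y"
proof -
  have a': "a \<in> local_coords X A" using atlas_subset_local_coords[OF sm] a by blast
  note cha = local_coords_chart[OF a']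
  have img: "snd a ` {p \<in> fst a. snd a p \<in> U} = U" using U(2) by auto
  have "f ` U = V" by (rule homeomorphism_image1[OF hom])
  then show V_eq: "snd c ` fst c = V" using img by (auto simp: c_def image_image[symmetric])
  have open_c: "openin X (fst c)" unfolding c_def fst_conv by (rule chart_preimage_open[OF cha U(1)])
  have sub: "fst c \<subseteq> fst a" by (auto simp: c_def)
  have "homeomorphic_map (subtopology X (fst a)) (top_of_set (snd a ` fst a)) (snd a)" using cha by (simp add: is_chart_def)
  then have "homeomorphic_map (subtopology (subtopology X (fst a)) (fst c)) (subtopology (top_of_set (snd a ` fst a)) U) (snd a)"
  proof (rule homeomorphic_map_subtopologies)
    show "snd a ` (topspace (subtopology X (fst a)) \<inter> fst c) = topspace (top_of_set (snd a ` fst a)) \<inter> U"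
      unfolding chart_topspace[OF cha] using U(2) by (auto simp: c_def)
  qed
  moreover have "subtopology (subtopology X (fst a)) (fst c) = subtopology X (fst c)"
    using sub by (simp add: subtopology_subtopology Int_absorb1)
  moreover have "subtopology (top_of_set (snd a ` fst a)) U = top_of_set U"
    using U(2) by (simp add: subtopology_subtopology Int_absorb1)
  ultimately have "homeomorphic_map (subtopology X (fst c)) (top_of_set U) (snd a)" by simp
  from homeomorphic_map_compose[OF this homeomorphism_imp_homeomorphic_map[OF hom]]
  have "homeomorphic_map (subtopology X (fst c)) (top_of_set V) (snd c)" by (simp add: c_def o_def)
  then have chc: "is_chart X c" using open_c V by (simp add: is_chart_def V_eq)
  show trans: "transition c a y = g y" if "y \<in> V" for y
  proof -
    have "g y \<in> U" using homeomorphism_image2[OF hom] that by blast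
    then obtain p where p: "p \<in> fst a" "snd a p = g y" using U(2) by auto
    then have "p \<in> fst c" "snd c p = y" using \<open>g y \<in> U\<close> homeomorphism_apply2[OF hom that] by (auto simp: c_def)
    then show ?thesis using transition_apply[OF chc, of p a] p(2) by simp
  qed
  have "compatible c d" if d: "d \<in> A" for d
    unfolding compatible_def
  proof
    have d': "d \<in> local_coords X A" using atlas_subset_local_coords[OF sm] d by blast
    note chd = local_coords_chart[OF d']
    let ?M = "snd c ` (fst c \<inter> fst d)"
    have M: "open ?M" by (rule chart_open_image[OF chc local_coords_open[OF d']])
    have MV: "?M \<subseteq> V" using V_eq by auto
    have "smooth_on ?M (\<lambda>y. transition a d (g y))"
    proof (rule smooth_on_compose[where g = g, OF M chart_open_image[OF cha local_coords_open[OF d']]])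
      show "g y \<in> snd a ` (fst a \<inter> fst d)" if "y \<in> ?M" for y
        using that by (auto simp: c_def homeomorphism_apply1[OF hom])
      show "smooth_on ?M g" by (rule smooth_on_subset[OF g MV])
      show "smooth_on (snd a ` (fst a \<inter> fst d)) (transition a d)" by (rule transition_smooth[OF sm a' d'])
    qed
    then show "smooth_on ?M (transition c d)"
    proof (rule smooth_on_cong[OF M, rotated])
      fix y assume y: "y \<in> ?M"
      then have "y \<in> snd c ` (fst c \<inter> fst a)" "y \<in> V" using sub MV by auto
      then show "transition a d (g y) = transition c d y"
        using transition_transition[OF chc cha, of y d] trans[of y] by simp
    qed
    let ?L = "snd d ` (fst c \<inter> fst d)"
    have L: "open ?L" using chart_open_image[OF chd open_c] by (simp add: Int_commute)
    have "smooth_on ?L (\<lambda>y. f (transition d a y))"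
    proof (rule smooth_on_compose[where g = "transition d a", OF L U(1) _ _ f])
      show "transition d a y \<in> U" if "y \<in> ?L" for y using that by (auto simp: transition_apply[OF chd] c_def)
      show "smooth_on ?L (transition d a)"
        by (rule smooth_on_subset[OF transition_smooth[OF sm d' a']]) (use sub in auto)
    qed
    then show "smooth_on ?L (transition d c)"
      by (rule smooth_on_cong[OF L, rotated]) (auto simp: transition_apply[OF chd] c_def)
  qed
  then show "c \<in> local_coords X A" using chc by (simp add: local_coords_def)
qed

text \<open>The first integrals of both pairs are combined into one map. Because its differentials
  have the kernels of the pairs, each coframe member vanishes on two of the four new coordinate
  vectors.\<close>

lemma coframe_imp_block_diagonalisable:
  fixes X :: "'a topology" and A :: "('a, 4) chart set" and g :: "('a, 4) tensor"
  assumes sm: "smooth_manifold X A" and rm: "riemannian_metric X A g" and W: "openin X W" and x: "x \<in> W"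
    and coframe: "orthonormal_coframe_on X A g W \<epsilon>"
    and w12: "\<And>i. i \<in> {1, 2} \<Longrightarrow> tensor_eq_on X A W (wedge 2 2 (wedge 1 1 (\<epsilon> 1) (\<epsilon> 2)) (ext_deriv 1 (\<epsilon> i))) zero_tensor"
    and w34: "\<And>i. i \<in> {3, 4} \<Longrightarrow> tensor_eq_on X A W (wedge 2 2 (wedge 1 1 (\<epsilon> 3) (\<epsilon> 4)) (ext_deriv 1 (\<epsilon> i))) zero_tensor"
  shows "block_diagonalisable_near X A g x"
proof -
  have "x \<in> topspace X" using W x openin_subset by blast
  moreover have "(\<Union>c\<in>A. fst c) = topspace X" using sm by (simp add: smooth_manifold_def)
  ultimately obtain a where a: "a \<in> A" "x \<in> fst a" by blast
  have a': "a \<in> local_coords X A" using atlas_subset_local_coords[OF sm] a(1) by blast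
  note cha = local_coords_chart[OF a']
  define V where "V = snd a ` (fst a \<inter> W)"
  have V: "open V" unfolding V_def by (rule chart_open_image[OF cha W])
  define z0 where "z0 = snd a x"
  have z0: "z0 \<in> V" using a(2) x by (simp add: z0_def V_def)
  have form: "tensor_field_on X A 1 W (\<epsilon> i)" for i using coframe by (simp add: orthonormal_coframe_on_def)
  have kl: "k_linear 1 (\<epsilon> i a y)" if "y \<in> V" for i y
    using form[of i] a' that unfolding tensor_field_on_def V_def by blast
  have \<epsilon>_smooth: "smooth_on V (\<lambda>y. \<epsilon> i a y v)" for i v
    using form[of i] a' unfolding tensor_field_on_def V_def by blast
  define e where "e i y u = \<epsilon> i a y (\<lambda>_. u)" for i y u
  have e_smooth: "smooth_on V (\<lambda>y. e i y v)" for i v unfolding e_def by (rule \<epsilon>_smooth)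
  have e_lin: "linear (e i y)" if "y \<in> V" for i y
    unfolding e_def[abs_def] by (rule k_linear_1_linear[OF kl[OF that]])
  have metric: "g a y v = (\<Sum>i\<in>UNIV. e i y (v 0) * e i y (v 1))" if "y \<in> V" for y v
  proof -
    have "g a y v = (\<Sum>i\<in>UNIV. tensor_prod 1 (\<epsilon> i) (\<epsilon> i) a y v)"
      using coframe a' that unfolding orthonormal_coframe_on_def tensor_eq_on_def V_def by blast
    moreover have "tensor_prod 1 (\<epsilon> i) (\<epsilon> i) a y v = e i y (v 0) * e i y (v 1)" for i
      unfolding tensor_prod_def e_def k_linear_1_const[OF kl[OF that], of i v]
        k_linear_1_const[OF kl[OF that], of i "\<lambda>i. v (1 + i)"] add_0_right ..
    ultimately show ?thesis by simp
  qed
  \<comment> \<open>A vector killed by the whole coframe has length zero, so positive definiteness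
    makes the coframe a basis at each point.\<close>
  have inj: "u = 0" if "y \<in> V" "\<And>i. e i y u = 0" for y u
  proof (rule ccontr)
    assume "u \<noteq> 0"
    moreover have "y \<in> snd a ` fst a" using that(1) by (auto simp: V_def)
    ultimately have "g a y (\<lambda>i. u) > 0" using rm a' unfolding riemannian_metric_def by blast
    then show False using metric[OF that(1), of "\<lambda>i. u"] that(2) by simp
  qed
  \<comment> \<open>Vectors of the dual frame are the test vectors that extract the exterior
    derivative from a vanishing wedge product.\<close>
  have dual: "\<exists>u. \<forall>i. e i y u = (if i = j then 1 else 0)" if "y \<in> V" for y j
  proof -
    let ?E = "\<lambda>u. \<chi> i. e i y u"
    have lin: "linear ?E"
      by (rule linearI) (simp_all add: vec_eq_iff linear_add[OF e_lin[OF that]] linear_scale[OF e_lin[OF that]])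
    have "inj ?E" unfolding linear_injective_0[OF lin] using inj[OF that] by (auto simp: vec_eq_iff)
    then have "surj ?E" by (rule linear_injective_imp_surjective[OF lin _ refl])
    then obtain u where "axis j 1 = ?E u" by (rule surjE)
    have "e i y u = (if i = j then 1 else 0)" for i
      using arg_cong[OF \<open>axis j 1 = ?E u\<close>, of "\<lambda>w. w $ i"] by (auto simp: axis_def)
    then show ?thesis by blast
  qed
  have diff: "\<forall>v. (\<lambda>z. \<epsilon> i a z v) differentiable at y" if "y \<in> V" for i y
    using smooth_on_has_derivative[OF \<epsilon>_smooth that] differentiableI by blast
  have integrable: "frechet_derivative (\<lambda>z. e i z w) (at y) u = frechet_derivative (\<lambda>z. e i z u) (at y) w"
    if wedge: "tensor_eq_on X A W (wedge 2 2 (wedge 1 1 (\<epsilon> j) (\<epsilon> k)) (ext_deriv 1 (\<epsilon> i))) zero_tensor" and "j \<noteq> k"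
      and y: "y \<in> V" and ker: "e j y u = 0" "e k y u = 0" "e j y w = 0" "e k y w = 0" for i j k y u w
  proof -
    obtain b where b: "\<forall>i. e i y b = (if i = j then 1 else 0)" using dual[OF y] by blast
    obtain d where d: "\<forall>i. e i y d = (if i = k then 1 else 0)" using dual[OF y] by blast
    have zero: "wedge 2 2 (wedge 1 1 (\<epsilon> j) (\<epsilon> k)) (ext_deriv 1 (\<epsilon> i)) a y v = 0" for v
      using wedge a' y unfolding tensor_eq_on_def zero_tensor_def V_def by blast
    have kl': "\<forall>z\<in>V. k_linear 1 (\<epsilon> i a z)" using kl by blast
    show ?thesis unfolding e_def
      by (rule wedge_eq_0_imp[where \<alpha> = "\<epsilon> j" and \<beta> = "\<epsilon> k" and a = b and b = d, OF V y kl[OF y] kl[OF y] kl' diff[OF y] zero])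
        (use b d ker \<open>j \<noteq> k\<close> in \<open>auto simp: e_def\<close>)
  qed
  \<comment> \<open>Two orderings of the index set; the leading two entries are the pair whose
    kernel is integrated.\<close>
  have U4: "(UNIV :: 4 set) = {1, 2, 3, 4}" "(UNIV :: 4 set) = {3, 4, 1, 2}" using UNIV_4 by auto
  have "\<exists>U h. open U \<and> z0 \<in> U \<and> U \<subseteq> V \<and> smooth_on U (h :: _ \<Rightarrow> real \<times> real) \<and>
    (\<forall>y\<in>U. \<forall>v. frechet_derivative h (at y) v = 0 \<longleftrightarrow> e 1 y v = 0 \<and> e 2 y v = 0)"
  proof (rule first_integrals[OF V z0 e_smooth e_lin _ U4(1)])
    show "u = 0" if "\<And>i. e i z0 u = 0" for u using that by (rule inj[OF z0])
    show "frechet_derivative (\<lambda>z. e i z w) (at y) u = frechet_derivative (\<lambda>z. e i z u) (at y) w"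
      if "i \<in> {1, 2}" "y \<in> V" "e 1 y u = 0" "e 2 y u = 0" "e 1 y w = 0" "e 2 y w = 0" for i y u w
      by (rule integrable[OF w12[OF that(1)] _ that(2-6)]) simp
  qed simp_all
  then obtain U1 h where h: "open U1" "z0 \<in> U1" "U1 \<subseteq> V" "smooth_on U1 (h :: _ \<Rightarrow> real \<times> real)"
    "\<forall>y\<in>U1. \<forall>v. frechet_derivative h (at y) v = 0 \<longleftrightarrow> e 1 y v = 0 \<and> e 2 y v = 0" by blast
  have "\<exists>U h. open U \<and> z0 \<in> U \<and> U \<subseteq> V \<and> smooth_on U (h :: _ \<Rightarrow> real \<times> real) \<and>
    (\<forall>y\<in>U. \<forall>v. frechet_derivative h (at y) v = 0 \<longleftrightarrow> e 3 y v = 0 \<and> e 4 y v = 0)"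
  proof (rule first_integrals[OF V z0 e_smooth e_lin _ U4(2)])
    show "u = 0" if "\<And>i. e i z0 u = 0" for u using that by (rule inj[OF z0])
    show "frechet_derivative (\<lambda>z. e i z w) (at y) u = frechet_derivative (\<lambda>z. e i z u) (at y) w"
      if "i \<in> {3, 4}" "y \<in> V" "e 3 y u = 0" "e 4 y u = 0" "e 3 y w = 0" "e 4 y w = 0" for i y u w
      by (rule integrable[OF w34[OF that(1)] _ that(2-6)]) simp
  qed simp_all
  then obtain U2 k where k: "open U2" "z0 \<in> U2" "U2 \<subseteq> V" "smooth_on U2 (k :: _ \<Rightarrow> real \<times> real)"
    "\<forall>y\<in>U2. \<forall>v. frechet_derivative k (at y) v = 0 \<longleftrightarrow> e 3 y v = 0 \<and> e 4 y v = 0" by blast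
  define U where "U = U1 \<inter> U2"
  have U: "open U" "z0 \<in> U" "U \<subseteq> V" using h k by (auto simp: U_def)
  have hU: "smooth_on U h" and kU: "smooth_on U k"
    using smooth_on_subset[OF h(4)] smooth_on_subset[OF k(4)] by (auto simp: U_def)
  define \<psi> :: "real ^ 4 \<Rightarrow> real ^ 4" where
    "\<psi> y = (\<chi> i. if i = 1 then fst (h y) else if i = 2 then snd (h y) else if i = 3 then fst (k y) else snd (k y))" for y
  have \<psi>_nth: "\<psi> y $ 1 = fst (h y)" "\<psi> y $ 2 = snd (h y)" "\<psi> y $ 3 = fst (k y)" "\<psi> y $ 4 = snd (k y)" for y
    by (simp_all add: \<psi>_def)
  have \<psi>: "smooth_on U \<psi>"
  proof (rule smooth_on_vec[OF U(1)])
    fix i :: 4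
    have "\<forall>i. smooth_on U (\<lambda>y. \<psi> y $ i)"
      unfolding forall_4 \<psi>_nth
      by (intro conjI smooth_on_linear_compose[OF bounded_linear_fst] smooth_on_linear_compose[OF bounded_linear_snd] U(1) hU kU)
    then show "smooth_on U (\<lambda>y. \<psi> y $ i)" by blast
  qed
  have d\<psi>: "frechet_derivative \<psi> (at y) v $ 1 = fst (frechet_derivative h (at y) v)"
    "frechet_derivative \<psi> (at y) v $ 2 = snd (frechet_derivative h (at y) v)"
    "frechet_derivative \<psi> (at y) v $ 3 = fst (frechet_derivative k (at y) v)"
    "frechet_derivative \<psi> (at y) v $ 4 = snd (frechet_derivative k (at y) v)" if "y \<in> U" for y v
  proof -
    have n: "((\<lambda>y. \<psi> y $ i) has_derivative (\<lambda>v. frechet_derivative \<psi> (at y) v $ i)) (at y)" for i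
      by (rule bounded_linear.has_derivative[OF bounded_linear_vec_nth smooth_on_has_derivative[OF \<psi> that]])
    note hd = smooth_on_has_derivative[OF hU that] and kd = smooth_on_has_derivative[OF kU that]
    note fs = bounded_linear.has_derivative[OF bounded_linear_fst] bounded_linear.has_derivative[OF bounded_linear_snd]
    show "frechet_derivative \<psi> (at y) v $ 1 = fst (frechet_derivative h (at y) v)"
      by (rule fun_cong[OF has_derivative_unique[OF n[of 1, unfolded \<psi>_nth] fs(1)[OF hd]]])
    show "frechet_derivative \<psi> (at y) v $ 2 = snd (frechet_derivative h (at y) v)"
      by (rule fun_cong[OF has_derivative_unique[OF n[of 2, unfolded \<psi>_nth] fs(2)[OF hd]]])
    show "frechet_derivative \<psi> (at y) v $ 3 = fst (frechet_derivative k (at y) v)"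
      by (rule fun_cong[OF has_derivative_unique[OF n[of 3, unfolded \<psi>_nth] fs(1)[OF kd]]])
    show "frechet_derivative \<psi> (at y) v $ 4 = snd (frechet_derivative k (at y) v)"
      by (rule fun_cong[OF has_derivative_unique[OF n[of 4, unfolded \<psi>_nth] fs(2)[OF kd]]])
  qed
  have ker12: "frechet_derivative \<psi> (at y) v $ 1 = 0 \<and> frechet_derivative \<psi> (at y) v $ 2 = 0 \<longleftrightarrow> e 1 y v = 0 \<and> e 2 y v = 0" if "y \<in> U" for y v
    using h(5) that by (auto simp: d\<psi>[OF that] U_def prod_eq_iff)
  have ker34: "frechet_derivative \<psi> (at y) v $ 3 = 0 \<and> frechet_derivative \<psi> (at y) v $ 4 = 0 \<longleftrightarrow> e 3 y v = 0 \<and> e 4 y v = 0" if "y \<in> U" for y v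
    using k(5) that by (auto simp: d\<psi>[OF that] U_def prod_eq_iff)
  \<comment> \<open>A vector killed by the derivative lies in both kernels, hence is killed by the
    whole coframe. This transversality makes the four functions coordinates.\<close>
  have inj\<psi>: "inj (frechet_derivative \<psi> (at z0))"
    unfolding linear_injective_0[OF has_derivative_linear[OF smooth_on_has_derivative[OF \<psi> U(2)]]]
  proof (intro allI impI)
    fix v assume "frechet_derivative \<psi> (at z0) v = 0"
    then have "e 1 z0 v = 0 \<and> e 2 z0 v = 0" "e 3 z0 v = 0 \<and> e 4 z0 v = 0"
      using ker12[OF U(2), of v] ker34[OF U(2), of v] by simp_all
    then have "\<forall>i. e i z0 v = 0" unfolding forall_4 by simp
    then show "v = 0" using inj[OF z0] by blast
  qed
  show ?thesis
  proof (rule smooth_inverse_function[OF U(1,2) \<psi> inj\<psi>])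
    fix U' V' \<gamma>
    assume U': "open U'" "z0 \<in> U'" "U' \<subseteq> U" "open V'" and hom: "homeomorphism U' V' \<psi> \<gamma>" and \<gamma>: "smooth_on V' \<gamma>"
      "\<And>y. y \<in> V' \<Longrightarrow> (\<gamma> has_derivative inv (frechet_derivative \<psi> (at (\<gamma> y)))) (at y)"
      "\<And>y. y \<in> V' \<Longrightarrow> bij (frechet_derivative \<psi> (at (\<gamma> y)))"
    have U'_sub: "U' \<subseteq> snd a ` fst a" using U'(3) U(3) by (auto simp: V_def)
    define c where "c = ({p \<in> fst a. snd a p \<in> U'}, \<lambda>p. \<psi> (snd a p))"
    note lc = local_coords_compose[OF sm a(1) U'(1) U'_sub U'(4) hom smooth_on_subset[OF \<psi> U'(3)] \<gamma>(1), folded c_def]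
    have xc: "x \<in> fst c" using a(2) U'(2) by (simp add: c_def z0_def)
    have "component g c y \<alpha> \<beta> = 0" if y: "y \<in> V'" and \<alpha>\<beta>: "(\<alpha>, \<beta>) \<in> {(1, 3), (1, 4), (2, 3), (2, 4)}" for y and \<alpha> \<beta> :: 4
    proof -
      have \<gamma>y: "\<gamma> y \<in> U'" using homeomorphism_image2[OF hom] y by blast
      then have \<gamma>U: "\<gamma> y \<in> U" and \<gamma>V: "\<gamma> y \<in> V" using U'(3) U(3) by auto
      \<comment> \<open>The coordinate vectors of the new chart, expressed in the chart
        \<open>a\<close>.\<close>
      let ?u = "\<lambda>\<alpha>. inv (frechet_derivative \<psi> (at (\<gamma> y))) (axis \<alpha> 1)"
      have u: "frechet_derivative \<psi> (at (\<gamma> y)) (?u \<alpha>) = axis \<alpha> 1" for \<alpha>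
        using \<gamma>(3)[OF y] by (simp add: bij_is_surj surj_f_inv_f)
      have dt: "frechet_derivative (transition c a) (at y) = inv (frechet_derivative \<psi> (at (\<gamma> y)))"
        by (rule frechet_derivative_eqI[OF has_derivative_transform_within_open[OF \<gamma>(2)[OF y] U'(4) y]]) (simp add: lc(3))
      have "y \<in> snd c ` (fst c \<inter> fst a \<inter> topspace X)"
        using y lc(2) openin_subset[OF local_coords_open[OF a']] by (force simp: c_def)
      then have "component g c y \<alpha> \<beta> = g a (transition c a y) (\<lambda>i. frechet_derivative (transition c a) (at y) (if i = 0 then axis \<alpha> 1 else axis \<beta> 1))"
        using rm lc(1) a' unfolding riemannian_metric_def tensor_field_on_def component_def by blast
      also have "\<dots> = (\<Sum>i\<in>UNIV. e i (\<gamma> y) (?u \<alpha>) * e i (\<gamma> y) (?u \<beta>))"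
        by (simp add: lc(3)[OF y] metric[OF \<gamma>V] dt)
      also have "\<dots> = 0"
        \<comment> \<open>With \<alpha> in the first block and \<beta> in the second, members 1 and
          2 vanish on \<open>?u \<beta>\<close> and members 3 and 4 on
          \<open>?u \<alpha>\<close>.\<close>
        using \<alpha>\<beta> ker12[OF \<gamma>U, of "?u \<beta>"] ker34[OF \<gamma>U, of "?u \<alpha>"] unfolding u sum_4 by (auto simp: axis_def)
      finally show ?thesis .
    qed
    then have "\<forall>y\<in>snd c ` fst c. \<forall>(\<alpha>, \<beta>)\<in>{(1, 3), (1, 4), (2, 3), (2, 4)}. component g c y \<alpha> \<beta> = 0"
      unfolding lc(2) by simp
    with xc show ?thesis unfolding block_diagonalisable_near_def by (intro bexI[OF conjI lc(1)])
  qed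
qed

theorem proposition3p1:
  fixes X :: "'a topology" and A :: "('a, 4) chart set" and g :: "('a, 4) tensor" and x :: 'a
  assumes "smooth_manifold X A"
    and "riemannian_metric X A g"
    and "x \<in> topspace X"
  shows "block_diagonalisable_near X A g x \<longleftrightarrow>
    (\<exists>W \<epsilon>. openin X W \<and> x \<in> W \<and> orthonormal_coframe_on X A g W \<epsilon> \<and>
       tensor_eq_on X A W (wedge 2 2 (wedge 1 1 (\<epsilon> 1) (\<epsilon> 2)) (ext_deriv 1 (\<epsilon> 1))) zero_tensor \<and>
       tensor_eq_on X A W (wedge 2 2 (wedge 1 1 (\<epsilon> 1) (\<epsilon> 2)) (ext_deriv 1 (\<epsilon> 2))) zero_tensor \<and>
       tensor_eq_on X A W (wedge 2 2 (wedge 1 1 (\<epsilon> 3) (\<epsilon> 4)) (ext_deriv 1 (\<epsilon> 3))) zero_tensor \<and>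
       tensor_eq_on X A W (wedge 2 2 (wedge 1 1 (\<epsilon> 3) (\<epsilon> 4)) (ext_deriv 1 (\<epsilon> 4))) zero_tensor)"
    (is "_ \<longleftrightarrow> ?R")
proof
  assume "block_diagonalisable_near X A g x"
  then obtain c where c: "c \<in> local_coords X A" "x \<in> fst c"
    "\<forall>y\<in>snd c ` fst c. \<forall>(\<alpha>, \<beta>)\<in>{(1, 3), (1, 4), (2, 3), (2, 4)}. component g c y \<alpha> \<beta> = 0"
    unfolding block_diagonalisable_near_def by blast
  have "component g c y \<alpha> \<beta> = 0"
    if "y \<in> snd c ` fst c" "(\<alpha>, \<beta>) \<in> {(1, 3), (1, 4), (2, 3), (2, 4)}" for y \<alpha> \<beta>
    using bspec[OF bspec[OF c(3) that(1)] that(2)] by simp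
  \<comment> \<open>The domain of the block-diagonalising chart serves as the neighbourhood
    \<open>W\<close>.\<close>
  from block_diagonal_imp_coframe[OF assms(1,2) c(1) this] local_coords_open[OF c(1)] c(2)
  show ?R by blast
next
  assume ?R
  then obtain W \<epsilon> where W: "openin X W" "x \<in> W" "orthonormal_coframe_on X A g W \<epsilon>"
    "tensor_eq_on X A W (wedge 2 2 (wedge 1 1 (\<epsilon> 1) (\<epsilon> 2)) (ext_deriv 1 (\<epsilon> 1))) zero_tensor"
    "tensor_eq_on X A W (wedge 2 2 (wedge 1 1 (\<epsilon> 1) (\<epsilon> 2)) (ext_deriv 1 (\<epsilon> 2))) zero_tensor"
    "tensor_eq_on X A W (wedge 2 2 (wedge 1 1 (\<epsilon> 3) (\<epsilon> 4)) (ext_deriv 1 (\<epsilon> 3))) zero_tensor"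
    "tensor_eq_on X A W (wedge 2 2 (wedge 1 1 (\<epsilon> 3) (\<epsilon> 4)) (ext_deriv 1 (\<epsilon> 4))) zero_tensor" by blast
  show "block_diagonalisable_near X A g x"
    by (rule coframe_imp_block_diagonalisable[OF assms(1,2) W(1-3)]) (use W(4-7) in auto)
qed

end
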